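(* Let $N\ge1$ be an integer, $p>1$, $q>1$, $\alpha>0$. Assume that either $p>2$, or $p<2$ and $\alpha<\frac{p}{2-p}$. Let $q^\ast=\frac{N(p-1)+p}{N-p}$ if $p<N$ and $q^\ast=\infty$ if $N\le p$. For $a\in\mathbb{R}$ let $w(\cdot,a)$ be the solution of $$(|w'|^{p-2}w')'+\frac{N-1}{r}|w'|^{p-2}w'+rw'+\alpha w+|w|^{q-1}w=0\ \text{ in }(0,\infty),\qquad w(0)=a,\quad w'(0)=0,$$ let $L(a)=\lim_{r\to\infty}r^\alpha w(r,a)$, and let $Z(a)$ denote the number of isolated zeros of $w(\cdot,a)$. (i) Suppose that for some $a_0>0$, $w(\cdot,a_0)$ has a finite number $Z(a_0)$ of isolated zeros. If $L(a_0)\ne0$, then $Z(a)=Z(a_0)$ for any $a$ close to $a_0$. (ii) Suppose $q<q^\ast$. Then $\{a>0:L(a)=0\}$ is unbounded from above. Moreover there exists an increasing sequence $(a_m)$ tending to $\infty$ such that $w(\cdot,a_m)$ has at least $m+1$ isolated zeros and $L(a_m)=0$. (iii) Suppose $q<q^\ast$, $p<2$ and $\alpha<N$. Then for any $m\in\mathbb{N}$ (including $m=0$), $$\bar a_m=\inf\{a>0:Z(a)\ge m+1\}\in(0,\infty),$$ and if $m\ge1$, then $w(\cdot,\bar a_m)$ has precisely $m$ zeros and $L(\bar a_m)=0$.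
   Context: For every $a\in\mathbb{R}$ the initial value problem has a unique solution $w(\cdot,a)\in C^1([0,\infty))$ with $|w'|^{p-2}w'\in C^1([0,\infty))$, and the limit $L(a)\in\mathbb{R}$ exists under the stated assumption on $p,\alpha$. *)

theory Defs
  imports "HOL-Analysis.Analysis" "HOL-Library.Extended_Nat"
begin

(* The map s |-> |s|^(p-2) s.  For s = 0 the value is 0 also when p < 2, since 0 powr x = 0. *)
definition pflux :: "real \<Rightarrow> real \<Rightarrow> real" where
  "pflux p s = \<bar>s\<bar> powr (p - 2) * s"

(* u solves the initial value problem with u(0) = a, u'(0) = 0, where du = u' and
   dv = (|u'|^(p-2) u')' are continuous on [0,\<infinity>).  Derivatives are one-sided at 0, so values
   of u at negative arguments are irrelevant. *)
definition is_solution :: "nat \<Rightarrow> real \<Rightarrow> real \<Rightarrow> real \<Rightarrow> real \<Rightarrow> (real \<Rightarrow> real) \<Rightarrow> bool" where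
  "is_solution N p q \<alpha> a u \<longleftrightarrow>
     (\<exists>du dv.
        continuous_on {0..} du \<and>
        continuous_on {0..} dv \<and>
        (\<forall>r\<ge>0. (u has_real_derivative du r) (at r within {0..})) \<and>
        (\<forall>r\<ge>0. ((\<lambda>s. pflux p (du s)) has_real_derivative dv r) (at r within {0..})) \<and>
        (\<forall>r>0. dv r + (real N - 1) / r * pflux p (du r) + r * du r + \<alpha> * u r
                 + \<bar>u r\<bar> powr (q - 1) * u r = 0) \<and>
        u 0 = a \<and> du 0 = 0)"

definition zeros :: "(real \<Rightarrow> real) \<Rightarrow> real set" where
  "zeros u = {r. 0 \<le> r \<and> u r = 0}"

(* For p > 2 solutions may vanish on a whole half-line, whose points are not isolated zeros. *)
definition isolated_zeros :: "(real \<Rightarrow> real) \<Rightarrow> real set" where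
  "isolated_zeros u = {r. r isolated_in zeros u}"

definition num_isolated_zeros :: "(real \<Rightarrow> real) \<Rightarrow> enat" where
  "num_isolated_zeros u =
     (if finite (isolated_zeros u) then enat (card (isolated_zeros u)) else \<infinity>)"

definition decay_limit :: "real \<Rightarrow> (real \<Rightarrow> real) \<Rightarrow> real" where
  "decay_limit \<alpha> u = Lim at_top (\<lambda>r. r powr \<alpha> * u r)"

definition qstar :: "nat \<Rightarrow> real \<Rightarrow> ereal" where
  "qstar N p = (if p < real N then ereal ((real N * (p - 1) + p) / (real N - p)) else \<infinity>)"

end

theory Submission
  imports Defs "HOL-Real_Asymp.Real_Asymp" "HOL-Complex_Analysis.Great_Picard"
    "HOL-Library.Diagonal_Subsequence"
begin

text \<open>
  With \<open>v = \<bar>w'\<bar>^(p-2) w'\<close> the equation is a first order system whose energy decreases. The function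
  \<open>J = r^\<alpha> (w + v/r)\<close> has derivative \<open>r^(\<alpha>-1) ((\<alpha>-N) v/r - \<bar>w\<bar>^(q-1) w)\<close>; a bootstrap between
  this identity and barriers for \<open>v\<close> gives \<open>w = O(r^-\<alpha>)\<close> and \<open>r^\<alpha> w \<rightarrow> L(a)\<close>, uniformly for bounded \<open>a\<close>.
  Solutions depend Lipschitz continuously on \<open>a > 0\<close> on bounded intervals, and all zeros before a point
  where \<open>w \<noteq> 0\<close> are simple, so the zeros are stable as long as \<open>L(a) \<noteq> 0\<close>: this is (i).

  For (ii), \<open>w\<close> rescaled to initial value 1 converges, as \<open>a \<rightarrow> \<infinity>\<close>, along subsequences to a solution of the
  Emden-Fowler equation. The Pohozaev function of that solution increases since \<open>q < q*\<close>, while a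
  solution of eventually constant sign would decay so fast that it tends to 0; hence the limit oscillates
  and \<open>Z(a) \<rightarrow> \<infinity>\<close>. As \<open>Z\<close> is finite and locally constant where \<open>L \<noteq> 0\<close>, \<open>L\<close> must vanish for arbitrarily
  large \<open>a\<close>.

  For (iii), if \<open>\<alpha> < N\<close> then \<open>r^(N-1) v + r^N w\<close> increases where \<open>w\<close> is positive and small, so a solution that is
  small from some point on has at most one zero there. Thus \<open>Z\<close> jumps by at most one at the
  threshold, and it is constant near the threshold unless \<open>L\<close> vanishes there.
\<close>

subsection \<open>Comparison principles and the power maps\<close>

text \<open>The obstacle is \<open>\<phi>\<close>: for \<open>p > 2\<close> its slope at 0 is
  infinite, so the system is not Lipschitz where \<open>v\<close> vanishes, and a nonzero solution
  may vanish from some radius on. A Gronwall argument that uses a derivative of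
  \<open>\<phi>\<close> is therefore run only near \<open>r = 0\<close>, where \<open>v\<close> lies
  between two negative multiples of \<open>r\<close>; further out only the monotonicity of
  \<open>\<phi>\<close> is used. Monotone quantities take the place of backward uniqueness: energy
  that is positive at a point with \<open>w \<noteq> 0\<close> makes all earlier zeros simple, and
  the positive Pohozaev function excludes double zeros of the limit problem. The assumption on
  \<open>p\<close> and \<open>\<alpha>\<close> enters as \<open>\<alpha> * (2 - p) < p\<close>. This
  says that \<open>v / r\<close>, with \<open>v\<close> of order
  \<open>r powr - ((\<alpha> + 1) * (p - 1))\<close>, is negligible against
  \<open>r powr - \<alpha>\<close>. No integrals occur. Each integration is a comparison of
  derivatives with an explicit antiderivative, and most a priori bounds say that a difference of two
  squares cannot reach 0.\<close>

text \<open>At a first zero of \<open>h\<close> the derivative cannot be positive, since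
  \<open>h\<close> is positive to the left of it. The premise \<open>cross\<close> may use
  positivity on the whole past, so bounds that depend on the history of a solution can be fed in. A
  typical \<open>h\<close> is the square of a bound minus the square of the bounded
  quantity.\<close>

lemma barrier:
  fixes h h' :: "real \<Rightarrow> real"
  assumes cont: "continuous_on {x..y} h" and pos: "h x > 0"
    and der: "\<And>r. x < r \<Longrightarrow> r \<le> y \<Longrightarrow> (h has_real_derivative h' r) (at r)"
    and cross: "\<And>r. \<lbrakk>x < r; r \<le> y; h r = 0; \<And>s. x \<le> s \<Longrightarrow> s < r \<Longrightarrow> h s > 0\<rbrakk> \<Longrightarrow> h' r > 0"
    and "x \<le> y"
  shows "h y > 0"
proof (rule ccontr)
  assume "\<not> h y > 0"
  define T where "T = {s \<in> {x..y}. h s \<le> 0}"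
  have "closed T"
    using continuous_on_closed_Collect_le[OF cont continuous_on_const, of 0] by (simp add: T_def)
  then have "compact T"
    unfolding T_def by (metis (no_types, lifting) bounded_closed_interval bounded_subset
        compact_eq_bounded_closed mem_Collect_eq subsetI)
  moreover have "T \<noteq> {}"
    using \<open>\<not> h y > 0\<close> \<open>x \<le> y\<close> by (auto simp: T_def)
  ultimately obtain t where t: "t \<in> T" "\<And>s. s \<in> T \<Longrightarrow> t \<le> s"
    by (meson compact_attains_inf)
  have tx: "t > x" "t \<le> y" "h t \<le> 0"
    using t(1) pos by (auto simp: T_def order.order_iff_strict)
  have before: "h s > 0" if "x \<le> s" "s < t" for s
    using t(2)[of s] that tx by (force simp: T_def)
  have "h t = 0"
  proof (rule ccontr)
    assume "h t \<noteq> 0"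
    then have "h t < 0" using tx by auto
    have "continuous_on {x..t} h"
      using cont by (rule continuous_on_subset) (use tx in auto)
    then obtain s where "x \<le> s" "s \<le> t" "h s = 0"
      using IVT2'[of h t 0 x] \<open>h t < 0\<close> pos tx by auto
    then show False using before[of s] \<open>h t \<noteq> 0\<close> by (cases "s = t") auto
  qed
  then have "h' t > 0"
    using cross[OF tx(1,2)] before by auto
  then obtain d where d: "d > 0" "\<And>y. y > 0 \<Longrightarrow> y < d \<Longrightarrow> h (t - y) < h t"
    using DERIV_pos_inc_left[OF der[OF tx(1,2)]] by auto
  have "h (t - min (d/2) ((t - x)/2)) < 0"
    using d(2)[of "min (d/2) ((t - x)/2)"] d(1) tx \<open>h t = 0\<close> by auto
  moreover have "h (t - min (d/2) ((t - x)/2)) > 0"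
    using d(1) tx by (intro before) (auto simp: min_def field_simps)
  ultimately show False by simp
qed

text \<open>Plays the role of integrating \<open>F' \<le> G'\<close>, with \<open>G\<close> an
  explicit antiderivative of the bound. Derivatives are required only in the interior, so the
  singular point \<open>r = 0\<close> is allowed as an endpoint.\<close>

lemma deriv_dominated:
  fixes F G F' G' :: "real \<Rightarrow> real"
  assumes "x \<le> y" "continuous_on {x..y} F" "continuous_on {x..y} G"
    and "\<And>r. x < r \<Longrightarrow> r < y \<Longrightarrow> (F has_real_derivative F' r) (at r)"
    and "\<And>r. x < r \<Longrightarrow> r < y \<Longrightarrow> (G has_real_derivative G' r) (at r)"
    and "\<And>r. x < r \<Longrightarrow> r < y \<Longrightarrow> F' r \<le> G' r"
  shows "F y - F x \<le> G y - G x"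
proof (cases "x = y")
  case False
  have "G x - F x \<le> G y - F y"
  proof (rule DERIV_nonneg_imp_increasing_open[of x y "\<lambda>r. G r - F r"])
    show "\<exists>d. ((\<lambda>r. G r - F r) has_real_derivative d) (at r) \<and> 0 \<le> d" if "x < r" "r < y" for r
      using assms that by (intro exI[of _ "G' r - F' r"]) (auto intro!: derivative_intros)
  qed (use assms in \<open>auto intro!: continuous_intros\<close>)
  then show ?thesis by auto
qed auto

lemma deriv_abs_dominated:
  fixes F G F' G' :: "real \<Rightarrow> real"
  assumes "x \<le> y" "continuous_on {x..y} F" "continuous_on {x..y} G"
    and "\<And>r. x < r \<Longrightarrow> r < y \<Longrightarrow> (F has_real_derivative F' r) (at r)"
    and "\<And>r. x < r \<Longrightarrow> r < y \<Longrightarrow> (G has_real_derivative G' r) (at r)"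
    and "\<And>r. x < r \<Longrightarrow> r < y \<Longrightarrow> \<bar>F' r\<bar> \<le> G' r"
  shows "\<bar>F y - F x\<bar> \<le> G y - G x"
proof -
  have "F y - F x \<le> G y - G x"
    by (rule deriv_dominated[where F' = F' and G' = G'])
      (use assms in \<open>auto simp: abs_le_iff\<close>)
  moreover have "- F y - (- F x) \<le> G y - G x"
    using deriv_dominated[of x y "\<lambda>r. - F r" G "\<lambda>r. - F' r" G'] assms
    by (auto simp: abs_le_iff intro!: DERIV_minus continuous_on_minus)
  ultimately show ?thesis by auto
qed

section \<open>The odd power map, its inverse and its regularity\<close>

lemma pflux_0 [simp]: "pflux e 0 = 0"
  by (simp add: pflux_def)

lemma pflux_minus: "pflux e (- x) = - pflux e x"
  by (simp add: pflux_def)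

lemma pflux_of_pos: "x > 0 \<Longrightarrow> pflux e x = x powr (e - 1)"
  by (simp add: pflux_def powr_diff power2_eq_square)

lemma mult_pflux: "x * pflux e x = \<bar>x\<bar> powr e"
  by (cases "x = 0") (simp_all add: pflux_def powr_diff power2_eq_square abs_if field_simps)

lemma pflux_scale: "c > 0 \<Longrightarrow> pflux e (c * x) = c powr (e - 1) * pflux e x"
  by (simp add: pflux_def powr_mult abs_mult powr_diff power2_eq_square)

lemma pflux_pos_iff [simp]: "pflux e x > 0 \<longleftrightarrow> x > 0"
  and pflux_neg_iff [simp]: "pflux e x < 0 \<longleftrightarrow> x < 0"
  and pflux_eq_0_iff [simp]: "pflux e x = 0 \<longleftrightarrow> x = 0"
  by (auto simp: pflux_def zero_less_mult_iff mult_less_0_iff)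

lemma abs_pflux: "\<bar>pflux e x\<bar> = \<bar>x\<bar> powr (e - 1)"
  by (cases x "0::real" rule: linorder_cases)
    (use pflux_of_pos[of "- x" e] pflux_neg_iff[of e x] in
      \<open>auto simp: pflux_of_pos pflux_minus abs_if not_less\<close>)

text \<open>The exponents are inverse to each other: \<open>(p - 1) * (p / (p - 1) - 1) = 1\<close>.
  This allows the flux to replace \<open>w'\<close> as an unknown.\<close>

lemma pflux_pflux:
  assumes "p > 1"
  shows "pflux (p / (p - 1)) (pflux p x) = x"
proof -
  have *: "pflux (p / (p - 1)) (pflux p x) = x" if "x > 0" for x
  proof -
    have "pflux p x > 0" using that by simp
    then have "pflux (p / (p - 1)) (pflux p x) = (x powr (p - 1)) powr (p / (p - 1) - 1)"
      using that by (simp add: pflux_of_pos)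
    also have "\<dots> = x"
      using assms that by (simp add: powr_powr field_simps)
    finally show ?thesis .
  qed
  show ?thesis
    using *[of x] *[of "- x"] by (cases x "0::real" rule: linorder_cases) (auto simp: pflux_minus)
qed

lemma pflux_strict_mono:
  assumes "e > 1" "x < y"
  shows "pflux e x < pflux e y"
proof -
  consider "0 < x" | "x \<le> 0" "0 \<le> y" | "y < 0" by linarith
  then show ?thesis
  proof cases
    case 1
    then show ?thesis using assms by (simp add: pflux_of_pos powr_less_mono2)
  next
    case 2
    have "pflux e x \<le> 0" "pflux e y \<ge> 0"
      using 2 by (meson not_le pflux_neg_iff pflux_pos_iff)+
    moreover have "pflux e x \<noteq> 0 \<or> pflux e y \<noteq> 0"
      using assms(2) by auto
    ultimately show ?thesis by linarith
  next
    case 3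
    then have "pflux e (- y) < pflux e (- x)"
      using assms by (simp add: pflux_of_pos powr_less_mono2 del: pflux_minus)
    then show ?thesis by (simp add: pflux_minus)
  qed
qed

lemma has_real_derivative_zero_powr:
  fixes F :: "real \<Rightarrow> real"
  assumes "d > 0" "\<And>x. \<bar>F x\<bar> \<le> \<bar>x\<bar> powr d * \<bar>x\<bar>"
  shows "(F has_real_derivative 0) (at 0)"
proof -
  have F0: "F 0 = 0" using assms(2)[of 0] by simp
  have "((\<lambda>x::real. \<bar>x\<bar> powr d) \<longlongrightarrow> 0) (at 0)"
    using assms(1) by (auto intro!: tendsto_eq_intros tendsto_powr2)
  then have "((\<lambda>h. (F (0 + h) - F 0) / h) \<longlongrightarrow> 0) (at 0)"
    by (rule Lim_null_comparison[rotated])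
      (use assms(2) F0 in \<open>auto simp: eventually_at_filter divide_le_eq\<close>)
  then show ?thesis by (simp add: DERIV_def)
qed

lemma has_derivative_abs_powr:
  assumes "e > 1"
  shows "((\<lambda>x. \<bar>x\<bar> powr e) has_real_derivative e * pflux e x) (at x)"
proof (cases x "0::real" rule: linorder_cases)
  case equal
  have "\<bar>\<bar>x\<bar> powr e\<bar> \<le> \<bar>x\<bar> powr (e - 1) * \<bar>x\<bar>" for x :: real
    by (cases "x = 0") (auto simp: powr_diff)
  then show ?thesis
    using has_real_derivative_zero_powr[of "e - 1" "\<lambda>x. \<bar>x\<bar> powr e"] assms equal by auto
next
  case greater
  have "((\<lambda>x. x powr e) has_real_derivative e * pflux e x) (at x)"
    using greater by (auto intro!: derivative_eq_intros simp: pflux_of_pos powr_diff)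
  then show ?thesis
    using greater
    by (elim has_field_derivative_transform_within[of _ _ _ _ x]) (auto simp: dist_real_def)
next
  case less
  have "((\<lambda>x. (- x) powr e) has_real_derivative e * pflux e x) (at x)"
    using less pflux_of_pos[of "- x" e]
    by (auto intro!: derivative_eq_intros simp: pflux_minus powr_diff)
  then show ?thesis
    using less
    by (elim has_field_derivative_transform_within[of _ _ _ _ "- x"]) (auto simp: dist_real_def)
qed

text \<open>At 0 the slope is infinite for \<open>1 < e < 2\<close>, and for \<open>e = 2\<close>
  the formula would give \<open>0 powr 0 = 0\<close> instead of 1; hence \<open>e > 2\<close> at
  that point.\<close>

lemma has_derivative_pflux:
  assumes "x \<noteq> 0 \<or> e > 2"
  shows "(pflux e has_real_derivative (e - 1) * \<bar>x\<bar> powr (e - 2)) (at x)"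
proof (cases x "0::real" rule: linorder_cases)
  case equal
  have "\<bar>pflux e x\<bar> \<le> \<bar>x\<bar> powr (e - 2) * \<bar>x\<bar>" for x :: real
    by (auto simp: pflux_def abs_mult)
  then show ?thesis
    using has_real_derivative_zero_powr[of "e - 2" "pflux e"] assms equal by auto
next
  case greater
  have "((\<lambda>x. x powr (e - 1)) has_real_derivative (e - 1) * x powr (e - 2)) (at x)"
    using has_real_derivative_powr[OF greater, of "e - 1"] by (simp add: algebra_simps)
  then show ?thesis
    using greater unfolding abs_of_pos[OF greater]
    by (elim has_field_derivative_transform_within[of _ _ _ _ x])
      (auto simp: dist_real_def pflux_of_pos)
next
  case less
  have "((\<lambda>x. x powr (e - 1)) has_real_derivative (e - 1) * \<bar>x\<bar> powr (e - 2)) (at (- x))"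
    using has_real_derivative_powr[of "- x" "e - 1"] less by (simp add: algebra_simps)
  from DERIV_minus[OF this[unfolded DERIV_mirror]]
  have "((\<lambda>x. - ((- x) powr (e - 1))) has_real_derivative (e - 1) * \<bar>x\<bar> powr (e - 2)) (at x)"
    by simp
  moreover have "- ((- y) powr (e - 1)) = pflux e y" if "y < 0" for y
    using pflux_of_pos[of "- y" e] that by (simp add: pflux_minus)
  ultimately show ?thesis
    using less
    by (elim has_field_derivative_transform_within[of _ _ _ _ "- x"])
      (auto simp: dist_real_def)
qed

lemma isCont_pflux:
  assumes "e > 1"
  shows "isCont (pflux e) x"
proof (cases "x = 0")
  case True
  have "((\<lambda>x::real. \<bar>x\<bar> powr (e - 1)) \<longlongrightarrow> 0) (at 0)"
    using assms by (auto intro!: tendsto_eq_intros tendsto_powr2)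
  then have "(pflux e \<longlongrightarrow> 0) (at 0)"
    by (rule Lim_null_comparison[rotated]) (auto simp: abs_pflux)
  then show ?thesis using True by (simp add: isCont_def)
next
  case False
  then show ?thesis using has_derivative_pflux[of x e] DERIV_isCont by blast
qed

lemma continuous_on_pflux [continuous_intros]:
  assumes "e > 1" "continuous_on S f"
  shows "continuous_on S (\<lambda>x. pflux e (f x))"
  by (rule continuous_on_compose2[of UNIV "pflux e"])
    (use assms isCont_pflux in \<open>auto simp: continuous_at_imp_continuous_on\<close>)

lemma pflux_lipschitz:
  assumes "e > 2" "\<bar>x\<bar> \<le> M" "\<bar>y\<bar> \<le> M"
  shows "\<bar>pflux e x - pflux e y\<bar> \<le> (e - 1) * M powr (e - 2) * \<bar>x - y\<bar>"
proof -
  have "norm (pflux e x - pflux e y) \<le> ((e - 1) * M powr (e - 2)) * norm (x - y)"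
  proof (rule field_differentiable_bound[of "{-M..M}"])
    show "(pflux e has_field_derivative (e - 1) * \<bar>z\<bar> powr (e - 2)) (at z within {- M..M})" for z
      using has_derivative_pflux[of z e] assms has_field_derivative_at_within by blast
    show "norm ((e - 1) * \<bar>z\<bar> powr (e - 2)) \<le> (e - 1) * M powr (e - 2)" if "z \<in> {- M..M}" for z
      using assms that by (auto simp: abs_mult intro!: mult_left_mono powr_mono2)
  qed (use assms in auto)
  then show ?thesis by simp
qed

subsection \<open>The ODE system and its energy\<close>

text \<open>Here \<open>k = N - 1\<close>, and \<open>\<phi>\<close> below is the inverse of \<open>pflux p\<close>. The original problem is \<open>\<epsilon> = 1\<close>; rescaling to initial
  value 1 turns it into \<open>\<epsilon> = a^(1-q)\<close>, with the Emden-Fowler limit \<open>\<epsilon> = 0\<close>.\<close>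

locale plap =
  fixes k :: nat and p q \<alpha> :: real
  assumes p: "1 < p" and q: "1 < q" and alpha: "0 < \<alpha>" and gap: "\<alpha> * (2 - p) < p"
begin

abbreviation pconj :: real where "pconj \<equiv> p / (p - 1)"

abbreviation \<phi> :: "real \<Rightarrow> real" where "\<phi> \<equiv> pflux pconj"

abbreviation g :: "real \<Rightarrow> real" where "g \<equiv> pflux (q + 1)"

text \<open>The unknown \<open>v\<close> is the flux, so no second derivative of \<open>w\<close>
  appears. The value \<open>w 0\<close> is left free because solutions with different initial values
  are compared. At 0 only continuity and \<open>v 0 = 0\<close> are recorded, since the equation is
  singular there.\<close>

definition sol :: "real \<Rightarrow> (real \<Rightarrow> real) \<Rightarrow> (real \<Rightarrow> real) \<Rightarrow> bool" where
  "sol \<epsilon> w v \<longleftrightarrow> continuous_on {0..} w \<and> continuous_on {0..} v \<and> v 0 = 0 \<and>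
     (\<forall>r>0. (w has_real_derivative \<phi> (v r)) (at r) \<and>
       (v has_real_derivative
         (- (k / r) * v r - \<epsilon> * (r * \<phi> (v r) + \<alpha> * w r) - g (w r))) (at r))"

lemma pconj: "pconj > 1" "pconj = 1 + 1 / (p - 1)"
  using p by (auto simp: field_simps)

lemma sol_cont: "sol \<epsilon> w v \<Longrightarrow> continuous_on {0..} w" "sol \<epsilon> w v \<Longrightarrow> continuous_on {0..} v"
  and sol_v0: "sol \<epsilon> w v \<Longrightarrow> v 0 = 0"
  and sol_w: "sol \<epsilon> w v \<Longrightarrow> r > 0 \<Longrightarrow> (w has_real_derivative \<phi> (v r)) (at r)"
  and sol_v: "sol \<epsilon> w v \<Longrightarrow> r > 0 \<Longrightarrow> (v has_real_derivative
         (- (k / r) * v r - \<epsilon> * (r * \<phi> (v r) + \<alpha> * w r) - g (w r))) (at r)"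
  by (auto simp: sol_def)

lemma sol_uminus:
  assumes "sol \<epsilon> w v"
  shows "sol \<epsilon> (\<lambda>r. - w r) (\<lambda>r. - v r)"
  unfolding sol_def
proof (intro conjI allI impI)
  fix r :: real assume r: "r > 0"
  show "((\<lambda>r. - w r) has_real_derivative \<phi> (- v r)) (at r)"
    using DERIV_minus[OF sol_w[OF assms r]] by (simp add: pflux_minus)
  show "((\<lambda>r. - v r) has_real_derivative - (real k / r) * - v r
          - \<epsilon> * (r * \<phi> (- v r) + \<alpha> * - w r) - g (- w r)) (at r)"
    using DERIV_minus[OF sol_v[OF assms r]] by (simp add: pflux_minus algebra_simps)
qed (use assms in \<open>auto simp: sol_def intro!: continuous_intros\<close>)

text \<open>The first summand is \<open>(p - 1) / p\<close> times the \<open>p\<close>-th power of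
  \<open>\<bar>w'\<bar>\<close>, because \<open>\<bar>v\<bar> powr pconj\<close> equals that
  power.\<close>

definition energy :: "real \<Rightarrow> (real \<Rightarrow> real) \<Rightarrow> (real \<Rightarrow> real) \<Rightarrow> real \<Rightarrow> real" where
  "energy \<epsilon> w v r = \<bar>v r\<bar> powr pconj / pconj + \<epsilon> * \<alpha> * (w r)\<^sup>2 / 2 + \<bar>w r\<bar> powr (q + 1) / (q + 1)"

lemma energy_deriv:
  assumes "sol \<epsilon> w v" "r > 0"
  shows "(energy \<epsilon> w v has_real_derivative
           (- (k / r) * \<bar>v r\<bar> powr pconj - \<epsilon> * r * (\<phi> (v r))\<^sup>2)) (at r)"
proof -
  note dw = sol_w[OF assms] and dv = sol_v[OF assms]
  let ?dv = "- (k / r) * v r - \<epsilon> * (r * \<phi> (v r) + \<alpha> * w r) - g (w r)"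
  have 1: "((\<lambda>r. \<bar>v r\<bar> powr pconj) has_real_derivative pconj * \<phi> (v r) * ?dv) (at r)"
    by (rule DERIV_chain2[OF has_derivative_abs_powr dv]) (rule pconj)
  have 2: "((\<lambda>r. \<bar>w r\<bar> powr (q + 1)) has_real_derivative ((q + 1) * g (w r)) * \<phi> (v r)) (at r)"
    by (rule DERIV_chain2[OF has_derivative_abs_powr dw]) (use q in auto)
  have "(energy \<epsilon> w v has_real_derivative
     (pconj * \<phi> (v r) * ?dv / pconj + \<epsilon> * \<alpha> * (2 * w r * \<phi> (v r)) / 2 + ((q + 1) * g (w r)) * \<phi> (v r) / (q + 1)))
     (at r)"
    unfolding energy_def power2_eq_square
    by (intro DERIV_add DERIV_cdivide 1 2 DERIV_cong[OF DERIV_cmult[OF DERIV_mult[OF dw dw]]]) auto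
  moreover have "pconj * \<phi> (v r) * ?dv / pconj + \<epsilon> * \<alpha> * (2 * w r * \<phi> (v r)) / 2
      + ((q + 1) * g (w r)) * \<phi> (v r) / (q + 1)
      = - (k / r) * (v r * \<phi> (v r)) - \<epsilon> * r * (\<phi> (v r))\<^sup>2"
  proof -
    have "pconj * \<phi> (v r) * ?dv / pconj = \<phi> (v r) * ?dv"
      using pconj(1) by (simp only: mult.assoc) (rule nonzero_mult_div_cancel_left, linarith)
    moreover have "((q + 1) * g (w r)) * \<phi> (v r) / (q + 1) = g (w r) * \<phi> (v r)"
      using q by simp
    ultimately show ?thesis
      by (simp add: algebra_simps power2_eq_square)
  qed
  ultimately show ?thesis by (simp add: mult_pflux)
qed

lemma continuous_on_abs_powr [continuous_intros]:
  fixes f :: "real \<Rightarrow> real"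
  assumes "e > 1" "continuous_on S f"
  shows "continuous_on S (\<lambda>x. \<bar>f x\<bar> powr e)"
  using assms by (intro continuous_on_powr' continuous_intros) auto

lemma energy_cont:
  assumes "sol \<epsilon> w v"
  shows "continuous_on {0..} (energy \<epsilon> w v)"
  unfolding energy_def using sol_cont[OF assms] pconj p q
  by (intro continuous_intros) auto

lemma energy_nonneg: "\<epsilon> \<ge> 0 \<Longrightarrow> energy \<epsilon> w v r \<ge> 0"
  using pconj q alpha by (auto simp: energy_def)

lemma energy_antimono:
  assumes "sol \<epsilon> w v" "\<epsilon> \<ge> 0" "0 \<le> x" "x \<le> y"
  shows "energy \<epsilon> w v y \<le> energy \<epsilon> w v x"
proof (rule DERIV_nonpos_imp_decreasing_open[OF assms(4)])
  fix r assume r: "x < r" "r < y"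
  have "0 \<le> (k / r) * \<bar>v r\<bar> powr pconj" "0 \<le> \<epsilon> * r * (\<phi> (v r))\<^sup>2"
    using assms r by (intro mult_nonneg_nonneg; simp)+
  then have "- (k / r) * \<bar>v r\<bar> powr pconj - \<epsilon> * r * (\<phi> (v r))\<^sup>2 \<le> 0"
    by linarith
  with energy_deriv[OF assms(1), of r] r assms
  show "\<exists>d. (energy \<epsilon> w v has_real_derivative d) (at r) \<and> d \<le> 0"
    by (metis order_le_less_trans)
next
  show "continuous_on {x..y} (energy \<epsilon> w v)"
    using energy_cont[OF assms(1)] by (rule continuous_on_subset) (use assms in auto)
qed

lemma energy_eq_0_iff:
  assumes "\<epsilon> \<ge> 0"
  shows "energy \<epsilon> w v r = 0 \<longleftrightarrow> w r = 0 \<and> v r = 0"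
proof
  assume *: "energy \<epsilon> w v r = 0"
  have "\<bar>v r\<bar> powr pconj / pconj \<ge> 0" "\<epsilon> * \<alpha> * (w r)\<^sup>2 / 2 \<ge> 0" "\<bar>w r\<bar> powr (q + 1) / (q + 1) \<ge> 0"
    using assms pconj q alpha by auto
  with * have "\<bar>v r\<bar> powr pconj / pconj = 0" "\<bar>w r\<bar> powr (q + 1) / (q + 1) = 0"
    unfolding energy_def by linarith+
  then show "w r = 0 \<and> v r = 0" using pconj q by (auto split: if_splits)
qed (simp add: energy_def)

lemma energy_pos_iff:
  assumes "\<epsilon> \<ge> 0"
  shows "energy \<epsilon> w v r > 0 \<longleftrightarrow> w r \<noteq> 0 \<or> v r \<noteq> 0"
  using energy_eq_0_iff[OF assms, of w v r] energy_nonneg[OF assms, of w v r] by linarith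

lemma powr_le_imp_le:
  fixes x c e :: real
  assumes "x \<ge> 0" "x powr e \<le> c" "e > 0"
  shows "x \<le> c powr (1 / e)"
proof -
  have "(x powr e) powr (1 / e) \<le> c powr (1 / e)"
    using assms by (intro powr_mono2) auto
  then show ?thesis using assms by (simp add: powr_powr)
qed

lemma energy_bound:
  assumes "energy \<epsilon> w v r \<le> c" "\<epsilon> \<ge> 0"
  shows "\<bar>w r\<bar> \<le> ((q + 1) * c) powr (1 / (q + 1))" "\<bar>v r\<bar> \<le> (pconj * c) powr (1 / pconj)"
proof -
  have *: "\<bar>v r\<bar> powr pconj / pconj \<ge> 0" "\<epsilon> * \<alpha> * (w r)\<^sup>2 / 2 \<ge> 0" "\<bar>w r\<bar> powr (q + 1) / (q + 1) \<ge> 0"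
    using assms pconj q alpha by auto
  then have "\<bar>v r\<bar> powr pconj / pconj \<le> c" "\<bar>w r\<bar> powr (q + 1) / (q + 1) \<le> c"
    using assms unfolding energy_def by linarith+
  then have "\<bar>w r\<bar> powr (q + 1) \<le> (q + 1) * c" "\<bar>v r\<bar> powr pconj \<le> pconj * c"
    using pos_divide_le_eq[of "q + 1"] pos_divide_le_eq[of pconj] pconj(1) q by (simp_all only: mult.commute)
  then show "\<bar>w r\<bar> \<le> ((q + 1) * c) powr (1 / (q + 1))" "\<bar>v r\<bar> \<le> (pconj * c) powr (1 / pconj)"
    using pconj(1) q by (intro powr_le_imp_le; simp)+
qed

lemma energy_init:
  assumes "sol \<epsilon> w v" "0 \<le> \<epsilon>" "\<epsilon> \<le> 1" "\<bar>w 0\<bar> \<le> A" "r \<ge> 0"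
  shows "energy \<epsilon> w v r \<le> \<alpha> * A\<^sup>2 / 2 + A powr (q + 1) / (q + 1)"
proof -
  have "energy \<epsilon> w v r \<le> energy \<epsilon> w v 0"
    using energy_antimono assms by simp
  also have "\<dots> = \<epsilon> * (\<alpha> * (w 0)\<^sup>2 / 2) + \<bar>w 0\<bar> powr (q + 1) / (q + 1)"
    using assms by (simp add: energy_def sol_v0)
  also have "\<dots> \<le> 1 * (\<alpha> * A\<^sup>2 / 2) + A powr (q + 1) / (q + 1)"
    using assms alpha q
    by (intro add_mono mult_mono divide_right_mono powr_mono2 mult_left_mono)
      (auto simp: abs_le_square_iff[symmetric])
  finally show ?thesis by simp
qed

text \<open>Since \<open>v 0 = 0\<close>, the initial energy depends on \<open>w 0\<close> and
  \<open>\<epsilon>\<close> only, and the energy never increases. One \<open>M\<close> serves all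
  \<open>\<epsilon>\<close> in \<open>[0, 1]\<close> and all solutions; both the comparison of
  neighbouring solutions and the compactness argument rely on this.\<close>

lemma sol_bounded:
  obtains M where "M \<ge> 1"
    "\<And>\<epsilon> w v r. \<lbrakk>sol \<epsilon> w v; 0 \<le> \<epsilon>; \<epsilon> \<le> 1; \<bar>w 0\<bar> \<le> A; r \<ge> 0\<rbrakk> \<Longrightarrow> \<bar>w r\<bar> \<le> M \<and> \<bar>v r\<bar> \<le> M"
proof -
  define c where "c = \<alpha> * A\<^sup>2 / 2 + A powr (q + 1) / (q + 1)"
  define M where "M = max 1 (max (((q + 1) * c) powr (1 / (q + 1))) ((pconj * c) powr (1 / pconj)))"
  show ?thesis
  proof (rule that)
    show "M \<ge> 1" by (simp add: M_def)
    fix \<epsilon> w v and r :: real assume "sol \<epsilon> w v" "0 \<le> \<epsilon>" "\<epsilon> \<le> 1" "\<bar>w 0\<bar> \<le> A" "r \<ge> 0"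
    then have "energy \<epsilon> w v r \<le> c" unfolding c_def by (rule energy_init)
    from energy_bound[OF this \<open>0 \<le> \<epsilon>\<close>] show "\<bar>w r\<bar> \<le> M \<and> \<bar>v r\<bar> \<le> M"
      unfolding M_def by auto
  qed
qed

lemma sol_small:
  assumes "\<eta> > 0"
  obtains A where "A > 0"
    "\<And>w v r. \<lbrakk>sol 1 w v; \<bar>w 0\<bar> \<le> A; r \<ge> 0\<rbrakk> \<Longrightarrow> \<bar>w r\<bar> \<le> \<eta>"
proof -
  \<comment> \<open>The energy level for which \<open>energy_bound\<close> returns exactly
    \<open>\<eta>\<close>.\<close>
  define T where "T = \<eta> powr (q + 1) / (q + 1)"
  have "T > 0" using assms q by (simp add: T_def)
  have "((\<lambda>A. \<alpha> * A\<^sup>2 / 2 + A powr (q + 1) / (q + 1)) \<longlongrightarrow> 0) (at_right 0)"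
    using q by (auto intro!: tendsto_eq_intros simp: eventually_at_filter)
  then have "eventually (\<lambda>A. \<alpha> * A\<^sup>2 / 2 + A powr (q + 1) / (q + 1) < T) (at_right 0)"
    using \<open>T > 0\<close> by (rule order_tendstoD)
  then obtain A where A: "A > 0" "\<alpha> * A\<^sup>2 / 2 + A powr (q + 1) / (q + 1) < T"
    unfolding eventually_at_right_field by (meson dense)
  show ?thesis
  proof (rule that[OF A(1)])
    fix w v and r :: real assume "sol 1 w v" "\<bar>w 0\<bar> \<le> A" "r \<ge> 0"
    then have "energy 1 w v r \<le> T" using energy_init[of 1 w v A r] A by simp
    from energy_bound(1)[OF this] have "\<bar>w r\<bar> \<le> ((q + 1) * T) powr (1 / (q + 1))" by simp
    also have "\<dots> = \<eta>" using assms q by (simp add: T_def powr_powr)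
    finally show "\<bar>w r\<bar> \<le> \<eta>" .
  qed
qed

lemma abs_g_le: "\<bar>x\<bar> \<le> M \<Longrightarrow> \<bar>g x\<bar> \<le> M powr (q - 1) * \<bar>x\<bar>"
  using q by (auto simp: pflux_def abs_mult intro!: mult_right_mono powr_mono2)

lemma g_lipschitz:
  assumes "\<bar>x\<bar> \<le> M" "\<bar>y\<bar> \<le> M"
  shows "\<bar>g x - g y\<bar> \<le> q * M powr (q - 1) * \<bar>x - y\<bar>"
  using pflux_lipschitz[of "q + 1" x M y] assms q by simp

subsection \<open>Decay at infinity\<close>

lemma phi_powr: "b > 0 \<Longrightarrow> b * b powr (1 / (p - 1)) = b powr pconj"
  using powr_add[of b 1 "1 / (p - 1)"] unfolding pconj(2) by simp

text \<open>If \<open>w\<close> is of order \<open>r powr - \<gamma>\<close>, balancing the drag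
  \<open>r * \<phi> (v r)\<close> against the terms in \<open>w\<close> suggests
  \<open>\<phi> (v r)\<close> of order \<open>r powr (- \<gamma> - 1)\<close>, which is the claimed
  rate. The barrier \<open>K * r powr - \<mu>\<close> cannot be crossed because the drag dominates
  both those terms and the slope of the barrier; the slope is of lower order exactly because
  \<open>\<gamma> * (2 - p) < p\<close>.\<close>

lemma flux_decay:
  assumes \<gamma>: "\<gamma> \<ge> 0" "\<gamma> * (2 - p) < p" and M: "M \<ge> 1"
  obtains K where "K \<ge> 1"
    "\<And>w v r. \<lbrakk>sol 1 w v; \<And>r. r \<ge> 1 \<Longrightarrow> \<bar>w r\<bar> \<le> M * r powr - \<gamma>; \<And>r. r \<ge> 1 \<Longrightarrow> \<bar>v r\<bar> \<le> M; r \<ge> 1\<rbrakk>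
      \<Longrightarrow> \<bar>v r\<bar> \<le> K * r powr - ((\<gamma> + 1) * (p - 1))"
proof -
  define \<mu> where "\<mu> = (\<gamma> + 1) * (p - 1)"
  define B where "B = (\<alpha> + M powr (q - 1)) * M"
  have \<mu>: "\<mu> > 0" "\<mu> + 1 > \<gamma>"
    using \<gamma> p by (simp_all add: \<mu>_def) (simp add: algebra_simps)
  have B: "B \<ge> 0" using M alpha by (simp add: B_def)
  \<comment> \<open>\<open>R\<close> is large enough for \<open>key\<close>, and \<open>K\<close> is
    chosen so that the barrier equals \<open>M + 1\<close> at \<open>R\<close>. So it starts
    strictly above \<open>\<bar>v\<bar>\<close> there, and on \<open>[1, R]\<close> the bound
    \<open>M\<close> already suffices.\<close>
  define R where "R = B + \<mu> * (M + 1) + 1"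
  have R: "R \<ge> 1" using B \<mu> M by (auto simp: R_def)
  define K where "K = (M + 1) * R powr \<mu>"
  have KR: "K * R powr - \<mu> = M + 1"
    using R by (simp add: K_def mult.assoc flip: powr_add)
  have "R powr \<mu> \<ge> 1" using R \<mu> by (simp add: ge_one_powr_ge_zero)
  then have KM: "K \<ge> M + 1" using M mult_left_mono[of 1 "R powr \<mu>" "M + 1"] by (simp add: K_def)
  have K: "K > 0" "K \<ge> 1" using KM M by auto
  \<comment> \<open>On the right stands the drag at a touching point, on the left the terms in
    \<open>w\<close> and the slope of the barrier, each divided by the height of the
    barrier.\<close>
  have key: "B * r powr - \<gamma> + \<mu> * K * r powr (- \<mu> - 1) < K powr (1 / (p - 1)) * r powr - \<gamma>"
    if "r \<ge> R" for r
  proof -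
    have "R powr (\<gamma> + 1) = (R powr \<mu>) powr (1 / (p - 1))"
      using p by (simp add: powr_powr \<mu>_def)
    also have "\<dots> \<le> K powr (1 / (p - 1))"
      using p M R mult_right_mono[of 1 "M + 1" "R powr \<mu>"] by (intro powr_mono2) (auto simp: K_def)
    finally have 1: "R powr (\<gamma> + 1) \<le> K powr (1 / (p - 1))" .
    have "r powr (- (\<mu> + 1 - \<gamma>)) \<le> R powr (- (\<mu> + 1 - \<gamma>))"
      using that R \<mu> by (intro powr_mono2') auto
    then have "\<mu> * K * r powr (- (\<mu> + 1 - \<gamma>)) \<le> \<mu> * K * R powr (- (\<mu> + 1 - \<gamma>))"
      using \<mu> K by (intro mult_left_mono) auto
    also have "\<dots> = \<mu> * (M + 1) * R powr (\<gamma> - 1)"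
      using R by (simp add: K_def flip: powr_add)
    finally have 2: "\<mu> * K * r powr (- (\<mu> + 1 - \<gamma>)) \<le> \<mu> * (M + 1) * R powr (\<gamma> - 1)" .
    have "B + \<mu> * (M + 1) * R powr (\<gamma> - 1) < R powr (\<gamma> + 1)"
    proof -
      have "B * R powr - \<gamma> \<le> B * 1"
        using B R \<gamma> powr_mono[of "- \<gamma>" 0 R] by (intro mult_left_mono) auto
      moreover have "\<mu> * (M + 1) * R powr - 1 \<le> \<mu> * (M + 1) * 1"
        using \<mu> M R powr_mono[of "- 1" 0 R] by (intro mult_left_mono) auto
      ultimately have "B * R powr - \<gamma> + \<mu> * (M + 1) * R powr - 1 < R"
        by (simp add: R_def)
      then have "R powr \<gamma> * (B * R powr - \<gamma> + \<mu> * (M + 1) * R powr - 1) < R powr \<gamma> * R"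
        using R by (intro mult_strict_left_mono) auto
      moreover have "R powr \<gamma> * (B * R powr - \<gamma> + \<mu> * (M + 1) * R powr - 1)
          = B * (R powr \<gamma> * R powr - \<gamma>) + \<mu> * (M + 1) * (R powr \<gamma> * R powr - 1)"
        by (simp only: distrib_left mult_ac)
      moreover have "R powr \<gamma> * R powr - \<gamma> = 1" "R powr \<gamma> * R powr - 1 = R powr (\<gamma> - 1)"
         "R powr \<gamma> * R = R powr (\<gamma> + 1)"
        using R by (simp_all add: powr_add powr_diff powr_minus field_simps)
      ultimately show ?thesis by (simp only: mult_1_right)
    qed
    with 1 2 have "B + \<mu> * K * r powr (- (\<mu> + 1 - \<gamma>)) < K powr (1 / (p - 1))" by linarith
    then have "r powr - \<gamma> * (B + \<mu> * K * r powr (- (\<mu> + 1 - \<gamma>))) < r powr - \<gamma> * K powr (1 / (p - 1))"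
      using that R by (intro mult_strict_left_mono) auto
    moreover have "r powr - \<gamma> * r powr (- (\<mu> + 1 - \<gamma>)) = r powr (- \<mu> - 1)"
      by (simp flip: powr_add)
    ultimately show ?thesis
      by (simp add: algebra_simps)
  qed
  show ?thesis
  proof (rule that[OF K(2)])
    fix w v and r :: real
    assume s: "sol 1 w v" and bw: "\<And>r. r \<ge> 1 \<Longrightarrow> \<bar>w r\<bar> \<le> M * r powr - \<gamma>"
      and bv: "\<And>r. r \<ge> 1 \<Longrightarrow> \<bar>v r\<bar> \<le> M" and "r \<ge> 1"
    have "\<bar>v r\<bar> \<le> K * r powr - \<mu>"
    proof (cases "r < R")
      case True
      have "M \<le> K * R powr - \<mu>" using KR by simp
      also have "\<dots> \<le> K * r powr - \<mu>"
        using True \<open>r \<ge> 1\<close> K \<mu> by (intro mult_left_mono powr_mono2') auto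
      finally show ?thesis using bv[OF \<open>r \<ge> 1\<close>] by linarith
    next
      case False
      define h where "h = (\<lambda>r. (K * r powr - \<mu>)\<^sup>2 - (v r)\<^sup>2)"
      define dv where "dv = (\<lambda>r. - (k / r) * v r - 1 * (r * \<phi> (v r) + \<alpha> * w r) - g (w r))"
      define h' where "h' = (\<lambda>r. 2 * (K * r powr - \<mu>) * (K * (- \<mu> * r powr (- \<mu> - 1))) - 2 * v r * dv r)"
      have "h r > 0"
      proof (rule barrier[where h = h and h' = h' and x = R])
        have "continuous_on {R..r} v"
          using sol_cont(2)[OF s] by (rule continuous_on_subset) (use R in auto)
        then show "continuous_on {R..r} h"
          unfolding h_def using R by (intro continuous_intros) auto
        have "(v R)\<^sup>2 \<le> M\<^sup>2" using bv[OF R] M by (simp add: abs_le_square_iff[symmetric])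
        also have "M\<^sup>2 < (M + 1)\<^sup>2" using M by (intro power_strict_mono) auto
        also have "(M + 1)\<^sup>2 = (K * R powr - \<mu>)\<^sup>2" by (simp add: KR)
        finally show "h R > 0" by (simp add: h_def)
        show "(h has_real_derivative h' r) (at r)" if "r > R" for r
        proof -
          have "r > 0" using that R by simp
          then have 1: "((\<lambda>r. K * r powr - \<mu>) has_real_derivative K * (- \<mu> * r powr (- \<mu> - 1))) (at r)"
            using has_real_derivative_powr[of r "- \<mu>"] by (intro DERIV_cmult) auto
          show ?thesis
            unfolding h_def h'_def power2_eq_square
            by (rule DERIV_cong[OF DERIV_diff[OF DERIV_mult[OF 1 1] DERIV_mult[OF sol_v[OF s \<open>r > 0\<close>] sol_v[OF s \<open>r > 0\<close>]]]])
              (simp add: dv_def)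
        qed
        show "h' r > 0" if r: "r > R" "h r = 0" for r
        proof -
          have r1: "r \<ge> 1" "r > 0" using r R by auto
          define b where "b = K * r powr - \<mu>"
          have b: "b > 0" "\<bar>v r\<bar> = b"
          proof -
            show "b > 0" using r1 K by (simp add: b_def)
            have "(v r)\<^sup>2 = b\<^sup>2" using r by (simp add: h_def b_def)
            then have "v r = b \<or> v r = - b" by (simp add: power2_eq_iff)
            then show "\<bar>v r\<bar> = b" using \<open>b > 0\<close> by auto
          qed
          have "r * \<bar>v r\<bar> powr pconj = b * (K powr (1 / (p - 1)) * r powr - \<gamma>)"
          proof -
            have "b powr (1 / (p - 1)) = K powr (1 / (p - 1)) * r powr (- \<gamma> - 1)"
              using K p by (simp add: b_def powr_mult powr_powr \<mu>_def)
            moreover have "r * r powr (- \<gamma> - 1) = r powr - \<gamma>"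
              using r1 by (simp add: powr_diff)
            ultimately have "r * b powr (1 / (p - 1)) = K powr (1 / (p - 1)) * r powr - \<gamma>"
              by (simp add: mult.left_commute)
            moreover have "\<bar>v r\<bar> powr pconj = b * b powr (1 / (p - 1))"
              using phi_powr[OF b(1)] b(2) by simp
            ultimately show ?thesis by (simp add: mult.left_commute)
          qed
          moreover have "- (v r * (\<alpha> * w r + g (w r))) \<le> b * (B * r powr - \<gamma>)"
          proof -
            have "M * r powr - \<gamma> \<le> M * 1"
              using M r1 \<gamma> powr_mono[of "- \<gamma>" 0 r] by (intro mult_left_mono) auto
            then have "\<bar>w r\<bar> \<le> M" using bw[OF r1(1)] by simp
            have "\<bar>\<alpha> * w r + g (w r)\<bar> \<le> \<alpha> * \<bar>w r\<bar> + M powr (q - 1) * \<bar>w r\<bar>"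
              using abs_g_le[OF \<open>\<bar>w r\<bar> \<le> M\<close>] alpha abs_triangle_ineq[of "\<alpha> * w r" "g (w r)"]
              by (simp add: abs_mult)
            also have "\<dots> \<le> (\<alpha> + M powr (q - 1)) * (M * r powr - \<gamma>)"
              unfolding distrib_right[symmetric] using bw[OF r1(1)] alpha
              by (intro mult_left_mono) auto
            finally have "b * \<bar>\<alpha> * w r + g (w r)\<bar> \<le> b * (B * r powr - \<gamma>)"
              using b by (intro mult_left_mono) (auto simp: B_def)
            moreover have "\<bar>v r * (\<alpha> * w r + g (w r))\<bar> = b * \<bar>\<alpha> * w r + g (w r)\<bar>"
              using b by (simp add: abs_mult)
            ultimately show ?thesis by linarith
          qed
          moreover have "v r * dv r = - ((k / r) * (v r * v r)) - r * \<bar>v r\<bar> powr pconj - v r * (\<alpha> * w r + g (w r))"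
            unfolding dv_def mult_pflux[symmetric] by (simp add: algebra_simps)
          moreover have "(k / r) * (v r * v r) \<ge> 0" using r1 by simp
          ultimately have "v r * dv r \<le> b * (B * r powr - \<gamma> - K powr (1 / (p - 1)) * r powr - \<gamma>)"
            unfolding right_diff_distrib by linarith
          also have "\<dots> < b * (- (\<mu> * K * r powr (- \<mu> - 1)))"
            using key[of r] r b(1) by (intro mult_strict_left_mono) auto
          finally have "v r * dv r < b * (- (\<mu> * K * r powr (- \<mu> - 1)))" .
          moreover have "h' r = 2 * (b * (- (\<mu> * K * r powr (- \<mu> - 1)))) - 2 * (v r * dv r)"
            unfolding h'_def b_def[symmetric] by (simp only: mult_ac mult_minus_left mult_minus_right)
          ultimately show ?thesis by linarith
        qed
      qed (use False in auto)
      then have "(v r)\<^sup>2 < (K * r powr - \<mu>)\<^sup>2" by (simp add: h_def)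
      then show ?thesis
        using K abs_le_square_iff[of "v r" "K * r powr - \<mu>"] by (simp add: abs_mult)
    qed
    then show "\<bar>v r\<bar> \<le> K * r powr - ((\<gamma> + 1) * (p - 1))" by (simp add: \<mu>_def)
  qed
qed

section \<open>The function \<open>Jfun\<close> and the bootstrap for the decay of
  \<open>w\<close>\<close>

text \<open>Adding \<open>v / r\<close> to \<open>w\<close> cancels both
  \<open>r * \<phi> (v r)\<close> and \<open>\<alpha> * w r\<close> in the derivative. The remaining
  terms are a multiple of \<open>v / r\<close> and the superlinear \<open>g (w r)\<close>.\<close>

definition Jfun :: "(real \<Rightarrow> real) \<Rightarrow> (real \<Rightarrow> real) \<Rightarrow> real \<Rightarrow> real" where
  "Jfun w v r = r powr \<alpha> * w r + r powr (\<alpha> - 1) * v r"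

lemma Jfun_deriv:
  assumes "sol 1 w v" "r > 0"
  shows "(Jfun w v has_real_derivative r powr (\<alpha> - 1) * ((\<alpha> - (k + 1)) * (v r / r) - g (w r))) (at r)"
proof -
  note dw = sol_w[OF assms] and dv = sol_v[OF assms]
  have "(Jfun w v has_real_derivative
     (\<alpha> * r powr (\<alpha> - 1) * w r + \<phi> (v r) * r powr \<alpha>) +
     ((\<alpha> - 1) * r powr (\<alpha> - 1 - 1) * v r +
      (- (k / r) * v r - 1 * (r * \<phi> (v r) + \<alpha> * w r) - g (w r)) * r powr (\<alpha> - 1))) (at r)"
    unfolding Jfun_def
    by (intro DERIV_add DERIV_mult dw dv has_real_derivative_powr assms)
  moreover have "r powr (\<alpha> - 1 - 1) = r powr (\<alpha> - 1) / r" "r powr \<alpha> = r powr (\<alpha> - 1) * r"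
    using assms by (simp_all add: powr_diff power2_eq_square)
  ultimately show ?thesis
    using assms(2) by (elim DERIV_cong) (simp only:, simp add: field_simps)
qed

lemma sol_cont_on:
  assumes "sol \<epsilon> w v" "S \<subseteq> {0..}"
  shows "continuous_on S w" "continuous_on S v"
  using sol_cont[OF assms(1)] assms(2) continuous_on_subset by blast+

lemma Jfun_cont:
  assumes "sol 1 w v" "x > 0"
  shows "continuous_on {x..y} (Jfun w v)"
proof -
  have "continuous_on {x..y} w" "continuous_on {x..y} v"
    using assms(2) by (auto intro!: sol_cont_on[OF assms(1)])
  then show ?thesis
    unfolding Jfun_def using assms(2) by (intro continuous_intros) auto
qed

text \<open>The sign of \<open>g\<close> only helps unless \<open>J w < 0\<close>, and then \<open>\<bar>w\<bar> \<le> \<bar>v\<bar> / r\<close>.\<close>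

lemma Jfun_forcing:
  assumes "r > 0" "\<bar>w r\<bar> \<le> M"
  shows "Jfun w v r * ((\<alpha> - (k + 1)) * (v r / r) - g (w r))
    \<le> \<bar>Jfun w v r\<bar> * ((\<bar>\<alpha> - (k + 1)\<bar> + M powr (q - 1)) * (\<bar>v r\<bar> / r))"
proof -
  let ?J = "Jfun w v r"
  have J: "?J = r powr \<alpha> * (w r + v r / r)"
    using assms by (simp add: Jfun_def powr_diff field_simps)
  have "- (?J * g (w r)) \<le> \<bar>?J\<bar> * (M powr (q - 1) * (\<bar>v r\<bar> / r))"
  proof (cases "?J * w r \<ge> 0")
    case True
    have eq: "?J * g (w r) = (?J * w r) * \<bar>w r\<bar> powr (q - 1)"
      by (simp add: pflux_def)
    have "?J * g (w r) \<ge> 0" unfolding eq by (intro mult_nonneg_nonneg True powr_ge_zero)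
    moreover have "\<bar>?J\<bar> * (M powr (q - 1) * (\<bar>v r\<bar> / r)) \<ge> 0" using assms by simp
    ultimately show ?thesis by linarith
  next
    case False
    then have "r powr \<alpha> * ((w r + v r / r) * w r) < r powr \<alpha> * 0"
      unfolding J by (simp only: mult.assoc not_le mult_zero_right)
    then have "(w r + v r / r) * w r < 0"
      using assms(1) by (subst (asm) mult_less_cancel_left_pos) auto
    then have "w r + v r / r > 0 \<and> w r < 0 \<or> w r + v r / r < 0 \<and> w r > 0"
      by (simp only: mult_less_0_iff)
    then have "\<bar>w r\<bar> \<le> \<bar>v r / r\<bar>" by linarith
    then have "\<bar>g (w r)\<bar> \<le> M powr (q - 1) * (\<bar>v r\<bar> / r)"
      using abs_g_le[OF assms(2)] assms(1) mult_left_mono[of "\<bar>w r\<bar>" "\<bar>v r / r\<bar>" "M powr (q - 1)"]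
      by simp
    then have "\<bar>?J\<bar> * \<bar>g (w r)\<bar> \<le> \<bar>?J\<bar> * (M powr (q - 1) * (\<bar>v r\<bar> / r))"
      by (intro mult_left_mono) auto
    moreover have "- (?J * g (w r)) \<le> \<bar>?J\<bar> * \<bar>g (w r)\<bar>"
      unfolding abs_mult[symmetric] by linarith
    ultimately show ?thesis by linarith
  qed
  moreover have "?J * ((\<alpha> - (k + 1)) * (v r / r)) \<le> \<bar>?J\<bar> * (\<bar>\<alpha> - (k + 1)\<bar> * (\<bar>v r\<bar> / r))"
  proof -
    have "\<bar>?J\<bar> * (\<bar>\<alpha> - (k + 1)\<bar> * (\<bar>v r\<bar> / r)) = \<bar>?J * ((\<alpha> - (k + 1)) * (v r / r))\<bar>"
      using assms(1) by (simp add: abs_mult)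
    then show ?thesis by (metis abs_ge_self)
  qed
  ultimately show ?thesis
    unfolding right_diff_distrib distrib_right distrib_left by linarith
qed

text \<open>A bound for \<open>Jfun\<close> by a multiple of
  \<open>r powr (\<alpha> - \<gamma>')\<close> gives the rate \<open>\<gamma>'\<close> for
  \<open>w\<close>, since \<open>v / r\<close> decays at least as fast. By
  \<open>Jfun_forcing\<close>, at a touching point the logarithmic growth of \<open>Jfun\<close> is
  limited by the decay of \<open>v\<close> alone, even though \<open>w\<close> is only known to be
  bounded.\<close>

lemma decay_step:
  assumes M: "M \<ge> 1" and K: "K \<ge> 1" and \<delta>: "\<delta> > 0" and \<mu>: "\<mu> + 1 \<ge> \<gamma> + 2 * \<delta>"
    and \<gamma>': "\<gamma>' \<le> \<gamma> + \<delta>" "\<gamma>' \<le> \<alpha>"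
  obtains M' where "M' \<ge> 1"
    "\<And>w v r. \<lbrakk>sol 1 w v; \<And>r. r \<ge> 1 \<Longrightarrow> \<bar>w r\<bar> \<le> M; \<And>r. r \<ge> 1 \<Longrightarrow> \<bar>v r\<bar> \<le> K * r powr - \<mu>; r \<ge> 1\<rbrakk>
      \<Longrightarrow> \<bar>w r\<bar> \<le> M' * r powr - \<gamma>'"
proof -
  define x where "x = \<alpha> - \<gamma>'"
  define C where "C = \<bar>\<alpha> - (k + 1)\<bar> + M powr (q - 1)"
  define D where "D = C * K / \<delta> + M + K + 1"
  have x: "x \<ge> 0" using \<gamma>' by (simp add: x_def)
  have C: "C \<ge> 0" by (simp add: C_def)
  have "C * K / \<delta> \<ge> 0" using C K \<delta> by simp
  then have D: "D > 0" "D > M + K" using M K by (auto simp: D_def)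
  have D\<delta>: "C * K < D * \<delta>"
  proof -
    have "D * \<delta> = C * K + (M + K + 1) * \<delta>" using \<delta> by (simp add: D_def field_simps)
    moreover have "(M + K + 1) * \<delta> > 0" using M K \<delta> by simp
    ultimately show ?thesis by linarith
  qed
  \<comment> \<open>For \<open>x = 0\<close>, which occurs in the final round
    \<open>\<gamma>' = \<alpha>\<close>, the power \<open>r powr x\<close> is constant and could not
    absorb any forcing. Subtracting \<open>r powr (x - \<delta>)\<close> gives a slope of at least
    \<open>D * \<delta> * r powr (x - \<delta> - 1)\<close> in all cases. \<open>D\<close> exceeds
    \<open>M + K\<close> for the start at 1, and \<open>D * \<delta>\<close> exceeds the forcing
    constant \<open>C * K\<close>.\<close>
  define G where "G = (\<lambda>r::real. D * (2 * r powr x - r powr (x - \<delta>)))"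
  define G' where "G' = (\<lambda>r::real. D * (2 * (x * r powr (x - 1)) - (x - \<delta>) * r powr (x - \<delta> - 1)))"
  have G: "G r > 0" "G r \<le> 2 * D * r powr x" if "r \<ge> 1" for r
  proof -
    have "r powr (x - \<delta>) \<le> r powr x" using that \<delta> by (intro powr_mono) auto
    moreover have "r powr x > 0" "r powr (x - \<delta>) > 0" using that by auto
    ultimately have "2 * r powr x - r powr (x - \<delta>) > 0" by linarith
    then show "G r > 0" using D by (simp add: G_def)
    have "D * (2 * r powr x - r powr (x - \<delta>)) \<le> D * (2 * r powr x)"
      using D \<open>r powr (x - \<delta>) > 0\<close> by (intro mult_left_mono) auto
    then show "G r \<le> 2 * D * r powr x" by (simp add: G_def mult_ac)
  qed
  have dG: "(G has_real_derivative G' r) (at r)" if "r \<ge> 1" for r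
    unfolding G_def G'_def using that
    by (intro DERIV_cmult DERIV_diff has_real_derivative_powr) auto
  have G'_ge: "G' r \<ge> D * \<delta> * r powr (x - \<delta> - 1)" if "r \<ge> 1" for r
  proof -
    have "x * r powr (x - \<delta> - 1) \<le> x * r powr (x - 1)"
      using that x \<delta> by (intro mult_left_mono powr_mono) auto
    moreover have "0 \<le> x * r powr (x - 1)" using x by simp
    ultimately have "\<delta> * r powr (x - \<delta> - 1) \<le> 2 * (x * r powr (x - 1)) - (x - \<delta>) * r powr (x - \<delta> - 1)"
      unfolding left_diff_distrib by linarith
    then have "D * (\<delta> * r powr (x - \<delta> - 1)) \<le> G' r"
      unfolding G'_def using D by (intro mult_left_mono) auto
    then show ?thesis by (simp add: mult.assoc)
  qed
  show ?thesis
  proof (rule that[of "2 * D + K"])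
    show "2 * D + K \<ge> 1" using D K by auto
    fix w v and r :: real
    assume s: "sol 1 w v" and bw: "\<And>r. r \<ge> 1 \<Longrightarrow> \<bar>w r\<bar> \<le> M"
      and bv: "\<And>r. r \<ge> 1 \<Longrightarrow> \<bar>v r\<bar> \<le> K * r powr - \<mu>" and "r \<ge> 1"
    let ?J = "Jfun w v"
    define J' where "J' = (\<lambda>r. r powr (\<alpha> - 1) * ((\<alpha> - (k + 1)) * (v r / r) - g (w r)))"
    define h where "h = (\<lambda>r. (G r)\<^sup>2 - (?J r)\<^sup>2)"
    define h' where "h' = (\<lambda>r. 2 * (G r * G' r) - 2 * (?J r * J' r))"
    have "h r > 0"
    proof (rule barrier[where h = h and h' = h' and x = 1])
      show "continuous_on {1..r} h"
        unfolding h_def G_def using Jfun_cont[OF s, of 1] by (intro continuous_intros) auto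
      have "\<bar>?J 1\<bar> \<le> M + K"
        using bw[of 1] bv[of 1] by (simp add: Jfun_def)
      then have "(?J 1)\<^sup>2 \<le> (M + K)\<^sup>2" using M K by (simp add: abs_le_square_iff[symmetric])
      also have "\<dots> < D\<^sup>2" using D M K by (intro power_strict_mono) auto
      finally show "h 1 > 0" by (simp add: h_def G_def)
      show "(h has_real_derivative h' r) (at r)" if "r > 1" for r
      proof -
        have J: "(?J has_real_derivative J' r) (at r)"
          unfolding J'_def using that by (intro Jfun_deriv[OF s]) auto
        have g: "(G has_real_derivative G' r) (at r)" using dG that by simp
        show ?thesis
          unfolding h_def h'_def power2_eq_square
          by (rule DERIV_cong[OF DERIV_diff[OF DERIV_mult[OF g g] DERIV_mult[OF J J]]]) simp
      qed
      show "h' r > 0" if r: "r > 1" "h r = 0" for r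
      proof -
        have r1: "r \<ge> 1" "r > 0" using r by auto
        have "(?J r)\<^sup>2 = (G r)\<^sup>2" using r by (simp add: h_def)
        then have "?J r = G r \<or> ?J r = - G r" by (simp add: power2_eq_iff)
        then have JG: "\<bar>?J r\<bar> = G r" using G(1)[OF r1(1)] by auto
        have "?J r * J' r = r powr (\<alpha> - 1) * (?J r * ((\<alpha> - (k + 1)) * (v r / r) - g (w r)))"
          by (simp add: J'_def)
        also have "\<dots> \<le> r powr (\<alpha> - 1) * (\<bar>?J r\<bar> * (C * (\<bar>v r\<bar> / r)))"
          unfolding C_def by (intro mult_left_mono Jfun_forcing r1 bw) auto
        also have "\<dots> \<le> r powr (\<alpha> - 1) * (\<bar>?J r\<bar> * (C * (K * r powr - \<mu> / r)))"
          using r1 C by (intro mult_left_mono divide_right_mono bv) auto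
        also have "\<dots> = G r * (C * K * r powr (\<alpha> - 2 - \<mu>))"
        proof -
          have "\<alpha> - 1 + - \<mu> = \<alpha> - 2 - \<mu> + 1" by simp
          then have "r powr (\<alpha> - 1) * r powr - \<mu> = r powr (\<alpha> - 2 - \<mu> + 1)"
            by (simp only: powr_add[symmetric])
          then have "r powr (\<alpha> - 1) * r powr - \<mu> = r powr (\<alpha> - 2 - \<mu>) * r"
            by (simp only: powr_add powr_one[OF order_trans[OF zero_le_one r1(1)]])
          then show ?thesis using r1 by (simp add: JG field_simps)
        qed
        also have "\<dots> \<le> G r * (C * K * r powr (x - \<delta> - 1))"
          using r1 G(1)[OF r1(1)] C K \<mu> \<gamma>'
          by (intro mult_left_mono powr_mono mult_nonneg_nonneg) (auto simp: x_def)
        also have "\<dots> < G r * (D * \<delta> * r powr (x - \<delta> - 1))"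
          using G(1)[OF r1(1)] r1 D\<delta> by (intro mult_strict_left_mono mult_strict_right_mono) auto
        also have "\<dots> \<le> G r * G' r"
          using G(1)[OF r1(1)] by (intro mult_left_mono G'_ge r1) auto
        finally show ?thesis by (simp add: h'_def)
      qed
    qed (rule \<open>r \<ge> 1\<close>)
    then have "(?J r)\<^sup>2 < (G r)\<^sup>2" by (simp add: h_def)
    then have "\<bar>?J r\<bar> \<le> G r"
      using G(1)[OF \<open>r \<ge> 1\<close>] abs_le_square_iff[of "?J r" "G r"] by simp
    then have J: "\<bar>?J r\<bar> \<le> 2 * D * r powr x" using G(2)[OF \<open>r \<ge> 1\<close>] by linarith
    have "w r = r powr - \<alpha> * ?J r - v r / r"
      using \<open>r \<ge> 1\<close> by (simp add: Jfun_def powr_minus powr_diff field_simps)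
    then have "\<bar>w r\<bar> \<le> \<bar>r powr - \<alpha> * ?J r\<bar> + \<bar>v r / r\<bar>"
      by (metis abs_triangle_ineq4)
    also have "\<dots> = r powr - \<alpha> * \<bar>?J r\<bar> + \<bar>v r\<bar> / r"
      using \<open>r \<ge> 1\<close> by (simp add: abs_mult)
    also have "\<dots> \<le> r powr - \<alpha> * (2 * D * r powr x) + K * r powr - \<mu> / r"
      using \<open>r \<ge> 1\<close> by (intro add_mono mult_left_mono divide_right_mono bv J) auto
    also have "\<dots> = 2 * D * r powr - \<gamma>' + K * r powr (- \<mu> - 1)"
    proof -
      have "r powr - \<alpha> * r powr x = r powr - \<gamma>'" by (simp add: x_def flip: powr_add)
      then show ?thesis using \<open>r \<ge> 1\<close> by (simp add: powr_diff mult.left_commute)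
    qed
    also have "\<dots> \<le> 2 * D * r powr - \<gamma>' + K * r powr - \<gamma>'"
      using \<open>r \<ge> 1\<close> K \<mu> \<gamma>' \<delta> by (intro add_left_mono mult_left_mono powr_mono) auto
    finally show "\<bar>w r\<bar> \<le> (2 * D + K) * r powr - \<gamma>'" by (simp add: distrib_right)
  qed
qed

text \<open>The excess \<open>(\<gamma> + 1) * (p - 1) + 1 - \<gamma>\<close> equals
  \<open>p - \<gamma> * (2 - p)\<close>, which is affine in \<open>\<gamma>\<close>. Its minimum
  over \<open>[0, \<alpha>]\<close> is attained at an endpoint, and \<open>\<delta>\<close> is half
  of that minimum.\<close>

lemma decay_gap:
  obtains \<delta> where "\<delta> > 0"
    "\<And>\<gamma>. 0 \<le> \<gamma> \<Longrightarrow> \<gamma> \<le> \<alpha> \<Longrightarrow> (\<gamma> + 1) * (p - 1) + 1 \<ge> \<gamma> + 2 * \<delta> \<and> \<gamma> * (2 - p) < p"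
proof -
  define \<delta> where "\<delta> = min p (p - \<alpha> * (2 - p)) / 2"
  have "\<delta> > 0" using p gap by (simp add: \<delta>_def)
  moreover have "(\<gamma> + 1) * (p - 1) + 1 \<ge> \<gamma> + 2 * \<delta> \<and> \<gamma> * (2 - p) < p"
    if "0 \<le> \<gamma>" "\<gamma> \<le> \<alpha>" for \<gamma>
  proof -
    have "\<gamma> * (2 - p) \<le> max 0 (\<alpha> * (2 - p))"
    proof (cases "p \<le> 2")
      case True
      then have "\<gamma> * (2 - p) \<le> \<alpha> * (2 - p)" using that by (intro mult_right_mono) auto
      then show ?thesis by simp
    next
      case False
      then have "\<gamma> * (2 - p) \<le> 0" using that by (simp add: mult_le_0_iff)
      then show ?thesis by simp
    qed
    moreover have "(\<gamma> + 1) * (p - 1) + 1 = \<gamma> + (p - \<gamma> * (2 - p))" by (simp add: algebra_simps)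
    ultimately show ?thesis using p gap unfolding \<delta>_def by auto
  qed
  ultimately show ?thesis by (rule that)
qed

text \<open>Each round first improves \<open>v\<close> by \<open>flux_decay\<close> and then gains
  \<open>\<delta>\<close> in the rate of \<open>w\<close> by \<open>decay_step\<close>; the gain
  stays the same until the rate reaches \<open>\<alpha>\<close>.\<close>

lemma uniform_decay_iterate:
  assumes \<delta>: "\<delta> > 0"
    "\<And>\<gamma>. 0 \<le> \<gamma> \<Longrightarrow> \<gamma> \<le> \<alpha> \<Longrightarrow> (\<gamma> + 1) * (p - 1) + 1 \<ge> \<gamma> + 2 * \<delta> \<and> \<gamma> * (2 - p) < p"
  shows "\<exists>C\<ge>1. \<forall>w v r. sol 1 w v \<and> \<bar>w 0\<bar> \<le> A \<and> r \<ge> 1 \<longrightarrow>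
     \<bar>w r\<bar> \<le> C * r powr - min \<alpha> (real n * \<delta>)"
proof (induction n)
  case 0
  obtain M where M: "M \<ge> 1" "\<And>\<epsilon> w v r. \<lbrakk>sol \<epsilon> w v; 0 \<le> \<epsilon>; \<epsilon> \<le> 1; \<bar>w 0\<bar> \<le> A; r \<ge> 0\<rbrakk> \<Longrightarrow> \<bar>w r\<bar> \<le> M \<and> \<bar>v r\<bar> \<le> M"
    using sol_bounded[of A] by blast
  show ?case
    using M(1) M(2)[of 1] alpha by (intro exI[of _ M]) auto
next
  case (Suc n)
  define \<gamma> where "\<gamma> = min \<alpha> (n * \<delta>)"
  have \<gamma>: "0 \<le> \<gamma>" "\<gamma> \<le> \<alpha>" using alpha \<delta>(1) by (auto simp: \<gamma>_def)
  obtain M where M: "M \<ge> 1" "\<And>\<epsilon> w v r. \<lbrakk>sol \<epsilon> w v; 0 \<le> \<epsilon>; \<epsilon> \<le> 1; \<bar>w 0\<bar> \<le> A; r \<ge> 0\<rbrakk> \<Longrightarrow> \<bar>w r\<bar> \<le> M \<and> \<bar>v r\<bar> \<le> M"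
    using sol_bounded[of A] by blast
  obtain C where C: "C \<ge> 1" "\<And>w v r. sol 1 w v \<Longrightarrow> \<bar>w 0\<bar> \<le> A \<Longrightarrow> r \<ge> 1 \<Longrightarrow> \<bar>w r\<bar> \<le> C * r powr - \<gamma>"
    using Suc.IH unfolding \<gamma>_def by blast
  define B where "B = max M C"
  have B: "B \<ge> 1" "M \<le> B" "C \<le> B" using M by (auto simp: B_def)
  have Bw: "\<bar>w r\<bar> \<le> B * r powr - \<gamma>" "\<bar>w r\<bar> \<le> B" "\<bar>v r\<bar> \<le> B"
    if "sol 1 w v" "\<bar>w 0\<bar> \<le> A" "r \<ge> 1" for w v r
  proof -
    have "C * r powr - \<gamma> \<le> B * r powr - \<gamma>" using B by (intro mult_right_mono) auto
    then show "\<bar>w r\<bar> \<le> B * r powr - \<gamma>" using C(2)[OF that] by linarith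
    show "\<bar>w r\<bar> \<le> B" "\<bar>v r\<bar> \<le> B" using M(2)[OF that(1) _ _ that(2), of r] that(3) B by auto
  qed
  obtain K where K: "K \<ge> 1" "\<And>w v r. \<lbrakk>sol 1 w v; \<And>r. r \<ge> 1 \<Longrightarrow> \<bar>w r\<bar> \<le> B * r powr - \<gamma>;
      \<And>r. r \<ge> 1 \<Longrightarrow> \<bar>v r\<bar> \<le> B; r \<ge> 1\<rbrakk> \<Longrightarrow> \<bar>v r\<bar> \<le> K * r powr - ((\<gamma> + 1) * (p - 1))"
    using flux_decay[of \<gamma> B] \<gamma> \<delta>(2)[OF \<gamma>] B(1) by metis
  have "(\<gamma> + 1) * (p - 1) + 1 \<ge> \<gamma> + 2 * \<delta>" using \<delta>(2)[OF \<gamma>] by blast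
  moreover have "min \<alpha> (Suc n * \<delta>) \<le> \<gamma> + \<delta>"
    using \<delta>(1) by (auto simp: \<gamma>_def algebra_simps min_def)
  ultimately obtain C' where "C' \<ge> 1" "\<And>w v r. \<lbrakk>sol 1 w v; \<And>r. r \<ge> 1 \<Longrightarrow> \<bar>w r\<bar> \<le> B;
      \<And>r. r \<ge> 1 \<Longrightarrow> \<bar>v r\<bar> \<le> K * r powr - ((\<gamma> + 1) * (p - 1)); r \<ge> 1\<rbrakk>
      \<Longrightarrow> \<bar>w r\<bar> \<le> C' * r powr - min \<alpha> (Suc n * \<delta>)"
    using decay_step[OF B(1) K(1) \<delta>(1) _ _ min.cobounded1] by blast
  then show ?case
    using K(2) Bw by (intro exI[of _ C']) blast
qed

text \<open>Finitely many rounds reach the rate \<open>\<alpha>\<close>; one more use of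
  \<open>flux_decay\<close> gives the matching rate for the flux.\<close>

lemma uniform_decay:
  obtains C \<delta> where "C \<ge> 1" "\<delta> > 0" "(\<alpha> + 1) * (p - 1) + 1 \<ge> \<alpha> + 2 * \<delta>"
    "\<And>w v r. \<lbrakk>sol 1 w v; \<bar>w 0\<bar> \<le> A; r \<ge> 1\<rbrakk> \<Longrightarrow>
       \<bar>w r\<bar> \<le> C * r powr - \<alpha> \<and> \<bar>v r\<bar> \<le> C * r powr - ((\<alpha> + 1) * (p - 1))"
proof -
  obtain \<delta> where \<delta>: "\<delta> > 0"
    "\<And>\<gamma>. 0 \<le> \<gamma> \<Longrightarrow> \<gamma> \<le> \<alpha> \<Longrightarrow> (\<gamma> + 1) * (p - 1) + 1 \<ge> \<gamma> + 2 * \<delta> \<and> \<gamma> * (2 - p) < p"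
    using decay_gap by blast
  obtain n :: nat where n: "n * \<delta> \<ge> \<alpha>"
    using reals_Archimedean3[OF \<delta>(1)] by (meson less_imp_le)
  then have "min \<alpha> (n * \<delta>) = \<alpha>" by simp
  then obtain C where C: "C \<ge> 1" "\<And>w v r. sol 1 w v \<Longrightarrow> \<bar>w 0\<bar> \<le> A \<Longrightarrow> r \<ge> 1 \<Longrightarrow> \<bar>w r\<bar> \<le> C * r powr - \<alpha>"
    using uniform_decay_iterate[OF \<delta>, of A n] by auto
  obtain M where M: "M \<ge> 1" "\<And>\<epsilon> w v r. \<lbrakk>sol \<epsilon> w v; 0 \<le> \<epsilon>; \<epsilon> \<le> 1; \<bar>w 0\<bar> \<le> A; r \<ge> 0\<rbrakk> \<Longrightarrow> \<bar>w r\<bar> \<le> M \<and> \<bar>v r\<bar> \<le> M"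
    using sol_bounded[of A] by blast
  define B where "B = max M C"
  have B: "B \<ge> 1" "M \<le> B" "C \<le> B" using M by (auto simp: B_def)
  have Bw: "\<bar>w r\<bar> \<le> B * r powr - \<alpha>" "\<bar>v r\<bar> \<le> B"
    if "sol 1 w v" "\<bar>w 0\<bar> \<le> A" "r \<ge> 1" for w v r
  proof -
    have "C * r powr - \<alpha> \<le> B * r powr - \<alpha>" using B by (intro mult_right_mono) auto
    then show "\<bar>w r\<bar> \<le> B * r powr - \<alpha>" using C(2)[OF that] by linarith
    show "\<bar>v r\<bar> \<le> B" using M(2)[OF that(1) _ _ that(2), of r] that(3) B by auto
  qed
  obtain K where K: "K \<ge> 1" "\<And>w v r. \<lbrakk>sol 1 w v; \<And>r. r \<ge> 1 \<Longrightarrow> \<bar>w r\<bar> \<le> B * r powr - \<alpha>;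
      \<And>r. r \<ge> 1 \<Longrightarrow> \<bar>v r\<bar> \<le> B; r \<ge> 1\<rbrakk> \<Longrightarrow> \<bar>v r\<bar> \<le> K * r powr - ((\<alpha> + 1) * (p - 1))"
    using flux_decay[of \<alpha> B] alpha gap B(1) by (metis less_imp_le)
  define C' where "C' = max B K"
  show ?thesis
  proof (rule that[of C' \<delta>])
    show "C' \<ge> 1" "\<delta> > 0" using B \<delta> by (auto simp: C'_def)
    show "(\<alpha> + 1) * (p - 1) + 1 \<ge> \<alpha> + 2 * \<delta>" using \<delta>(2)[of \<alpha>] alpha by auto
    fix w v and r :: real assume a: "sol 1 w v" "\<bar>w 0\<bar> \<le> A" "r \<ge> 1"
    have "B * r powr - \<alpha> \<le> C' * r powr - \<alpha>"
      "K * r powr - ((\<alpha> + 1) * (p - 1)) \<le> C' * r powr - ((\<alpha> + 1) * (p - 1))"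
      by (intro mult_right_mono; simp add: C'_def)+
    then show "\<bar>w r\<bar> \<le> C' * r powr - \<alpha> \<and> \<bar>v r\<bar> \<le> C' * r powr - ((\<alpha> + 1) * (p - 1))"
      using Bw(1)[OF a] K(2)[OF a(1) Bw(1)[OF a(1,2)] Bw(2)[OF a(1,2)] a(3)] by linarith
  qed
qed

text \<open>The derivative of \<open>Jfun\<close> is of order
  \<open>r powr (- \<delta> - 1)\<close>, hence integrable, so \<open>Jfun\<close> converges with an
  explicit rate, and its flux part tends to 0 at that rate too. The constants depend on
  \<open>A\<close> only; part (i) needs this to control the tails of all neighbouring solutions at
  once.\<close>

lemma uniform_limit_at_top:
  obtains C \<delta> where "C > 0" "\<delta> > 0"
    "\<And>w v. \<lbrakk>sol 1 w v; \<bar>w 0\<bar> \<le> A\<rbrakk> \<Longrightarrow>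
       \<exists>L. ((\<lambda>r. r powr \<alpha> * w r) \<longlongrightarrow> L) at_top \<and> (\<forall>r\<ge>1. \<bar>r powr \<alpha> * w r - L\<bar> \<le> C * r powr - \<delta>)"
proof -
  obtain C \<delta>0 where C: "C \<ge> 1" "\<delta>0 > 0" "(\<alpha> + 1) * (p - 1) + 1 \<ge> \<alpha> + 2 * \<delta>0"
    "\<And>w v r. \<lbrakk>sol 1 w v; \<bar>w 0\<bar> \<le> A; r \<ge> 1\<rbrakk> \<Longrightarrow>
       \<bar>w r\<bar> \<le> C * r powr - \<alpha> \<and> \<bar>v r\<bar> \<le> C * r powr - ((\<alpha> + 1) * (p - 1))"
    using uniform_decay[of A] by blast
  \<comment> \<open>The first entry is the margin for the flux term, the second the one for
    \<open>g (w r)\<close>, which is of order \<open>r powr - (\<alpha> * q)\<close>.\<close>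
  define \<delta> where "\<delta> = min \<delta>0 (\<alpha> * (q - 1))"
  have \<delta>: "\<delta> > 0" "\<delta> \<le> \<delta>0" "\<delta> \<le> \<alpha> * (q - 1)"
    using C(2) alpha q by (auto simp: \<delta>_def)
  define K where "K = \<bar>\<alpha> - (k + 1)\<bar> * C + C powr (q - 1) * C"
  have K: "K > 0" unfolding K_def using C(1) by (intro add_nonneg_pos mult_nonneg_nonneg) auto
  define D where "D = K / \<delta>"
  have D: "D > 0" using K \<delta> by (simp add: D_def)
  show ?thesis
  proof (rule that[of "D + C" \<delta>])
    show "D + C > 0" "\<delta> > 0" using D C \<delta> by auto
    fix w v assume s: "sol 1 w v" and A: "\<bar>w 0\<bar> \<le> A"
    let ?J = "Jfun w v"
    note bd = C(4)[OF s A]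
    have flux: "r powr (\<alpha> - 1) * \<bar>v r\<bar> \<le> C * r powr - \<delta>" if "r \<ge> 1" for r
    proof -
      have "r powr (\<alpha> - 1) * \<bar>v r\<bar> \<le> r powr (\<alpha> - 1) * (C * r powr - ((\<alpha> + 1) * (p - 1)))"
        using bd[OF that] by (intro mult_left_mono) auto
      also have "\<dots> = C * r powr (\<alpha> - 1 - (\<alpha> + 1) * (p - 1))"
        by (simp add: mult.left_commute flip: powr_add)
      also have "\<dots> \<le> C * r powr - \<delta>"
        using C(1) C(2) C(3) \<delta> that by (intro mult_left_mono powr_mono) auto
      finally show ?thesis .
    qed
    have J'_bound: "\<bar>r powr (\<alpha> - 1) * ((\<alpha> - (k + 1)) * (v r / r) - g (w r))\<bar> \<le> K * r powr (- \<delta> - 1)"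
      if "r \<ge> 1" for r
    proof -
      have 1: "r powr (\<alpha> - 1) * (\<bar>v r\<bar> / r) \<le> C * r powr (- \<delta> - 1)"
        using divide_right_mono[OF flux[OF that], of r] that by (simp add: powr_diff)
      have "\<bar>g (w r)\<bar> = \<bar>w r\<bar> powr q" by (simp add: abs_pflux)
      also have "\<dots> \<le> (C * r powr - \<alpha>) powr q" using bd[OF that] q by (intro powr_mono2) auto
      also have "\<dots> = C powr (q - 1) * C * r powr - (\<alpha> * q)"
        using C(1) that by (simp add: powr_mult powr_powr powr_diff)
      finally have "r powr (\<alpha> - 1) * \<bar>g (w r)\<bar> \<le> r powr (\<alpha> - 1) * (C powr (q - 1) * C * r powr - (\<alpha> * q))"
        by (intro mult_left_mono) auto
      also have "\<dots> = C powr (q - 1) * C * r powr (\<alpha> - 1 - \<alpha> * q)"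
        by (simp add: mult.left_commute flip: powr_add)
      also have "\<dots> \<le> C powr (q - 1) * C * r powr (- \<delta> - 1)"
        using C(1) \<delta> that by (intro mult_left_mono powr_mono) (auto simp: algebra_simps)
      finally have 2: "r powr (\<alpha> - 1) * \<bar>g (w r)\<bar> \<le> C powr (q - 1) * C * r powr (- \<delta> - 1)" .
      have "\<bar>r powr (\<alpha> - 1) * ((\<alpha> - (k + 1)) * (v r / r) - g (w r))\<bar>
        \<le> r powr (\<alpha> - 1) * (\<bar>(\<alpha> - (k + 1)) * (v r / r)\<bar> + \<bar>g (w r)\<bar>)"
        unfolding abs_mult[of "r powr (\<alpha> - 1)"] abs_of_nonneg[OF powr_ge_zero]
        by (intro mult_left_mono abs_triangle_ineq4 powr_ge_zero)
      also have "\<dots> = \<bar>\<alpha> - (k + 1)\<bar> * (r powr (\<alpha> - 1) * (\<bar>v r\<bar> / r)) + r powr (\<alpha> - 1) * \<bar>g (w r)\<bar>"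
        using that by (simp add: abs_mult distrib_left)
      also have "\<dots> \<le> \<bar>\<alpha> - (k + 1)\<bar> * (C * r powr (- \<delta> - 1)) + C powr (q - 1) * C * r powr (- \<delta> - 1)"
        by (intro add_mono mult_left_mono 1 2) auto
      finally show ?thesis by (simp add: K_def distrib_right mult.assoc)
    qed
    have osc: "\<bar>?J y - ?J x\<bar> \<le> D * x powr - \<delta>" if "1 \<le> x" "x \<le> y" for x y
    proof -
      have "\<bar>?J y - ?J x\<bar> \<le> - D * y powr - \<delta> - (- D * x powr - \<delta>)"
      proof (rule deriv_abs_dominated[where F = ?J and G = "\<lambda>r. - D * r powr - \<delta>"
            and F' = "\<lambda>r. r powr (\<alpha> - 1) * ((\<alpha> - (k + 1)) * (v r / r) - g (w r))"
            and G' = "\<lambda>r. - D * (- \<delta> * r powr (- \<delta> - 1))"])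
        show "continuous_on {x..y} ?J"
          using Jfun_cont[OF s, of x] that by auto
        show "continuous_on {x..y} (\<lambda>r. - D * r powr - \<delta>)"
          using that by (intro continuous_intros) auto
        fix r assume r: "x < r" "r < y"
        then have "r > 0" "r \<ge> 1" using that by auto
        show "(?J has_real_derivative r powr (\<alpha> - 1) * ((\<alpha> - (k + 1)) * (v r / r) - g (w r))) (at r)"
          using Jfun_deriv[OF s \<open>r > 0\<close>] .
        show "((\<lambda>r. - D * r powr - \<delta>) has_real_derivative - D * (- \<delta> * r powr (- \<delta> - 1))) (at r)"
          using \<open>r > 0\<close> by (intro DERIV_cmult has_real_derivative_powr)
        show "\<bar>r powr (\<alpha> - 1) * ((\<alpha> - (k + 1)) * (v r / r) - g (w r))\<bar> \<le> - D * (- \<delta> * r powr (- \<delta> - 1))"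
          using J'_bound[OF \<open>r \<ge> 1\<close>] \<delta> by (simp add: D_def)
      qed (use that in auto)
      also have "\<dots> \<le> D * x powr - \<delta>" using D by simp
      finally show ?thesis .
    qed
    have tend0: "((\<lambda>r::real. c * r powr - \<delta>) \<longlongrightarrow> 0) at_top" for c
      using \<delta>(1) by real_asymp
    \<comment> \<open>Integer radii suffice to produce the limit; \<open>osc\<close> carries the
      estimate over to all real radii.\<close>
    have "Cauchy (\<lambda>n. ?J (real n))"
    proof (rule metric_CauchyI)
      fix e :: real assume "e > 0"
      have "eventually (\<lambda>r. D * r powr - \<delta> < e / 2) at_top"
        using order_tendstoD(2)[OF tend0, of "e / 2"] \<open>e > 0\<close> by simp
      then obtain R where R: "\<And>r. r \<ge> R \<Longrightarrow> D * r powr - \<delta> < e / 2"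
        by (auto simp: eventually_at_top_linorder)
      define n0 where "n0 = nat \<lceil>max R 1\<rceil>"
      have n0: "real n0 \<ge> 1" "real n0 \<ge> R" unfolding n0_def by linarith+
      have *: "\<bar>?J (real n) - ?J (real n0)\<bar> < e / 2" if "n \<ge> n0" for n
        using osc[of "real n0" "real n"] R[OF n0(2)] n0 that by simp
      show "\<exists>M. \<forall>m\<ge>M. \<forall>n\<ge>M. dist (?J (real m)) (?J (real n)) < e"
      proof (intro exI[of _ n0] allI impI)
        fix m n assume "m \<ge> n0" "n \<ge> n0"
        then show "dist (?J (real m)) (?J (real n)) < e"
          using *[OF \<open>m \<ge> n0\<close>] *[OF \<open>n \<ge> n0\<close>] unfolding dist_real_def by linarith
      qed
    qed
    then obtain L where L: "(\<lambda>n. ?J (real n)) \<longlonglongrightarrow> L"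
      using Cauchy_convergent convergent_def by blast
    have JL: "\<bar>?J r - L\<bar> \<le> D * r powr - \<delta>" if "r \<ge> 1" for r
    proof -
      have "(\<lambda>n. \<bar>?J (real n) - ?J r\<bar>) \<longlonglongrightarrow> \<bar>L - ?J r\<bar>"
        by (intro tendsto_intros L)
      moreover have "eventually (\<lambda>n. \<bar>?J (real n) - ?J r\<bar> \<le> D * r powr - \<delta>) sequentially"
        using eventually_ge_at_top[of "nat \<lceil>r\<rceil>"]
      proof eventually_elim
        case (elim n)
        then have "r \<le> real n" by linarith
        then show ?case using osc[OF that] by simp
      qed
      ultimately have "\<bar>L - ?J r\<bar> \<le> D * r powr - \<delta>"
        by (intro tendsto_upperbound) auto
      then show ?thesis by (simp add: abs_minus_commute)
    qed
    have wL: "\<bar>r powr \<alpha> * w r - L\<bar> \<le> (D + C) * r powr - \<delta>" if "r \<ge> 1" for r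
    proof -
      have "r powr \<alpha> * w r - L = (?J r - L) - r powr (\<alpha> - 1) * v r"
        by (simp add: Jfun_def)
      then have "\<bar>r powr \<alpha> * w r - L\<bar> \<le> \<bar>?J r - L\<bar> + r powr (\<alpha> - 1) * \<bar>v r\<bar>"
        using abs_triangle_ineq4[of "?J r - L" "r powr (\<alpha> - 1) * v r"] by (simp add: abs_mult)
      then show ?thesis using JL[OF that] flux[OF that] by (simp add: distrib_right)
    qed
    have "((\<lambda>r. r powr \<alpha> * w r - L) \<longlongrightarrow> 0) at_top"
      by (rule Lim_null_comparison[OF _ tend0[of "D + C"]])
        (use wL in \<open>auto intro!: eventually_at_top_linorderI[of 1]\<close>)
    then have "((\<lambda>r. r powr \<alpha> * w r) \<longlongrightarrow> L) at_top"
      by (simp add: LIM_zero_iff)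
    with wL show "\<exists>L. ((\<lambda>r. r powr \<alpha> * w r) \<longlongrightarrow> L) at_top \<and>
        (\<forall>r\<ge>1. \<bar>r powr \<alpha> * w r - L\<bar> \<le> (D + C) * r powr - \<delta>)" by blast
  qed
qed

subsection \<open>Continuous dependence on the initial value\<close>

text \<open>For \<open>\<epsilon> = 1\<close> this is \<open>J\<close> with \<open>N\<close> in place of \<open>\<alpha>\<close>: its derivative contains no flux term.\<close>

definition Qfun :: "real \<Rightarrow> (real \<Rightarrow> real) \<Rightarrow> (real \<Rightarrow> real) \<Rightarrow> real \<Rightarrow> real" where
  "Qfun \<epsilon> w v r = r ^ k * v r + \<epsilon> * (r ^ Suc k * w r)"

text \<open>The integrating factor \<open>r ^ k\<close> removes the singular term
  \<open>(k / r) * v r\<close>.\<close>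

lemma power_v_deriv:
  assumes "sol \<epsilon> w v" "r > 0"
  shows "((\<lambda>r. r ^ k * v r) has_real_derivative - (r ^ k * (\<epsilon> * (r * \<phi> (v r) + \<alpha> * w r) + g (w r)))) (at r)"
proof -
  have "((\<lambda>r. r ^ k * v r) has_real_derivative
     (k * r ^ (k - 1)) * v r + (- (k / r) * v r - \<epsilon> * (r * \<phi> (v r) + \<alpha> * w r) - g (w r)) * r ^ k) (at r)"
    using DERIV_mult[OF DERIV_pow sol_v[OF assms], of k] by simp
  moreover have "k * r ^ (k - 1) = k / r * r ^ k"
    using assms(2) by (cases k) auto
  ultimately show ?thesis
    by (elim DERIV_cong) (simp add: algebra_simps)
qed

lemma Qfun_deriv:
  assumes "sol \<epsilon> w v" "r > 0"
  shows "(Qfun \<epsilon> w v has_real_derivative r ^ k * (\<epsilon> * ((k + 1 - \<alpha>) * w r) - g (w r))) (at r)"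
proof -
  have "(Qfun \<epsilon> w v has_real_derivative
     - (r ^ k * (\<epsilon> * (r * \<phi> (v r) + \<alpha> * w r) + g (w r))) +
     \<epsilon> * (Suc k * r ^ k * w r + \<phi> (v r) * r ^ Suc k)) (at r)"
    unfolding Qfun_def
    using DERIV_mult[OF DERIV_pow[of "Suc k" r UNIV] sol_w[OF assms]]
    by (intro DERIV_add DERIV_cmult power_v_deriv assms) simp
  then show ?thesis
    by (elim DERIV_cong) (simp add: algebra_simps)
qed

lemma power_v_cont:
  assumes "sol \<epsilon> w v" "x \<ge> 0"
  shows "continuous_on {x..y} (\<lambda>r. r ^ k * v r)"
  by (intro continuous_intros sol_cont_on(2)[OF assms(1)]) (use assms(2) in auto)

lemma Qfun_cont:
  assumes "sol \<epsilon> w v" "x \<ge> 0"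
  shows "continuous_on {x..y} (Qfun \<epsilon> w v)"
proof -
  have "continuous_on {x..y} w" "continuous_on {x..y} v"
    using assms(2) by (auto intro!: sol_cont_on[OF assms(1)])
  then show ?thesis
    unfolding Qfun_def by (intro continuous_intros)
qed

lemma DERIV_power_div: "((\<lambda>r. c * r ^ Suc k / Suc k) has_real_derivative c * r ^ k) (at r)"
  using DERIV_cdivide[OF DERIV_cmult[OF DERIV_pow[of "Suc k" r UNIV], of c], of "Suc k"] by simp

lemma abs_phi_le: "\<bar>x\<bar> \<le> M \<Longrightarrow> \<bar>\<phi> x\<bar> \<le> M powr (pconj - 1)"
  using pconj(1) unfolding abs_pflux by (intro powr_mono2) auto

lemma sol_w_lipschitz:
  assumes "sol \<epsilon> w v" "\<And>r. r \<ge> 0 \<Longrightarrow> \<bar>v r\<bar> \<le> M" "0 \<le> x" "x \<le> y"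
  shows "\<bar>w y - w x\<bar> \<le> M powr (pconj - 1) * (y - x)"
proof -
  have "\<bar>w y - w x\<bar> \<le> M powr (pconj - 1) * y - M powr (pconj - 1) * x"
  proof (rule deriv_abs_dominated[where F = w and G = "\<lambda>r. M powr (pconj - 1) * r"
        and F' = "\<lambda>r. \<phi> (v r)" and G' = "\<lambda>_. M powr (pconj - 1)"])
    show "continuous_on {x..y} w"
      using sol_cont(1)[OF assms(1)] by (rule continuous_on_subset) (use assms in auto)
    show "\<bar>\<phi> (v r)\<bar> \<le> M powr (pconj - 1)" if "x < r" for r
      using assms that by (intro abs_phi_le) auto
  qed (use assms sol_w in \<open>auto intro!: continuous_intros derivative_eq_intros\<close>)
  then show ?thesis by (simp add: right_diff_distrib)
qed

text \<open>On \<open>[0, R]\<close> the derivative of \<open>r ^ k * v r\<close> is at most a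
  constant times \<open>r ^ k\<close>. So \<open>v r / r\<close> stays bounded near 0, uniformly in
  the solution and in \<open>\<epsilon>\<close>.\<close>

lemma flux_linear:
  obtains C where "C > 0"
    "\<And>\<epsilon> w v r. \<lbrakk>sol \<epsilon> w v; 0 \<le> \<epsilon>; \<epsilon> \<le> 1; \<bar>w 0\<bar> \<le> A; 0 \<le> r; r \<le> R\<rbrakk> \<Longrightarrow> \<bar>v r\<bar> \<le> C * r"
proof -
  obtain M where M: "M \<ge> 1" "\<And>\<epsilon> w v r. \<lbrakk>sol \<epsilon> w v; 0 \<le> \<epsilon>; \<epsilon> \<le> 1; \<bar>w 0\<bar> \<le> A; r \<ge> 0\<rbrakk> \<Longrightarrow> \<bar>w r\<bar> \<le> M \<and> \<bar>v r\<bar> \<le> M"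
    using sol_bounded[of A] by blast
  define C where "C = \<bar>R\<bar> * M powr (pconj - 1) + \<alpha> * M + M powr (q - 1) * M"
  have "C > 0" unfolding C_def using M(1) alpha by (intro add_pos_nonneg add_nonneg_pos) auto
  moreover have "\<bar>v r\<bar> \<le> C * r"
    if s: "sol \<epsilon> w v" and e: "0 \<le> \<epsilon>" "\<epsilon> \<le> 1" and A: "\<bar>w 0\<bar> \<le> A" and r: "0 \<le> r" "r \<le> R" for \<epsilon> w v r
  proof (cases "r = 0")
    case False
    have bd: "\<bar>w r\<bar> \<le> M" "\<bar>v r\<bar> \<le> M" if "r \<ge> 0" for r using M(2)[OF s e A that] by auto
    have "\<bar>r ^ k * v r - 0 ^ k * v 0\<bar> \<le> C * r ^ Suc k / Suc k - C * 0 ^ Suc k / Suc k"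
    proof (rule deriv_abs_dominated[where F = "\<lambda>r. r ^ k * v r" and G = "\<lambda>r. C * r ^ Suc k / Suc k"
          and F' = "\<lambda>r. - (r ^ k * (\<epsilon> * (r * \<phi> (v r) + \<alpha> * w r) + g (w r)))" and G' = "\<lambda>r. C * r ^ k"])
      fix t assume t: "0 < t" "t < r"
      show "((\<lambda>r. r ^ k * v r) has_real_derivative - (t ^ k * (\<epsilon> * (t * \<phi> (v t) + \<alpha> * w t) + g (w t)))) (at t)"
        by (rule power_v_deriv[OF s t(1)])
      have "\<bar>t * \<phi> (v t) + \<alpha> * w t\<bar> \<le> \<bar>R\<bar> * M powr (pconj - 1) + \<alpha> * M"
      proof -
        have "\<bar>t * \<phi> (v t)\<bar> \<le> \<bar>R\<bar> * M powr (pconj - 1)"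
          unfolding abs_mult using t r bd[of t] by (intro mult_mono abs_phi_le) auto
        moreover have "\<bar>\<alpha> * w t\<bar> \<le> \<alpha> * M" using t bd(1)[of t] alpha by (simp add: abs_mult)
        ultimately show ?thesis by linarith
      qed
      then have "\<epsilon> * \<bar>t * \<phi> (v t) + \<alpha> * w t\<bar> \<le> 1 * (\<bar>R\<bar> * M powr (pconj - 1) + \<alpha> * M)"
        using e by (intro mult_mono) auto
      moreover have "\<bar>g (w t)\<bar> \<le> M powr (q - 1) * M"
        using abs_g_le[of "w t" M] bd[of t] t mult_left_mono[of "\<bar>w t\<bar>" M "M powr (q - 1)"] by simp
      moreover have "\<bar>\<epsilon> * (t * \<phi> (v t) + \<alpha> * w t) + g (w t)\<bar> \<le> \<epsilon> * \<bar>t * \<phi> (v t) + \<alpha> * w t\<bar> + \<bar>g (w t)\<bar>"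
        using abs_triangle_ineq[of "\<epsilon> * (t * \<phi> (v t) + \<alpha> * w t)" "g (w t)"] e by (simp add: abs_mult)
      ultimately have "\<bar>\<epsilon> * (t * \<phi> (v t) + \<alpha> * w t) + g (w t)\<bar> \<le> C"
        unfolding C_def mult_1_left by (meson add_mono order_trans)
      then show "\<bar>- (t ^ k * (\<epsilon> * (t * \<phi> (v t) + \<alpha> * w t) + g (w t)))\<bar> \<le> C * t ^ k"
        using t by (simp add: abs_mult)
    qed (use r power_v_cont[OF s] DERIV_power_div in \<open>auto intro!: continuous_intros simp del: power_Suc\<close>)
    then have "r ^ k * \<bar>v r\<bar> \<le> C * r ^ Suc k / Suc k"
      using r sol_v0[OF s] by (simp add: abs_mult)
    also have "\<dots> \<le> C * r ^ Suc k / 1"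
      using \<open>C > 0\<close> r by (intro divide_left_mono) auto
    also have "\<dots> = r ^ k * (C * r)" by simp
    finally show ?thesis using r False by simp
  qed (use sol_v0[OF that(1)] in simp)
  ultimately show ?thesis by (rule that)
qed

text \<open>Together with \<open>flux_linear\<close> this confines \<open>v\<close> to a sector away
  from 0. There \<open>\<phi>\<close> is differentiable, with a derivative bounded by a multiple of
  \<open>r powr (pconj - 2)\<close>.\<close>

lemma flux_near_0:
  assumes "a0 > 0"
  obtains x0 c where "0 < x0" "x0 \<le> 1" "c > 0"
    "\<And>w v r. \<lbrakk>sol 1 w v; a0 / 2 \<le> w 0; w 0 \<le> 2 * a0; 0 \<le> r; r \<le> x0\<rbrakk> \<Longrightarrow> v r \<le> - c * r"
proof -
  obtain M where M: "M \<ge> 1" "\<And>\<epsilon> w v r. \<lbrakk>sol \<epsilon> w v; 0 \<le> \<epsilon>; \<epsilon> \<le> 1; \<bar>w 0\<bar> \<le> 2 * a0; r \<ge> 0\<rbrakk> \<Longrightarrow> \<bar>w r\<bar> \<le> M \<and> \<bar>v r\<bar> \<le> M"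
    using sol_bounded[of "2 * a0"] by blast
  define B where "B = M powr (pconj - 1)"
  have B: "B > 0" using M by (simp add: B_def)
  \<comment> \<open>Up to \<open>x0\<close> the solution stays above \<open>a0 / 4\<close>, so
    \<open>\<alpha> * w\<close> is at least \<open>\<alpha> * a0 / 4\<close>, while the drag is at
    most half of that. The other half is \<open>c\<close>.\<close>
  define x0 where "x0 = min 1 (min (a0 / (4 * B)) (\<alpha> * a0 / (8 * B)))"
  have x0: "0 < x0" "x0 \<le> 1" "B * x0 \<le> a0 / 4" "B * x0 \<le> \<alpha> * a0 / 8"
  proof -
    show "0 < x0" "x0 \<le> 1" using assms B alpha by (auto simp: x0_def)
    have "x0 \<le> a0 / (4 * B)" "x0 \<le> \<alpha> * a0 / (8 * B)" by (auto simp: x0_def)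
    then show "B * x0 \<le> a0 / 4" "B * x0 \<le> \<alpha> * a0 / 8" using B by (simp_all add: field_simps)
  qed
  define c where "c = \<alpha> * a0 / 8"
  have "c > 0" using assms alpha by (simp add: c_def)
  show ?thesis
  proof (rule that[of x0 "c / Suc k"])
    fix w v and r :: real
    assume s: "sol 1 w v" and a: "a0 / 2 \<le> w 0" "w 0 \<le> 2 * a0" and r: "0 \<le> r" "r \<le> x0"
    have bd: "\<bar>w r\<bar> \<le> M" "\<bar>v r\<bar> \<le> M" if "r \<ge> 0" for r using M(2)[OF s, of r] that a assms by auto
    show "v r \<le> - (c / Suc k) * r"
    proof (cases "r = 0")
      case False
      have "r ^ k * v r - 0 ^ k * v 0 \<le> (- c) * r ^ Suc k / Suc k - (- c) * 0 ^ Suc k / Suc k"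
      proof (rule deriv_dominated[where F = "\<lambda>r. r ^ k * v r" and G = "\<lambda>r. (- c) * r ^ Suc k / Suc k"
          and F' = "\<lambda>r. - (r ^ k * (1 * (r * \<phi> (v r) + \<alpha> * w r) + g (w r)))" and G' = "\<lambda>r. (- c) * r ^ k"])
        fix t assume t: "0 < t" "t < r"
        show "((\<lambda>r. r ^ k * v r) has_real_derivative - (t ^ k * (1 * (t * \<phi> (v t) + \<alpha> * w t) + g (w t)))) (at t)"
          by (rule power_v_deriv[OF s t(1)])
        show "((\<lambda>r. (- c) * r ^ Suc k / Suc k) has_real_derivative (- c) * t ^ k) (at t)"
          by (rule DERIV_power_div)
        have "B * t \<le> B * x0" using B t r by simp
        have "\<bar>w t - w 0\<bar> \<le> B * t"
          using sol_w_lipschitz[OF s bd(2), of 0 t] t unfolding B_def by simp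
        then have w: "w t \<ge> a0 / 4" using a x0(3) \<open>B * t \<le> B * x0\<close> by linarith
        then have "g (w t) > 0" using assms by simp
        moreover have "\<alpha> * w t \<ge> \<alpha> * a0 / 4" using mult_left_mono[OF w, of \<alpha>] alpha by simp
        moreover have "\<bar>t * \<phi> (v t)\<bar> \<le> B * t"
          unfolding abs_mult B_def mult.commute[of _ t] using t bd[of t] by (intro mult_mono abs_phi_le) auto
        then have "- (t * \<phi> (v t)) \<le> B * t" by (rule abs_le_D2)
        ultimately have "c \<le> 1 * (t * \<phi> (v t) + \<alpha> * w t) + g (w t)"
          using x0(4) \<open>B * t \<le> B * x0\<close> unfolding c_def mult_1_left by linarith
        then show "- (t ^ k * (1 * (t * \<phi> (v t) + \<alpha> * w t) + g (w t))) \<le> (- c) * t ^ k"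
          using t mult_left_mono[of c _ "t ^ k"] by (simp add: mult.commute)
      qed (use r power_v_cont[OF s] DERIV_power_div in \<open>auto intro!: continuous_intros simp del: power_Suc\<close>)
      then have "r ^ k * v r \<le> r ^ k * (- (c / Suc k) * r)"
        using sol_v0[OF s] by (simp add: mult_ac)
      then show ?thesis using r False by (subst (asm) mult_le_cancel_left_pos) auto
    qed (use sol_v0[OF s] in simp)
  qed (use x0 \<open>c > 0\<close> in auto)
qed

text \<open>The derivative of \<open>Qfun\<close> depends on \<open>w\<close> but not on
  \<open>\<phi> (v r)\<close>, and \<open>g\<close> is Lipschitz on bounded sets. So the difference
  of two such functions is controlled by \<open>\<bar>w1 - w2\<bar>\<close> even where
  \<open>\<phi>\<close> is not Lipschitz.\<close>

lemma Qfun_diff: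
  assumes s: "sol 1 w1 v1" "sol 1 w2 v2" and M: "\<And>r. r \<ge> 0 \<Longrightarrow> \<bar>w1 r\<bar> \<le> M" "\<And>r. r \<ge> 0 \<Longrightarrow> \<bar>w2 r\<bar> \<le> M"
    and "0 \<le> x" "x \<le> y"
    and G: "continuous_on {x..y} G" "\<And>r. x < r \<Longrightarrow> r < y \<Longrightarrow> (G has_real_derivative G' r) (at r)"
    and le: "\<And>r. x < r \<Longrightarrow> r < y \<Longrightarrow> (\<bar>k + 1 - \<alpha>\<bar> + q * M powr (q - 1)) * (r ^ k * \<bar>w1 r - w2 r\<bar>) \<le> G' r"
  shows "\<bar>Qfun 1 w1 v1 y - Qfun 1 w2 v2 y\<bar> \<le> \<bar>Qfun 1 w1 v1 x - Qfun 1 w2 v2 x\<bar> + (G y - G x)"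
proof -
  define F where "F = (\<lambda>r. Qfun 1 w1 v1 r - Qfun 1 w2 v2 r)"
  define F' where "F' = (\<lambda>r. r ^ k * (1 * ((k + 1 - \<alpha>) * w1 r) - g (w1 r)) - r ^ k * (1 * ((k + 1 - \<alpha>) * w2 r) - g (w2 r)))"
  have "\<bar>F y - F x\<bar> \<le> G y - G x"
  proof (rule deriv_abs_dominated[where F = F and G = G and F' = F' and G' = G'])
    show "continuous_on {x..y} F"
      unfolding F_def using Qfun_cont s \<open>0 \<le> x\<close> by (intro continuous_intros) auto
    fix r assume r: "x < r" "r < y"
    then have "r > 0" using assms by auto
    then show "(F has_real_derivative F' r) (at r)"
      unfolding F_def F'_def by (intro DERIV_diff Qfun_deriv s)
    have "F' r = r ^ k * ((k + 1 - \<alpha>) * (w1 r - w2 r) - (g (w1 r) - g (w2 r)))"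
      by (simp add: F'_def algebra_simps)
    then have "\<bar>F' r\<bar> = r ^ k * \<bar>(k + 1 - \<alpha>) * (w1 r - w2 r) - (g (w1 r) - g (w2 r))\<bar>"
      using \<open>r > 0\<close> by (simp add: abs_mult)
    also have "\<dots> \<le> r ^ k * (\<bar>k + 1 - \<alpha>\<bar> * \<bar>w1 r - w2 r\<bar> + q * M powr (q - 1) * \<bar>w1 r - w2 r\<bar>)"
      unfolding abs_mult[symmetric, of "k + 1 - \<alpha>"]
      using M[of r] \<open>r > 0\<close> g_lipschitz[of "w1 r" M "w2 r"]
        abs_triangle_ineq4[of "(k + 1 - \<alpha>) * (w1 r - w2 r)" "g (w1 r) - g (w2 r)"]
      by (intro mult_left_mono) auto
    also have "\<dots> = (\<bar>k + 1 - \<alpha>\<bar> + q * M powr (q - 1)) * (r ^ k * \<bar>w1 r - w2 r\<bar>)"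
      by (simp add: algebra_simps)
    also have "\<dots> \<le> G' r" by (rule le[OF r])
    finally show "\<bar>F' r\<bar> \<le> G' r" .
  qed (use assms in auto)
  then show ?thesis unfolding F_def by linarith
qed

text \<open>Integrating in \<open>Qfun_diff\<close> from 0 and dividing by \<open>r ^ k\<close>
  leaves a factor \<open>r\<close>. This factor is essential: it compensates the singular Lipschitz
  constant in \<open>phi_diff\<close>.\<close>

lemma v_diff:
  assumes s: "sol 1 w1 v1" "sol 1 w2 v2" and M: "\<And>r. r \<ge> 0 \<Longrightarrow> \<bar>w1 r\<bar> \<le> M" "\<And>r. r \<ge> 0 \<Longrightarrow> \<bar>w2 r\<bar> \<le> M"
    and "0 \<le> r" and B: "\<And>s. 0 \<le> s \<Longrightarrow> s \<le> r \<Longrightarrow> \<bar>w1 s - w2 s\<bar> \<le> B"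
  shows "\<bar>v1 r - v2 r\<bar> \<le> (\<bar>k + 1 - \<alpha>\<bar> + q * M powr (q - 1) + 1) * B * r"
proof (cases "r = 0")
  case False
  define C where "C = \<bar>k + 1 - \<alpha>\<bar> + q * M powr (q - 1)"
  have C: "C \<ge> 0" using q by (simp add: C_def)
  have B0: "B \<ge> 0" using B[of 0] \<open>0 \<le> r\<close> by linarith
  have "\<bar>Qfun 1 w1 v1 r - Qfun 1 w2 v2 r\<bar> \<le> \<bar>Qfun 1 w1 v1 0 - Qfun 1 w2 v2 0\<bar> +
    (C * B * r ^ Suc k / Suc k - C * B * 0 ^ Suc k / Suc k)"
  proof (rule Qfun_diff[OF s, where G = "\<lambda>r. C * B * r ^ Suc k / Suc k" and G' = "\<lambda>r. C * B * r ^ k"])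
    fix t assume t: "0 < t" "t < r"
    have "C * (t ^ k * \<bar>w1 t - w2 t\<bar>) \<le> C * (t ^ k * B)"
      using t C B[of t] by (intro mult_left_mono) auto
    then show "(\<bar>k + 1 - \<alpha>\<bar> + q * M powr (q - 1)) * (t ^ k * \<bar>w1 t - w2 t\<bar>) \<le> C * B * t ^ k"
      by (simp add: C_def mult_ac)
  qed (use assms DERIV_power_div in \<open>auto intro!: continuous_intros simp del: power_Suc\<close>)
  also have "\<dots> \<le> C * B * r ^ Suc k"
  proof -
    have "C * B * r ^ Suc k / Suc k \<le> C * B * r ^ Suc k / 1"
      using C B0 \<open>0 \<le> r\<close> by (intro divide_left_mono) auto
    then show ?thesis using sol_v0[OF s(1)] sol_v0[OF s(2)] by (simp add: Qfun_def)
  qed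
  finally have 1: "\<bar>Qfun 1 w1 v1 r - Qfun 1 w2 v2 r\<bar> \<le> C * B * r ^ Suc k" .
  have "r ^ Suc k * \<bar>w1 r - w2 r\<bar> \<le> r ^ Suc k * B"
    using B[of r] \<open>0 \<le> r\<close> by (intro mult_left_mono) auto
  moreover have "r ^ k * (v1 r - v2 r) = (Qfun 1 w1 v1 r - Qfun 1 w2 v2 r) - r ^ Suc k * (w1 r - w2 r)"
    by (simp add: Qfun_def algebra_simps)
  then have "r ^ k * \<bar>v1 r - v2 r\<bar> \<le> \<bar>Qfun 1 w1 v1 r - Qfun 1 w2 v2 r\<bar> + r ^ Suc k * \<bar>w1 r - w2 r\<bar>"
    using abs_triangle_ineq4[of "Qfun 1 w1 v1 r - Qfun 1 w2 v2 r" "r ^ Suc k * (w1 r - w2 r)"] \<open>0 \<le> r\<close>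
    by (metis abs_mult abs_of_nonneg zero_le_power)
  ultimately have "r ^ k * \<bar>v1 r - v2 r\<bar> \<le> r ^ k * ((C + 1) * B * r)"
    using 1 by (simp add: algebra_simps)
  then show ?thesis using False \<open>0 \<le> r\<close> by (simp add: C_def)
qed (use sol_v0[OF s(1)] sol_v0[OF s(2)] in simp)

text \<open>Mean value bound on the sector. Both powers appear because the derivative of
  \<open>\<phi>\<close> is largest at the outer end if \<open>pconj \<ge> 2\<close> and at the inner
  end otherwise.\<close>

lemma phi_diff:
  assumes "0 < c" "0 < r" "- C * r \<le> x" "x \<le> - c * r" "- C * r \<le> y" "y \<le> - c * r"
  shows "\<bar>\<phi> x - \<phi> y\<bar> \<le> (pconj - 1) * (C powr (pconj - 2) + c powr (pconj - 2)) * r powr (pconj - 2) * \<bar>x - y\<bar>"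
proof -
  have "c * r > 0" "c \<le> C"
  proof -
    show "c * r > 0" using assms by simp
    have "c * r \<le> C * r" using assms by linarith
    then show "c \<le> C" using assms by simp
  qed
  have "norm (\<phi> x - \<phi> y) \<le> ((pconj - 1) * (C powr (pconj - 2) + c powr (pconj - 2)) * r powr (pconj - 2)) * norm (x - y)"
  proof (rule field_differentiable_bound[of "{- C * r..- c * r}"])
    fix z assume z: "z \<in> {- C * r..- c * r}"
    then have zn: "z < 0" "c * r \<le> \<bar>z\<bar>" "\<bar>z\<bar> \<le> C * r"
      using \<open>c * r > 0\<close> by auto
    show "(\<phi> has_field_derivative (pconj - 1) * \<bar>z\<bar> powr (pconj - 2)) (at z within {- C * r..- c * r})"
      using has_derivative_pflux[of z pconj] zn has_field_derivative_at_within by blast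
    have "\<bar>z\<bar> powr (pconj - 2) \<le> (C * r) powr (pconj - 2) + (c * r) powr (pconj - 2)"
    proof (cases "pconj \<ge> 2")
      case True
      then have "\<bar>z\<bar> powr (pconj - 2) \<le> (C * r) powr (pconj - 2)"
        using zn by (intro powr_mono2) auto
      then show ?thesis by (simp add: add_increasing2)
    next
      case False
      then have "\<bar>z\<bar> powr (pconj - 2) \<le> (c * r) powr (pconj - 2)"
        using zn \<open>c * r > 0\<close> by (intro powr_mono2') auto
      then show ?thesis by (simp add: add_increasing)
    qed
    also have "\<dots> = (C powr (pconj - 2) + c powr (pconj - 2)) * r powr (pconj - 2)"
      using assms \<open>c \<le> C\<close> by (simp add: powr_mult distrib_right)
    finally have "(pconj - 1) * \<bar>z\<bar> powr (pconj - 2) \<le> (pconj - 1) * ((C powr (pconj - 2) + c powr (pconj - 2)) * r powr (pconj - 2))"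
      using pconj(1) by (intro mult_left_mono) auto
    moreover have "0 \<le> (pconj - 1) * \<bar>z\<bar> powr (pconj - 2)"
      by (intro mult_nonneg_nonneg powr_ge_zero) (use pconj(1) in linarith)
    ultimately show "norm ((pconj - 1) * \<bar>z\<bar> powr (pconj - 2)) \<le> (pconj - 1) * (C powr (pconj - 2) + c powr (pconj - 2)) * r powr (pconj - 2)"
      by (simp only: mult.assoc real_norm_def abs_of_nonneg)
  qed (use assms in auto)
  then show ?thesis by simp
qed

text \<open>The factor \<open>r\<close> from \<open>v_diff\<close> times
  \<open>r powr (pconj - 2)\<close> from \<open>phi_diff\<close> is
  \<open>r powr (pconj - 1)\<close>, at most 1 on \<open>[0, x0]\<close>. So a Gronwall argument
  with rate \<open>H * D\<close> applies; \<open>K\<close> is larger by 1 to make the barrier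
  strict, and the strict bound \<open>\<eta>\<close> does the same at the start.\<close>

lemma dependence_near_0:
  assumes "a0 > 0"
  obtains x0 C where "0 < x0" "x0 \<le> 1" "C > 0"
    "\<And>w1 v1 w2 v2 \<eta> r. \<lbrakk>sol 1 w1 v1; sol 1 w2 v2; a0 / 2 \<le> w1 0; w1 0 \<le> 2 * a0; a0 / 2 \<le> w2 0; w2 0 \<le> 2 * a0;
       \<bar>w1 0 - w2 0\<bar> < \<eta>; 0 \<le> r; r \<le> x0\<rbrakk> \<Longrightarrow> \<bar>w1 r - w2 r\<bar> \<le> C * \<eta>"
proof -
  obtain M where M: "M \<ge> 1" "\<And>\<epsilon> w v r. \<lbrakk>sol \<epsilon> w v; 0 \<le> \<epsilon>; \<epsilon> \<le> 1; \<bar>w 0\<bar> \<le> 2 * a0; r \<ge> 0\<rbrakk> \<Longrightarrow> \<bar>w r\<bar> \<le> M \<and> \<bar>v r\<bar> \<le> M"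
    using sol_bounded[of "2 * a0"] by blast
  obtain x0 c where x0: "0 < x0" "x0 \<le> 1" and c: "c > 0" and
    lower: "\<And>w v r. \<lbrakk>sol 1 w v; a0 / 2 \<le> w 0; w 0 \<le> 2 * a0; 0 \<le> r; r \<le> x0\<rbrakk> \<Longrightarrow> v r \<le> - c * r"
    using flux_near_0[OF assms] by blast
  obtain C where C: "C > 0"
    "\<And>\<epsilon> w v r. \<lbrakk>sol \<epsilon> w v; 0 \<le> \<epsilon>; \<epsilon> \<le> 1; \<bar>w 0\<bar> \<le> 2 * a0; 0 \<le> r; r \<le> 1\<rbrakk> \<Longrightarrow> \<bar>v r\<bar> \<le> C * r"
    using flux_linear[of "2 * a0" 1] by blast
  define H where "H = (pconj - 1) * (C powr (pconj - 2) + c powr (pconj - 2))"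
  define D where "D = \<bar>k + 1 - \<alpha>\<bar> + q * M powr (q - 1) + 1"
  have H: "H \<ge> 0" using pconj(1) by (simp add: H_def)
  have D: "D \<ge> 0" using q by (simp add: D_def)
  define K where "K = H * D + 1"
  have K: "K > 0" using H D unfolding K_def by (simp add: add_nonneg_pos)
  show ?thesis
  proof (rule that[of x0 "exp (K * x0)"])
    fix w1 v1 w2 v2 and \<eta> r :: real
    assume s: "sol 1 w1 v1" "sol 1 w2 v2" and a: "a0 / 2 \<le> w1 0" "w1 0 \<le> 2 * a0" "a0 / 2 \<le> w2 0" "w2 0 \<le> 2 * a0"
      and \<eta>: "\<bar>w1 0 - w2 0\<bar> < \<eta>" and r: "0 \<le> r" "r \<le> x0"
    have bd: "\<bar>w1 r\<bar> \<le> M" "\<bar>w2 r\<bar> \<le> M" if "r \<ge> 0" for r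
      using M(2)[OF s(1), of r] M(2)[OF s(2), of r] that a assms by auto
    have "\<eta> > 0" using \<eta> by linarith
    define b where "b = (\<lambda>r. \<eta> * exp (K * r))"
    have b: "b r > 0" for r using \<open>\<eta> > 0\<close> by (simp add: b_def)
    have b_mono: "b r \<le> b t" if "r \<le> t" for r t using \<open>\<eta> > 0\<close> K that by (simp add: b_def)
    define h where "h = (\<lambda>r. b r * b r - (w1 r - w2 r) * (w1 r - w2 r))"
    define h' where "h' = (\<lambda>r. 2 * (b r * (K * b r)) - 2 * ((w1 r - w2 r) * (\<phi> (v1 r) - \<phi> (v2 r))))"
    have "h r > 0"
    proof (rule barrier[where h = h and h' = h' and x = 0])
      show "continuous_on {0..r} h"
        unfolding h_def b_def by (intro continuous_intros sol_cont_on(1)[OF s(1)] sol_cont_on(1)[OF s(2)]) auto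
      have "\<bar>w1 0 - w2 0\<bar> * \<bar>w1 0 - w2 0\<bar> < \<eta> * \<eta>" using \<eta> by (intro mult_strict_mono') auto
      then show "h 0 > 0" by (simp add: h_def b_def flip: abs_mult)
      fix t assume t: "0 < t" "t \<le> r"
      have db: "(b has_real_derivative K * b t) (at t)"
        unfolding b_def by (auto intro!: derivative_eq_intros)
      have dW: "((\<lambda>r. w1 r - w2 r) has_real_derivative \<phi> (v1 t) - \<phi> (v2 t)) (at t)"
        by (intro DERIV_diff sol_w[OF s(1)] sol_w[OF s(2)] t)
      show "(h has_real_derivative h' t) (at t)"
        unfolding h_def h'_def
        by (rule DERIV_cong[OF DERIV_diff[OF DERIV_mult[OF db db] DERIV_mult[OF dW dW]]]) simp
      assume "h t = 0" and before: "\<And>s. 0 \<le> s \<Longrightarrow> s < t \<Longrightarrow> h s > 0"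
      \<comment> \<open>\<open>v_diff\<close> asks for a bound on the whole interval up to
        \<open>t\<close>; positivity of \<open>h\<close> in the past and monotonicity of
        \<open>b\<close> provide it.\<close>
      have le: "\<bar>w1 s - w2 s\<bar> \<le> b t" if "0 \<le> s" "s \<le> t" for s
      proof -
        have "h s \<ge> 0" using before[of s] that \<open>h t = 0\<close> by (cases "s = t") (auto intro: less_imp_le)
        then have "(w1 s - w2 s)\<^sup>2 \<le> (b s)\<^sup>2" by (simp add: h_def power2_eq_square)
        then have "\<bar>w1 s - w2 s\<bar> \<le> \<bar>b s\<bar>" by (simp add: abs_le_square_iff)
        then show ?thesis using b[of s] b_mono[OF that(2)] by linarith
      qed
      have "\<bar>v1 t - v2 t\<bar> \<le> D * b t * t"
        unfolding D_def using v_diff[OF s bd, of t "b t"] le t by auto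
      moreover have "\<bar>\<phi> (v1 t) - \<phi> (v2 t)\<bar> \<le> H * t powr (pconj - 2) * \<bar>v1 t - v2 t\<bar>"
        unfolding H_def
      proof (rule phi_diff[OF c t(1)])
        show "v1 t \<le> - c * t" "v2 t \<le> - c * t"
          using lower[OF s(1) a(1,2), of t] lower[OF s(2) a(3,4), of t] t r by auto
        show "- C * t \<le> v1 t" "- C * t \<le> v2 t"
          using C(2)[OF s(1), of t] C(2)[OF s(2), of t] t r x0 a assms by auto
      qed
      moreover have "H * t powr (pconj - 2) * \<bar>v1 t - v2 t\<bar> \<le> H * t powr (pconj - 2) * (D * b t * t)"
        using H calculation(1) by (intro mult_left_mono) auto
      moreover have "H * t powr (pconj - 2) * (D * b t * t) \<le> H * D * b t"
      proof -
        have "t powr (pconj - 2) * t = t powr (pconj - 1)" using t by (simp add: powr_diff field_simps power2_eq_square)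
        also have "\<dots> \<le> 1 powr (pconj - 1)" using t r x0 pconj(1) by (intro powr_mono2) auto
        finally have "t powr (pconj - 2) * t \<le> 1" by simp
        then have "(H * D * b t) * (t powr (pconj - 2) * t) \<le> (H * D * b t) * 1"
          using H D b[of t] by (intro mult_left_mono) auto
        then show ?thesis by (simp add: mult_ac)
      qed
      ultimately have "\<bar>\<phi> (v1 t) - \<phi> (v2 t)\<bar> \<le> H * D * b t" by linarith
      then have "\<bar>w1 t - w2 t\<bar> * \<bar>\<phi> (v1 t) - \<phi> (v2 t)\<bar> \<le> b t * (H * D * b t)"
        using le[of t] t b[of t] by (intro mult_mono) auto
      moreover have "(w1 t - w2 t) * (\<phi> (v1 t) - \<phi> (v2 t)) \<le> \<bar>w1 t - w2 t\<bar> * \<bar>\<phi> (v1 t) - \<phi> (v2 t)\<bar>"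
        unfolding abs_mult[symmetric] by (rule abs_ge_self)
      moreover have "b t * (K * b t) = b t * (H * D * b t) + b t * b t"
        by (simp add: K_def algebra_simps)
      moreover have "b t * b t > 0" using b[of t] by simp
      ultimately show "h' t > 0" unfolding h'_def by linarith
    qed (use r in auto)
    then have "(w1 r - w2 r)\<^sup>2 \<le> (b r)\<^sup>2" by (simp add: h_def power2_eq_square)
    then have "\<bar>w1 r - w2 r\<bar> \<le> \<bar>b r\<bar>" by (simp add: abs_le_square_iff)
    also have "\<dots> = b r" using b[of r] by simp
    also have "\<dots> \<le> b x0" by (rule b_mono[OF r(2)])
    finally show "\<bar>w1 r - w2 r\<bar> \<le> exp (K * x0) * \<eta>" by (simp add: b_def mult.commute)
  qed (use x0 in auto)
qed

text \<open>Away from \<open>0\<close> no Lipschitz bound on \<open>\<phi>\<close> is needed: with \<open>W\<close>, \<open>V\<close>, \<open>Q\<close> the differences of the two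
  solutions, \<open>r^k V = Q - r^(k+1) W\<close>, so \<open>\<bar>W\<bar>\<close> can only grow where \<open>r^(k+1) \<bar>W\<bar> \<le> \<bar>Q\<bar>\<close>, and \<open>Q\<close> is controlled by
  an integral of \<open>W\<close>.\<close>

lemma dependence_away_from_0:
  assumes "x0 > 0"
  obtains C where "C > 0"
    "\<And>w1 v1 w2 v2 m r. \<lbrakk>sol 1 w1 v1; sol 1 w2 v2; \<And>r. r \<ge> 0 \<Longrightarrow> \<bar>w1 r\<bar> \<le> M; \<And>r. r \<ge> 0 \<Longrightarrow> \<bar>w2 r\<bar> \<le> M;
       m > 0; \<bar>w1 x0 - w2 x0\<bar> \<le> m; \<bar>Qfun 1 w1 v1 x0 - Qfun 1 w2 v2 x0\<bar> \<le> m; x0 \<le> r; r \<le> R\<rbrakk>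
       \<Longrightarrow> \<bar>w1 r - w2 r\<bar> \<le> C * m"
proof -
  define D where "D = \<bar>k + 1 - \<alpha>\<bar> + q * M powr (q - 1)"
  have D: "D \<ge> 0" using q by (simp add: D_def)
  define E where "E = x0 ^ Suc k"
  have E: "E > 0" using assms by (simp add: E_def)
  \<comment> \<open>\<open>K\<close> and \<open>A\<close> are such that, up to \<open>R\<close>, the
    growth of the \<open>Qfun\<close> difference and its initial size \<open>m\<close> each
    contribute at most \<open>E * b t / 4\<close>. The sum stays below \<open>E * b t\<close>, which
    is at most \<open>t ^ Suc k * b t\<close>.\<close>
  define K where "K = 4 * D * \<bar>R\<bar> ^ k / E + 1"
  have K: "K > 0" using D E by (simp add: K_def add_nonneg_pos)
  define A where "A = 4 / E + 2"
  have A: "A > 0" "A \<ge> 2" using E by (auto simp: A_def add_pos_pos)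
  show ?thesis
  proof (rule that[of "A * exp (K * (\<bar>R\<bar> + x0))"])
    show "A * exp (K * (\<bar>R\<bar> + x0)) > 0" using A by simp
    fix w1 v1 w2 v2 and m r :: real
    assume s: "sol 1 w1 v1" "sol 1 w2 v2"
      and bd: "\<And>r. r \<ge> 0 \<Longrightarrow> \<bar>w1 r\<bar> \<le> M" "\<And>r. r \<ge> 0 \<Longrightarrow> \<bar>w2 r\<bar> \<le> M"
      and m: "m > 0" "\<bar>w1 x0 - w2 x0\<bar> \<le> m" "\<bar>Qfun 1 w1 v1 x0 - Qfun 1 w2 v2 x0\<bar> \<le> m"
      and r: "x0 \<le> r" "r \<le> R"
    define b where "b = (\<lambda>r. A * m * exp (K * (r - x0)))"
    have b: "b r > 0" for r using m A by (simp add: b_def)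
    have b_ge: "b r \<ge> A * m" if "r \<ge> x0" for r using m A K that by (simp add: b_def)
    have db: "(b has_real_derivative K * b t) (at t)" for t
      unfolding b_def by (auto intro!: derivative_eq_intros)
    define h where "h = (\<lambda>r. b r * b r - (w1 r - w2 r) * (w1 r - w2 r))"
    define h' where "h' = (\<lambda>r. 2 * (b r * (K * b r)) - 2 * ((w1 r - w2 r) * (\<phi> (v1 r) - \<phi> (v2 r))))"
    have "h r > 0"
    proof (rule barrier[where h = h and h' = h' and x = x0])
      show "continuous_on {x0..r} h"
        unfolding h_def b_def using assms
        by (intro continuous_intros sol_cont_on(1)[OF s(1)] sol_cont_on(1)[OF s(2)]) auto
      have "\<bar>w1 x0 - w2 x0\<bar> < b x0"
        using b_ge[of x0] m A mult_right_mono[of 2 A m] by linarith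
      then have "\<bar>w1 x0 - w2 x0\<bar> * \<bar>w1 x0 - w2 x0\<bar> < b x0 * b x0" by (intro mult_strict_mono') auto
      then show "h x0 > 0" by (simp add: h_def flip: abs_mult)
      fix t assume t: "x0 < t" "t \<le> r"
      have t0: "t > 0" using t assms by simp
      have dW: "((\<lambda>r. w1 r - w2 r) has_real_derivative \<phi> (v1 t) - \<phi> (v2 t)) (at t)"
        by (intro DERIV_diff sol_w[OF s(1)] sol_w[OF s(2)] t0)
      show "(h has_real_derivative h' t) (at t)"
        unfolding h_def h'_def
        by (rule DERIV_cong[OF DERIV_diff[OF DERIV_mult[OF db db] DERIV_mult[OF dW dW]]]) simp
      assume "h t = 0" and before: "\<And>s. x0 \<le> s \<Longrightarrow> s < t \<Longrightarrow> h s > 0"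
      have le: "\<bar>w1 s - w2 s\<bar> \<le> b s" if "x0 \<le> s" "s \<le> t" for s
      proof -
        have "h s \<ge> 0" using before[of s] that \<open>h t = 0\<close> by (cases "s = t") (auto intro: less_imp_le)
        then have "(w1 s - w2 s)\<^sup>2 \<le> (b s)\<^sup>2" by (simp add: h_def power2_eq_square)
        then have "\<bar>w1 s - w2 s\<bar> \<le> \<bar>b s\<bar>" by (simp add: abs_le_square_iff)
        then show ?thesis using b[of s] by linarith
      qed
      have "(w1 t - w2 t)\<^sup>2 = (b t)\<^sup>2" using \<open>h t = 0\<close> by (simp add: h_def power2_eq_square)
      then have "w1 t - w2 t = b t \<or> w1 t - w2 t = - b t" by (simp add: power2_eq_iff)
      then have eq: "\<bar>w1 t - w2 t\<bar> = b t" using b[of t] by auto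
      let ?Q = "Qfun 1 w1 v1 t - Qfun 1 w2 v2 t"
      have "\<bar>?Q\<bar> \<le> \<bar>Qfun 1 w1 v1 x0 - Qfun 1 w2 v2 x0\<bar> + (D * \<bar>R\<bar> ^ k / K * b t - D * \<bar>R\<bar> ^ k / K * b x0)"
      proof (rule Qfun_diff[OF s bd, where G = "\<lambda>r. D * \<bar>R\<bar> ^ k / K * b r" and G' = "\<lambda>r. D * \<bar>R\<bar> ^ k / K * (K * b r)"])
        show "continuous_on {x0..t} (\<lambda>r. D * \<bar>R\<bar> ^ k / K * b r)"
          unfolding b_def using K by (intro continuous_intros) auto
        fix u assume u: "x0 < u" "u < t"
        show "((\<lambda>r. D * \<bar>R\<bar> ^ k / K * b r) has_real_derivative D * \<bar>R\<bar> ^ k / K * (K * b u)) (at u)"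
          by (intro DERIV_cmult db)
        have "u ^ k * \<bar>w1 u - w2 u\<bar> \<le> \<bar>R\<bar> ^ k * b u"
          using u t r assms le[of u] by (intro mult_mono power_mono) auto
        then have "D * (u ^ k * \<bar>w1 u - w2 u\<bar>) \<le> D * (\<bar>R\<bar> ^ k * b u)"
          using D by (intro mult_left_mono)
        then show "(\<bar>k + 1 - \<alpha>\<bar> + q * M powr (q - 1)) * (u ^ k * \<bar>w1 u - w2 u\<bar>) \<le> D * \<bar>R\<bar> ^ k / K * (K * b u)"
          using K unfolding D_def[symmetric] by (simp add: mult.assoc)
      qed (use t assms in auto)
      also have "\<dots> \<le> m + D * \<bar>R\<bar> ^ k / K * b t"
      proof -
        have "D * \<bar>R\<bar> ^ k / K * b x0 \<ge> 0" using D K b[of x0] by simp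
        then show ?thesis using m(3) by linarith
      qed
      also have "\<dots> < E * b t"
      proof -
        have "4 * m \<le> E * (A * m)"
          using E m by (simp add: A_def field_simps)
        also have "\<dots> \<le> E * b t" using E b_ge[of t] t by (intro mult_left_mono) auto
        finally have "m \<le> E * b t / 4" by simp
        moreover have "D * \<bar>R\<bar> ^ k / K \<le> E / 4"
        proof -
          have "4 * (D * \<bar>R\<bar> ^ k) \<le> E * K" using E by (simp add: K_def field_simps)
          then show ?thesis using K by (simp add: field_simps)
        qed
        then have "D * \<bar>R\<bar> ^ k / K * b t \<le> E / 4 * b t" using b[of t] by (intro mult_right_mono) auto
        moreover have "E / 4 * b t = E * b t / 4" by simp
        moreover have "E * b t > 0" using E b[of t] by simp
        ultimately show ?thesis using \<open>m \<le> E * b t / 4\<close> by linarith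
      qed
      also have "\<dots> \<le> t ^ Suc k * b t"
        unfolding E_def using t assms b[of t] by (intro mult_right_mono power_mono) auto
      finally have Q: "\<bar>?Q\<bar> < t ^ Suc k * b t" .
      have "(w1 t - w2 t) * (t ^ k * (v1 t - v2 t)) = (w1 t - w2 t) * ?Q - t ^ Suc k * ((w1 t - w2 t) * (w1 t - w2 t))"
        by (simp add: Qfun_def algebra_simps)
      moreover have "(w1 t - w2 t) * ?Q \<le> \<bar>w1 t - w2 t\<bar> * \<bar>?Q\<bar>"
        unfolding abs_mult[symmetric] by (rule abs_ge_self)
      moreover have "\<bar>w1 t - w2 t\<bar> * \<bar>?Q\<bar> < b t * (t ^ Suc k * b t)"
        unfolding eq using Q b[of t] by (rule mult_strict_left_mono)
      moreover have "(w1 t - w2 t) * (w1 t - w2 t) = b t * b t"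
        using \<open>h t = 0\<close> by (simp add: h_def)
      ultimately have "(w1 t - w2 t) * (t ^ k * (v1 t - v2 t)) < 0"
        by (simp add: mult_ac)
      then have "(w1 t - w2 t) * (v1 t - v2 t) < 0"
        using t0 by (simp add: mult_less_0_iff zero_less_mult_iff)
      \<comment> \<open>The two differences have opposite signs, and since \<open>\<phi>\<close> is
        increasing this passes from \<open>v1 t - v2 t\<close> to the difference of the
        derivatives.\<close>
      then have "(w1 t - w2 t) * (\<phi> (v1 t) - \<phi> (v2 t)) \<le> 0"
        using pflux_strict_mono[OF pconj(1), of "v1 t" "v2 t"] pflux_strict_mono[OF pconj(1), of "v2 t" "v1 t"]
        by (auto simp: mult_less_0_iff mult_le_0_iff)
      moreover have "b t * (K * b t) > 0" using b[of t] K by simp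
      ultimately show "h' t > 0" unfolding h'_def by linarith
    qed (use r in auto)
    then have "(w1 r - w2 r)\<^sup>2 \<le> (b r)\<^sup>2" by (simp add: h_def power2_eq_square)
    then have "\<bar>w1 r - w2 r\<bar> \<le> \<bar>b r\<bar>" by (simp add: abs_le_square_iff)
    also have "\<dots> = A * exp (K * (r - x0)) * m" using b[of r] by (simp add: b_def mult_ac)
    also have "\<dots> \<le> A * exp (K * (\<bar>R\<bar> + x0)) * m"
      using m A K r assms by (intro mult_right_mono mult_left_mono) auto
    finally show "\<bar>w1 r - w2 r\<bar> \<le> A * exp (K * (\<bar>R\<bar> + x0)) * m" .
  qed
qed

lemma continuous_dependence:
  assumes "a0 > 0" "R \<ge> 0"
  obtains C where "C > 0"
    "\<And>w1 v1 w2 v2 \<eta> r. \<lbrakk>sol 1 w1 v1; sol 1 w2 v2; a0 / 2 \<le> w1 0; w1 0 \<le> 2 * a0; a0 / 2 \<le> w2 0; w2 0 \<le> 2 * a0;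
       \<bar>w1 0 - w2 0\<bar> < \<eta>; 0 \<le> r; r \<le> R\<rbrakk> \<Longrightarrow> \<bar>w1 r - w2 r\<bar> \<le> C * \<eta> \<and> \<bar>v1 r - v2 r\<bar> \<le> C * \<eta>"
proof -
  obtain M where M: "M \<ge> 1" "\<And>\<epsilon> w v r. \<lbrakk>sol \<epsilon> w v; 0 \<le> \<epsilon>; \<epsilon> \<le> 1; \<bar>w 0\<bar> \<le> 2 * a0; r \<ge> 0\<rbrakk> \<Longrightarrow> \<bar>w r\<bar> \<le> M \<and> \<bar>v r\<bar> \<le> M"
    using sol_bounded[of "2 * a0"] by blast
  obtain x0 C0 where x0: "0 < x0" "x0 \<le> 1" and C0: "C0 > 0"
    "\<And>w1 v1 w2 v2 \<eta> r. \<lbrakk>sol 1 w1 v1; sol 1 w2 v2; a0 / 2 \<le> w1 0; w1 0 \<le> 2 * a0; a0 / 2 \<le> w2 0; w2 0 \<le> 2 * a0;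
       \<bar>w1 0 - w2 0\<bar> < \<eta>; 0 \<le> r; r \<le> x0\<rbrakk> \<Longrightarrow> \<bar>w1 r - w2 r\<bar> \<le> C0 * \<eta>"
    using dependence_near_0[OF assms(1)] by blast
  obtain C1 where C1: "C1 > 0"
    "\<And>w1 v1 w2 v2 m r. \<lbrakk>sol 1 w1 v1; sol 1 w2 v2; \<And>r. r \<ge> 0 \<Longrightarrow> \<bar>w1 r\<bar> \<le> M; \<And>r. r \<ge> 0 \<Longrightarrow> \<bar>w2 r\<bar> \<le> M;
       m > 0; \<bar>w1 x0 - w2 x0\<bar> \<le> m; \<bar>Qfun 1 w1 v1 x0 - Qfun 1 w2 v2 x0\<bar> \<le> m; x0 \<le> r; r \<le> R\<rbrakk>
       \<Longrightarrow> \<bar>w1 r - w2 r\<bar> \<le> C1 * m"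
    using dependence_away_from_0[OF x0(1)] by blast
  define D where "D = \<bar>k + 1 - \<alpha>\<bar> + q * M powr (q - 1) + 1"
  have D: "D \<ge> 1" using q by (simp add: D_def)
  \<comment> \<open>Covers both data at \<open>x0\<close>: the difference of the solutions costs
    \<open>C0\<close>, and that of the fluxes inside \<open>Qfun\<close> costs
    \<open>D * C0\<close>.\<close>
  define C2 where "C2 = C0 * (D + 1)"
  define C3 where "C3 = max C0 (C1 * C2)"
  have C2: "C2 > 0" "C0 \<le> C2" using C0(1) D by (auto simp: C2_def)
  have C3: "C3 > 0" using C0(1) by (simp add: C3_def)
  show ?thesis
  proof (rule that[of "C3 + D * C3 * R"])
    show "C3 + D * C3 * R > 0" using C3 D assms(2) by (simp add: add_pos_nonneg)
    fix w1 v1 w2 v2 and \<eta> r :: real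
    assume s: "sol 1 w1 v1" "sol 1 w2 v2" and a: "a0 / 2 \<le> w1 0" "w1 0 \<le> 2 * a0" "a0 / 2 \<le> w2 0" "w2 0 \<le> 2 * a0"
      and \<eta>: "\<bar>w1 0 - w2 0\<bar> < \<eta>" and r: "0 \<le> r" "r \<le> R"
    have "\<eta> > 0" using \<eta> by linarith
    have bd: "\<bar>w1 r\<bar> \<le> M" "\<bar>w2 r\<bar> \<le> M" if "r \<ge> 0" for r
      using M(2)[OF s(1), of r] M(2)[OF s(2), of r] that a assms by auto
    note near = C0(2)[OF s a \<eta>]
    have vnear: "\<bar>v1 x0 - v2 x0\<bar> \<le> D * (C0 * \<eta>) * x0"
      unfolding D_def using x0 by (intro v_diff[OF s bd] near) auto
    have W: "\<bar>w1 t - w2 t\<bar> \<le> C3 * \<eta>" if "0 \<le> t" "t \<le> R" for t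
    proof (cases "t \<le> x0")
      case True
      have "C0 * \<eta> \<le> C3 * \<eta>" using \<open>\<eta> > 0\<close> by (intro mult_right_mono) (auto simp: C3_def)
      then show ?thesis using near[OF that(1) True] by linarith
    next
      case False
      have "\<bar>w1 t - w2 t\<bar> \<le> C1 * (C2 * \<eta>)"
      proof (rule C1(2)[OF s bd])
        show "C2 * \<eta> > 0" using C2 \<open>\<eta> > 0\<close> by simp
        have w: "\<bar>w1 x0 - w2 x0\<bar> \<le> C0 * \<eta>" using near[of x0] x0 by simp
        have "C0 * \<eta> \<le> C2 * \<eta>" using C2 \<open>\<eta> > 0\<close> by (intro mult_right_mono) auto
        then show "\<bar>w1 x0 - w2 x0\<bar> \<le> C2 * \<eta>" using w by linarith
        have p: "0 \<le> x0 ^ n" "x0 ^ n \<le> 1" for n using x0 by (auto intro: power_le_one)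
        have "Qfun 1 w1 v1 x0 - Qfun 1 w2 v2 x0 = x0 ^ k * (v1 x0 - v2 x0) + x0 ^ Suc k * (w1 x0 - w2 x0)"
          by (simp add: Qfun_def algebra_simps)
        then have "\<bar>Qfun 1 w1 v1 x0 - Qfun 1 w2 v2 x0\<bar> \<le> \<bar>x0 ^ k * (v1 x0 - v2 x0)\<bar> + \<bar>x0 ^ Suc k * (w1 x0 - w2 x0)\<bar>"
          by (metis abs_triangle_ineq)
        also have "\<dots> = x0 ^ k * \<bar>v1 x0 - v2 x0\<bar> + x0 ^ Suc k * \<bar>w1 x0 - w2 x0\<bar>"
          using x0 by (simp add: abs_mult)
        also have "\<dots> \<le> 1 * (D * (C0 * \<eta>) * 1) + 1 * (C0 * \<eta>)"
        proof (intro add_mono mult_mono p w)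
          have "D * (C0 * \<eta>) * x0 \<le> D * (C0 * \<eta>) * 1"
            using D C0 \<open>\<eta> > 0\<close> x0 by (intro mult_left_mono) auto
          then show "\<bar>v1 x0 - v2 x0\<bar> \<le> D * (C0 * \<eta>) * 1" using vnear by linarith
        qed auto
        also have "\<dots> = C2 * \<eta>" by (simp add: C2_def algebra_simps)
        finally show "\<bar>Qfun 1 w1 v1 x0 - Qfun 1 w2 v2 x0\<bar> \<le> C2 * \<eta>" .
      qed (use False that in auto)
      also have "\<dots> \<le> C3 * \<eta>"
        using \<open>\<eta> > 0\<close> unfolding mult.assoc[symmetric] by (intro mult_right_mono) (auto simp: C3_def)
      finally show ?thesis .
    qed
    have "\<bar>v1 r - v2 r\<bar> \<le> D * (C3 * \<eta>) * r"
      unfolding D_def using r by (intro v_diff[OF s bd] W) auto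
    also have "\<dots> \<le> D * (C3 * \<eta>) * R"
      using D C3 \<open>\<eta> > 0\<close> r by (intro mult_left_mono) auto
    finally have V: "\<bar>v1 r - v2 r\<bar> \<le> D * C3 * R * \<eta>" by (simp add: mult_ac)
    have "0 \<le> D * C3 * R * \<eta>" "0 \<le> C3 * \<eta>" using D C3 \<open>\<eta> > 0\<close> assms(2) by auto
    then show "\<bar>w1 r - w2 r\<bar> \<le> (C3 + D * C3 * R) * \<eta> \<and> \<bar>v1 r - v2 r\<bar> \<le> (C3 + D * C3 * R) * \<eta>"
      using W[OF r] V unfolding distrib_right by linarith
  qed
qed

end

subsection \<open>Counting zeros\<close>

lemma isolated_in_iff_punctured:
  fixes S :: "real set"
  shows "x isolated_in S \<longleftrightarrow> x \<in> S \<and> (\<exists>d>0. \<forall>y\<in>S. \<bar>y - x\<bar> < d \<longrightarrow> y = x)"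
proof
  assume "x isolated_in S"
  then obtain T where T: "open T" "T \<inter> S = {x}" "x \<in> S" by (auto simp: isolated_in_def)
  then obtain d where "d > 0" "ball x d \<subseteq> T" using open_contains_ball by blast
  then show "x \<in> S \<and> (\<exists>d>0. \<forall>y\<in>S. \<bar>y - x\<bar> < d \<longrightarrow> y = x)"
    using T by (intro conjI exI[of _ d]) (auto simp: subset_eq dist_real_def abs_minus_commute)
next
  assume *: "x \<in> S \<and> (\<exists>d>0. \<forall>y\<in>S. \<bar>y - x\<bar> < d \<longrightarrow> y = x)"
  then obtain d where d: "d > 0" "\<And>y. y \<in> S \<Longrightarrow> \<bar>y - x\<bar> < d \<Longrightarrow> y = x" by blast
  have "ball x d \<inter> S = {x}"
    using * d by (auto simp: dist_real_def abs_minus_commute)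
  then show "x isolated_in S" using * by (auto simp: isolated_in_def)
qed

lemma card_eq_of_unique_in_parts:
  assumes "finite T" "\<And>t. t \<in> T \<Longrightarrow> \<exists>!z. z \<in> Z \<and> z \<in> I t"
    and "Z \<subseteq> (\<Union>t\<in>T. I t)" "\<And>t t'. t \<in> T \<Longrightarrow> t' \<in> T \<Longrightarrow> t \<noteq> t' \<Longrightarrow> I t \<inter> I t' = {}"
  shows "finite Z" "card Z = card T"
proof -
  have one: "\<exists>z. Z \<inter> I t = {z}" if "t \<in> T" for t
    using assms(2)[OF that] by blast
  have Z: "Z = (\<Union>t\<in>T. Z \<inter> I t)" using assms(3) by blast
  have fin: "finite (Z \<inter> I t)" if "t \<in> T" for t using one[OF that] by auto
  then show "finite Z" using Z assms(1) by (metis finite_UN_I)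
  have "card Z = (\<Sum>t\<in>T. card (Z \<inter> I t))"
    by (subst Z, rule card_UN_disjoint) (use assms(1,4) fin in blast)+
  also have "\<dots> = (\<Sum>t\<in>T. 1)"
  proof (intro sum.cong refl)
    show "card (Z \<inter> I t) = 1" if "t \<in> T" for t using one[OF that] by auto
  qed
  finally show "card Z = card T" by simp
qed

context plap
begin

section \<open>Simple zeros and their stability under perturbation\<close>

lemma simple_zero_neighbourhood:
  assumes "sol \<epsilon> w v" "r \<ge> 0" "w r = 0" "v r > 0"
  obtains d where "d > 0" "d < r" "\<And>y. r < y \<Longrightarrow> y < r + d \<Longrightarrow> w y > 0" "\<And>y. r - d < y \<Longrightarrow> y < r \<Longrightarrow> w y < 0"
proof -
  have "r > 0" using assms sol_v0[OF assms(1)] by (cases "r = 0") auto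
  note D = sol_w[OF assms(1) this]
  have "\<phi> (v r) > 0" using assms by simp
  obtain d1 where d1: "d1 > 0" "\<And>h. h > 0 \<Longrightarrow> h < d1 \<Longrightarrow> w r < w (r + h)"
    using DERIV_pos_inc_right[OF D \<open>\<phi> (v r) > 0\<close>] by auto
  obtain d2 where d2: "d2 > 0" "\<And>h. h > 0 \<Longrightarrow> h < d2 \<Longrightarrow> w (r - h) < w r"
    using DERIV_pos_inc_left[OF D \<open>\<phi> (v r) > 0\<close>] by auto
  show ?thesis
  proof (rule that[of "min (min d1 d2) (r / 2)"])
    show "min (min d1 d2) (r / 2) > 0" "min (min d1 d2) (r / 2) < r"
      using d1 d2 \<open>r > 0\<close> by auto
    show "w y > 0" if "r < y" "y < r + min (min d1 d2) (r / 2)" for y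
      using d1(2)[of "y - r"] that assms by auto
    show "w y < 0" if "r - min (min d1 d2) (r / 2) < y" "y < r" for y
      using d2(2)[of "r - y"] that assms by auto
  qed
qed

lemma simple_zero_isolated:
  assumes "sol \<epsilon> w v" "r \<ge> 0" "w r = 0" "v r \<noteq> 0"
  shows "r isolated_in zeros w"
proof -
  have *: "\<exists>d>0. \<forall>y. \<bar>y - r\<bar> < d \<longrightarrow> w y = 0 \<longrightarrow> y = r" if a: "sol \<epsilon> w v" "w r = 0" "v r > 0" for w v
  proof -
    obtain d where d: "d > 0" "d < r" "\<And>y. r < y \<Longrightarrow> y < r + d \<Longrightarrow> w y > 0"
      "\<And>y. r - d < y \<Longrightarrow> y < r \<Longrightarrow> w y < 0"
      by (rule simple_zero_neighbourhood[OF a(1) assms(2) a(2,3)]) (rule that)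
    have "y = r" if y: "\<bar>y - r\<bar> < d" "w y = 0" for y
    proof (rule ccontr)
      assume "y \<noteq> r"
      then consider "r < y" "y < r + d" | "r - d < y" "y < r" using y(1) by linarith
      then show False using d(3)[of y] d(4)[of y] y(2) by cases auto
    qed
    then show ?thesis using d(1) by auto
  qed
  have "\<exists>d>0. \<forall>y. \<bar>y - r\<bar> < d \<longrightarrow> w y = 0 \<longrightarrow> y = r"
  proof (cases "v r > 0")
    case True
    then show ?thesis using * assms by blast
  next
    case False
    then show ?thesis using *[OF sol_uminus[OF assms(1)]] assms by auto
  qed
  then show ?thesis
    unfolding isolated_in_iff_punctured zeros_def using assms by blast
qed

text \<open>The energy is positive at \<open>R\<close> and does not increase, so it is positive at
  every earlier zero, where only the flux can contribute. This also covers solutions that become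
  extinct after \<open>R\<close>.\<close>

lemma energy_pos_before:
  assumes "sol \<epsilon> w v" "\<epsilon> \<ge> 0" "w R \<noteq> 0" "0 \<le> r" "r \<le> R" "w r = 0"
  shows "v r \<noteq> 0"
proof -
  have "energy \<epsilon> w v R > 0" using energy_pos_iff[OF assms(2)] assms(3) by blast
  then have "energy \<epsilon> w v r > 0" using energy_antimono[OF assms(1,2,4,5)] by linarith
  then show ?thesis using energy_pos_iff[OF assms(2)] assms(6) by blast
qed

text \<open>An accumulation point of zeros would itself be a zero before \<open>R\<close>, hence
  simple, hence isolated.\<close>

lemma finite_zeros_before:
  assumes "sol \<epsilon> w v" "\<epsilon> \<ge> 0" "w R \<noteq> 0"
  shows "finite {r \<in> {0..R}. w r = 0}"
proof (rule ccontr)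
  let ?T = "{r \<in> {0..R}. w r = 0}"
  assume "infinite ?T"
  have "closed ?T"
    using continuous_closed_preimage_constant[of "{0..R}" w 0] sol_cont_on(1)[OF assms(1), of "{0..R}"] by auto
  obtain x where x: "x islimpt ?T"
    using \<open>infinite ?T\<close> compact_eq_Bolzano_Weierstrass[of "{0..R}"] by (metis (no_types, lifting) compact_Icc mem_Collect_eq subsetI)
  then have "x \<in> ?T" using \<open>closed ?T\<close> closed_limpt by blast
  then have "x isolated_in zeros w"
    using simple_zero_isolated[OF assms(1)] energy_pos_before[OF assms] by auto
  then obtain d where "d > 0" "\<And>y. y \<in> zeros w \<Longrightarrow> \<bar>y - x\<bar> < d \<Longrightarrow> y = x"
    unfolding isolated_in_iff_punctured by blast
  moreover obtain y where "y \<in> ?T" "y \<noteq> x" "dist y x < d"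
    using x \<open>d > 0\<close> unfolding islimpt_approachable by blast
  ultimately show False by (auto simp: zeros_def dist_real_def)
qed

lemma num_isolated_zeros_before:
  assumes "sol \<epsilon> w v" "\<epsilon> \<ge> 0" "w R \<noteq> 0" "\<And>r. r > R \<Longrightarrow> w r \<noteq> 0"
  shows "num_isolated_zeros w = enat (card {r \<in> {0..R}. w r = 0})"
proof -
  have "isolated_zeros w = {r \<in> {0..R}. w r = 0}"
  proof (intro equalityI subsetI)
    fix r assume "r \<in> isolated_zeros w"
    then have "r \<ge> 0" "w r = 0" by (auto simp: isolated_zeros_def isolated_in_def zeros_def)
    then show "r \<in> {r \<in> {0..R}. w r = 0}" using assms(4)[of r] by force
  next
    fix r assume "r \<in> {r \<in> {0..R}. w r = 0}"
    then show "r \<in> isolated_zeros w"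
      using simple_zero_isolated[OF assms(1)] energy_pos_before[OF assms(1-3)] by (auto simp: isolated_zeros_def)
  qed
  then show ?thesis
    using finite_zeros_before[OF assms(1-3)] by (simp add: num_isolated_zeros_def)
qed

text \<open>Off small intervals around the zeros \<open>w0\<close> is bounded away from 0, and on
  them \<open>v0\<close> is. A perturbation smaller than both bounds has no zero outside; inside
  each interval a sign change gives one zero, and Rolle's theorem excludes a second because
  \<open>v\<close> does not vanish. Closeness of the fluxes is needed for the latter.\<close>

lemma zero_count_stable:
  assumes s0: "sol 1 w0 v0" and "w0 0 \<noteq> 0" "w0 R \<noteq> 0" "R > 0"
  obtains c where "c > 0"
    "\<And>w v. sol 1 w v \<Longrightarrow> (\<And>r. 0 \<le> r \<Longrightarrow> r \<le> R \<Longrightarrow> \<bar>w r - w0 r\<bar> < c \<and> \<bar>v r - v0 r\<bar> < c) \<Longrightarrow>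
       w R \<noteq> 0 \<and> card {r \<in> {0..R}. w r = 0} = card {r \<in> {0..R}. w0 r = 0}"
proof -
  define T where "T = {r \<in> {0..R}. w0 r = 0}"
  have fin: "finite T" unfolding T_def by (rule finite_zeros_before[OF s0 _ assms(3)]) simp
  have T: "0 < t" "t < R" "w0 t = 0" "v0 t \<noteq> 0" if "t \<in> T" for t
  proof -
    show "w0 t = 0" using that by (simp add: T_def)
    show "0 < t" "t < R" using that assms(2,3) by (auto simp: T_def order.order_iff_strict)
    show "v0 t \<noteq> 0" using energy_pos_before[OF s0 _ assms(3), of t] that by (auto simp: T_def)
  qed
  have contv: "continuous_on {0..R} v0" and contw: "continuous_on {0..R} w0"
    using sol_cont_on[OF s0, of "{0..R}"] by auto
  have "\<exists>d>0. d < t \<and> d < R - t \<and> (\<forall>r. \<bar>r - t\<bar> \<le> d \<longrightarrow> v0 r * v0 t > 0)" if "t \<in> T" for t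
  proof -
    have "isCont v0 t" using sol_v[OF s0 T(1)[OF that]] DERIV_isCont by blast
    then have "isCont (\<lambda>r. v0 r * v0 t) t" by (intro continuous_intros)
    moreover have pos: "v0 t * v0 t > 0"
      using T(4)[OF that] by (cases "v0 t" "0::real" rule: linorder_cases) (auto simp: zero_less_mult_iff)
    ultimately have "eventually (\<lambda>r. v0 r * v0 t > 0) (at t)"
      unfolding isCont_def by (rule order_tendstoD(1))
    then obtain d where d: "d > 0" "\<And>r. dist r t < d \<Longrightarrow> v0 r * v0 t > 0"
      unfolding eventually_at using pos by (metis UNIV_I)
    show ?thesis
      using d T(1,2)[OF that] by (intro exI[of _ "min (d / 2) (min (t / 2) ((R - t) / 2))"]) (auto simp: dist_real_def min_less_iff_disj)
  qed
  then obtain df where df: "\<And>t. t \<in> T \<Longrightarrow> df t > 0 \<and> df t < t \<and> df t < R - t \<and> (\<forall>r. \<bar>r - t\<bar> \<le> df t \<longrightarrow> v0 r * v0 t > 0)"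
    by metis
  \<comment> \<open>A common radius on which \<open>v0\<close> keeps its sign near each zero; the
    entry 1 covers the case of no zeros.\<close>
  define \<delta> where "\<delta> = Min (insert 1 (df ` T))"
  have \<delta>: "\<delta> > 0" "\<And>t. t \<in> T \<Longrightarrow> \<delta> \<le> df t"
    using fin df by (auto simp: \<delta>_def)
  have vsign: "v0 r * v0 t > 0" if "t \<in> T" "\<bar>r - t\<bar> \<le> \<delta>" for t r
    using df[OF that(1)] \<delta>(2)[OF that(1)] that by auto
  have inR: "0 < t - \<delta>" "t + \<delta> < R" if "t \<in> T" for t
    using df[OF that] \<delta>(2)[OF that] by auto
  have mvt: "\<exists>z. x < z \<and> z < y \<and> w y - w x = (y - x) * \<phi> (v z)" if "sol 1 w v" "0 < x" "x < y" for w v x y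
  proof -
    have "\<exists>z>x. z < y \<and> w y - w x = (y - x) * \<phi> (v z)"
      by (rule MVT2) (use sol_w[OF that(1)] that in auto)
    then show ?thesis by blast
  qed
  \<comment> \<open>Between two closer zeros Rolle's theorem would place a zero of
    \<open>v0\<close>, within the radius where \<open>v0\<close> has a fixed sign.\<close>
  have sep: "\<bar>t - t'\<bar> > \<delta>" if t: "t \<in> T" "t' \<in> T" "t \<noteq> t'" for t t'
  proof -
    have *: "y - x > \<delta>" if xy: "x \<in> T" "y \<in> T" "x < y" for x y
    proof (rule ccontr)
      assume "\<not> y - x > \<delta>"
      obtain z where z: "x < z" "z < y" "w0 y - w0 x = (y - x) * \<phi> (v0 z)"
        using mvt[OF s0 T(1)[OF xy(1)] xy(3)] by blast
      then have "v0 z = 0" using T(3) xy by simp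
      moreover have "v0 z * v0 x > 0" using vsign[OF xy(1), of z] z \<open>\<not> y - x > \<delta>\<close> by auto
      ultimately show False by simp
    qed
    show ?thesis using *[of t t'] *[of t' t] t by (cases t t' rule: linorder_cases) auto
  qed
  \<comment> \<open>Half the radius, so that zeros more than \<open>\<delta>\<close> apart get
    disjoint intervals.\<close>
  define I where "I = (\<lambda>t. {t - \<delta> / 2<..<t + \<delta> / 2})"
  define K where "K = {0..R} - (\<Union>t\<in>T. I t)"
  have "compact K" unfolding K_def I_def by (intro compact_diff open_UN) auto
  have "0 \<in> K" using inR \<delta>(1) by (force simp: K_def I_def assms(4) less_imp_le)
  have "\<exists>x\<in>K. \<forall>y\<in>K. \<bar>w0 x\<bar> \<le> \<bar>w0 y\<bar>"
    using \<open>compact K\<close> \<open>0 \<in> K\<close>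
    by (intro continuous_attains_inf continuous_intros continuous_on_subset[OF contw]) (auto simp: K_def)
  then obtain x where x: "x \<in> K" "\<And>y. y \<in> K \<Longrightarrow> \<bar>w0 x\<bar> \<le> \<bar>w0 y\<bar>" by blast
  have "w0 x \<noteq> 0"
  proof
    assume "w0 x = 0"
    then have "x \<in> T" using x(1) by (auto simp: K_def T_def)
    then show False using x(1) \<delta>(1) by (auto simp: K_def I_def)
  qed
  have "\<exists>c>0. \<forall>t\<in>T. \<forall>r\<in>{t - \<delta> / 2..t + \<delta> / 2}. c \<le> \<bar>v0 r\<bar>"
  proof (cases "T = {}")
    case False
    let ?K = "\<Union>t\<in>T. {t - \<delta> / 2..t + \<delta> / 2}"
    have sub: "?K \<subseteq> {0..R}" using inR \<delta>(1) by fastforce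
    have "\<exists>x\<in>?K. \<forall>y\<in>?K. \<bar>v0 x\<bar> \<le> \<bar>v0 y\<bar>"
    proof (rule continuous_attains_inf)
      show "compact ?K" using fin by (intro compact_UN) auto
      show "?K \<noteq> {}" using False \<delta>(1) by fastforce
      show "continuous_on ?K (\<lambda>x. \<bar>v0 x\<bar>)"
        by (intro continuous_intros continuous_on_subset[OF contv sub])
    qed
    then obtain x where x: "x \<in> ?K" "\<And>y. y \<in> ?K \<Longrightarrow> \<bar>v0 x\<bar> \<le> \<bar>v0 y\<bar>" by blast
    then obtain t where "t \<in> T" "x \<in> {t - \<delta> / 2..t + \<delta> / 2}" by blast
    then have "v0 x * v0 t > 0" using vsign[of t x] \<delta>(1) by (auto simp: abs_le_iff)
    then have "\<bar>v0 x\<bar> > 0" by auto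
    then show ?thesis using x by (intro exI[of _ "\<bar>v0 x\<bar>"]) blast
  qed (auto intro: exI[of _ 1])
  then obtain cv where cv: "cv > 0" "\<And>t r. t \<in> T \<Longrightarrow> r \<in> {t - \<delta> / 2..t + \<delta> / 2} \<Longrightarrow> cv \<le> \<bar>v0 r\<bar>" by blast
  define c where "c = min cv \<bar>w0 x\<bar>"
  have c: "c > 0" using cv(1) \<open>w0 x \<noteq> 0\<close> by (simp add: c_def)
  have endpoints: "t - \<delta> / 2 \<in> K" "t + \<delta> / 2 \<in> K" "w0 (t - \<delta> / 2) * w0 (t + \<delta> / 2) < 0" if t: "t \<in> T" for t
  proof -
    have "t + s * (\<delta> / 2) \<notin> I t'" if "s = 1 \<or> s = -1" "t' \<in> T" for s t'
      using sep[OF t that(2)] that(1) \<delta>(1) by (cases "t = t'") (auto simp: I_def abs_if split: if_splits)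
    from this[of 1] this[of "-1"] show "t - \<delta> / 2 \<in> K" "t + \<delta> / 2 \<in> K"
      using inR[OF t] \<delta>(1) by (auto simp: K_def)
    obtain z1 where z1: "t - \<delta> / 2 < z1" "z1 < t" "w0 t - w0 (t - \<delta> / 2) = (t - (t - \<delta> / 2)) * \<phi> (v0 z1)"
      using mvt[OF s0, of "t - \<delta> / 2" t] inR[OF t] \<delta>(1) by auto
    obtain z2 where z2: "t < z2" "z2 < t + \<delta> / 2" "w0 (t + \<delta> / 2) - w0 t = (t + \<delta> / 2 - t) * \<phi> (v0 z2)"
      using mvt[OF s0, of t "t + \<delta> / 2"] T(1)[OF t] \<delta>(1) by auto
    have "v0 z1 * v0 t > 0" "v0 z2 * v0 t > 0"
      using vsign[OF t, of z1] vsign[OF t, of z2] z1 z2 \<delta>(1) by auto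
    then have "\<phi> (v0 z1) * \<phi> (v0 z2) > 0"
      by (auto simp: zero_less_mult_iff)
    moreover have "w0 (t - \<delta> / 2) * w0 (t + \<delta> / 2) = - ((\<delta> / 2)\<^sup>2 * (\<phi> (v0 z1) * \<phi> (v0 z2)))"
    proof -
      have "w0 (t - \<delta> / 2) = - (\<delta> / 2 * \<phi> (v0 z1))" "w0 (t + \<delta> / 2) = \<delta> / 2 * \<phi> (v0 z2)"
        using z1(3) z2(3) T(3)[OF t] by auto
      then show ?thesis by (simp add: power2_eq_square)
    qed
    ultimately show "w0 (t - \<delta> / 2) * w0 (t + \<delta> / 2) < 0" using \<delta>(1) by simp
  qed
  have "R \<in> K" using inR \<delta>(1) assms(4) by (force simp: K_def I_def)
  show ?thesis
  proof (rule that[OF c])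
    fix w v assume s: "sol 1 w v" and close: "\<And>r. 0 \<le> r \<Longrightarrow> r \<le> R \<Longrightarrow> \<bar>w r - w0 r\<bar> < c \<and> \<bar>v r - v0 r\<bar> < c"
    have wK: "w r * w0 r > 0" if "r \<in> K" for r
    proof -
      have "\<bar>w r - w0 r\<bar> < \<bar>w0 r\<bar>" using close[of r] x(2)[OF that] that by (auto simp: K_def c_def)
      then show ?thesis by (auto simp: zero_less_mult_iff abs_if split: if_splits)
    qed
    have vI: "v r \<noteq> 0" if "t \<in> T" "r \<in> I t" for t r
    proof -
      have "0 \<le> r" "r \<le> R" using that inR[of t] \<delta>(1) by (auto simp: I_def)
      moreover have "cv \<le> \<bar>v0 r\<bar>" using cv(2)[of t r] that by (auto simp: I_def)
      ultimately show ?thesis using close[of r] by (auto simp: c_def)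
    qed
    define Z where "Z = {r \<in> {0..R}. w r = 0}"
    have "card Z = card T"
    proof (rule card_eq_of_unique_in_parts(2)[OF fin, where I = I])
      show "Z \<subseteq> (\<Union>t\<in>T. I t)"
      proof
        fix r assume "r \<in> Z"
        then show "r \<in> (\<Union>t\<in>T. I t)" using wK[of r] by (auto simp: Z_def K_def)
      qed
      show "I t \<inter> I t' = {}" if "t \<in> T" "t' \<in> T" "t \<noteq> t'" for t t'
        using sep[OF that] by (auto simp: I_def abs_if split: if_splits)
      fix t assume t: "t \<in> T"
      have sgn: "w (t - \<delta> / 2) * w (t + \<delta> / 2) < 0"
        using wK[OF endpoints(1)[OF t]] wK[OF endpoints(2)[OF t]] endpoints(3)[OF t]
        by (auto simp: zero_less_mult_iff mult_less_0_iff)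
      have contI: "continuous_on {t - \<delta> / 2..t + \<delta> / 2} w"
        using inR[OF t] \<delta>(1) by (intro sol_cont_on(1)[OF s]) auto
      have "\<exists>z\<ge>t - \<delta> / 2. z \<le> t + \<delta> / 2 \<and> w z = 0"
      proof (cases "w (t - \<delta> / 2) < 0")
        case True
        then have "w (t + \<delta> / 2) > 0" using sgn by (simp add: mult_less_0_iff)
        then show ?thesis using True \<delta>(1) contI by (intro IVT') auto
      next
        case False
        then have "w (t + \<delta> / 2) < 0" "w (t - \<delta> / 2) > 0" using sgn by (auto simp: mult_less_0_iff)
        then show ?thesis using \<delta>(1) contI by (intro IVT2') auto
      qed
      then obtain z where z: "t - \<delta> / 2 \<le> z" "z \<le> t + \<delta> / 2" "w z = 0" by blast
      have "z \<noteq> t - \<delta> / 2" "z \<noteq> t + \<delta> / 2" using sgn z(3) by auto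
      then have zI: "z \<in> I t" using z by (auto simp: I_def)
      show "\<exists>!z. z \<in> Z \<and> z \<in> I t"
      proof (rule ex1I[of _ z])
        show "z \<in> Z \<and> z \<in> I t" using zI z inR[OF t] \<delta>(1) by (auto simp: Z_def)
        fix y assume y: "y \<in> Z \<and> y \<in> I t"
        have no: False if "a \<in> I t" "b \<in> I t" "w a = 0" "w b = 0" "a < b" for a b
        proof -
          have "a > 0" using that(1) inR[OF t] \<delta>(1) by (auto simp: I_def)
          then obtain u where u: "a < u" "u < b" "w b - w a = (b - a) * \<phi> (v u)"
            using mvt[OF s _ \<open>a < b\<close>] by blast
          then have "v u = 0" using that by simp
          moreover have "u \<in> I t" using u that by (auto simp: I_def)
          ultimately show False using vI[OF t] by blast
        qed
        show "y = z"
          using no[of y z] no[of z y] y zI z(3) by (cases y z rule: linorder_cases) (auto simp: Z_def)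
      qed
    qed
    moreover have "w R \<noteq> 0" using wK[OF \<open>R \<in> K\<close>] by auto
    ultimately show "w R \<noteq> 0 \<and> card {r \<in> {0..R}. w r = 0} = card {r \<in> {0..R}. w0 r = 0}"
      by (simp add: Z_def T_def)
  qed
qed

text \<open>Each zero found by a sign change precedes a point where \<open>w\<close> does not
  vanish, so by \<open>energy_pos_before\<close> it is simple and counts as isolated.\<close>

lemma sign_changes_imp_zeros:
  assumes s: "sol \<epsilon> w v" and "\<epsilon> \<ge> 0"
    and x: "x 0 \<ge> 0" "\<And>i. i < m \<Longrightarrow> x i < x (Suc i)" "\<And>i. i < m \<Longrightarrow> w (x i) * w (x (Suc i)) < 0"
  shows "enat m \<le> num_isolated_zeros w"
proof -
  have mono: "x i \<le> x j" if "i \<le> j" "j \<le> m" for i j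
    using that
  proof (induction j rule: dec_induct)
    case (step n)
    then show ?case using x(2)[of n] by force
  qed simp
  have nn: "x i \<ge> 0" if "i \<le> m" for i using mono[of 0 i] x(1) that by simp
  have "\<exists>z. x i < z \<and> z < x (Suc i) \<and> w z = 0" if "i < m" for i
  proof -
    have sgn: "w (x i) * w (x (Suc i)) < 0" using x(3)[OF that] .
    have c: "continuous_on {x i..x (Suc i)} w"
      using nn[of i] that by (intro sol_cont_on(1)[OF s]) auto
    have "\<exists>z\<ge>x i. z \<le> x (Suc i) \<and> w z = 0"
    proof (cases "w (x i) < 0")
      case True
      then have "w (x (Suc i)) > 0" using sgn by (simp add: mult_less_0_iff)
      then show ?thesis using True x(2)[OF that] c by (intro IVT') auto
    next
      case False
      then have "w (x (Suc i)) < 0" "w (x i) > 0" using sgn by (auto simp: mult_less_0_iff)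
      then show ?thesis using x(2)[OF that] c by (intro IVT2') auto
    qed
    then obtain z where "x i \<le> z" "z \<le> x (Suc i)" "w z = 0" by blast
    moreover have "z \<noteq> x i" "z \<noteq> x (Suc i)" using sgn \<open>w z = 0\<close> by auto
    ultimately show ?thesis by (intro exI[of _ z]) auto
  qed
  then obtain z where z: "\<And>i. i < m \<Longrightarrow> x i < z i \<and> z i < x (Suc i) \<and> w (z i) = 0" by metis
  have less: "z i < z j" if "i < j" "j < m" for i j
    using z[of i] z[of j] mono[of "Suc i" j] that by force
  have inj: "inj_on z {..<m}"
  proof (rule inj_onI)
    fix i j assume "i \<in> {..<m}" "j \<in> {..<m}" "z i = z j"
    then show "i = j" using less[of i j] less[of j i] by (cases i j rule: linorder_cases) auto
  qed
  have sub: "z ` {..<m} \<subseteq> isolated_zeros w"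
  proof
    fix y assume "y \<in> z ` {..<m}"
    then obtain i where i: "i < m" "y = z i" by auto
    have "w (x (Suc i)) \<noteq> 0" using x(3)[OF i(1)] by auto
    then have "v y \<noteq> 0"
      using energy_pos_before[OF s assms(2), of "x (Suc i)" y] z[OF i(1)] nn[of i] i by auto
    then show "y \<in> isolated_zeros w"
      using simple_zero_isolated[OF s, of y] z[OF i(1)] nn[of i] i by (auto simp: isolated_zeros_def)
  qed
  show ?thesis
  proof (cases "finite (isolated_zeros w)")
    case True
    then have "card (z ` {..<m}) \<le> card (isolated_zeros w)" using sub by (intro card_mono)
    then show ?thesis using True inj by (simp add: num_isolated_zeros_def card_image)
  qed (simp add: num_isolated_zeros_def)
qed

lemma zero_count_locally_constant:
  assumes s0: "sol 1 w0 v0" and "w0 0 > 0" "w0 R \<noteq> 0" "R > 0"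
  obtains \<rho> where "\<rho> > 0"
    "\<And>w v. sol 1 w v \<Longrightarrow> \<bar>w 0 - w0 0\<bar> < \<rho> \<Longrightarrow>
       w R \<noteq> 0 \<and> card {r \<in> {0..R}. w r = 0} = card {r \<in> {0..R}. w0 r = 0}"
proof -
  have "w0 0 \<noteq> 0" using assms by simp
  then obtain c where c: "c > 0"
    "\<And>w v. sol 1 w v \<Longrightarrow> (\<And>r. 0 \<le> r \<Longrightarrow> r \<le> R \<Longrightarrow> \<bar>w r - w0 r\<bar> < c \<and> \<bar>v r - v0 r\<bar> < c) \<Longrightarrow>
       w R \<noteq> 0 \<and> card {r \<in> {0..R}. w r = 0} = card {r \<in> {0..R}. w0 r = 0}"
    using zero_count_stable[OF s0 _ assms(3,4)] by blast
  obtain C where C: "C > 0"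
    "\<And>w1 v1 w2 v2 \<eta> r. \<lbrakk>sol 1 w1 v1; sol 1 w2 v2; w0 0 / 2 \<le> w1 0; w1 0 \<le> 2 * w0 0; w0 0 / 2 \<le> w2 0; w2 0 \<le> 2 * w0 0;
       \<bar>w1 0 - w2 0\<bar> < \<eta>; 0 \<le> r; r \<le> R\<rbrakk> \<Longrightarrow> \<bar>w1 r - w2 r\<bar> \<le> C * \<eta> \<and> \<bar>v1 r - v2 r\<bar> \<le> C * \<eta>"
    using continuous_dependence[OF assms(2) less_imp_le[OF assms(4)]] by blast
  define \<rho> where "\<rho> = min (w0 0 / 2) (c / (2 * C))"
  have "C * \<rho> \<le> C * (c / (2 * C))" using C by (intro mult_left_mono) (auto simp: \<rho>_def)
  then have \<rho>: "\<rho> > 0" "C * \<rho> < c" "\<rho> \<le> w0 0 / 2"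
    using assms C c by (auto simp: \<rho>_def)
  show ?thesis
  proof (rule that[OF \<rho>(1)])
    fix w v assume s: "sol 1 w v" and d: "\<bar>w 0 - w0 0\<bar> < \<rho>"
    then have range: "w0 0 / 2 \<le> w 0" "w 0 \<le> 2 * w0 0" "w0 0 / 2 \<le> w0 0" "w0 0 \<le> 2 * w0 0"
      using \<rho>(3) assms(2) by auto
    have "\<bar>w r - w0 r\<bar> < c \<and> \<bar>v r - v0 r\<bar> < c" if "0 \<le> r" "r \<le> R" for r
      using C(2)[OF s s0 range d that] \<rho>(2) by linarith
    then show "w R \<noteq> 0 \<and> card {r \<in> {0..R}. w r = 0} = card {r \<in> {0..R}. w0 r = 0}"
      by (rule c(2)[OF s])
  qed
qed

text \<open>For all nearby initial values the tail of \<open>r powr \<alpha> * w r\<close> beyond a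
  common \<open>R\<close> varies by less than a quarter of \<open>\<bar>L\<bar>\<close>, while its
  value at \<open>R\<close> stays at least three eighths of \<open>\<bar>L\<bar>\<close> in size.
  Hence no zeros lie beyond \<open>R\<close>, and up to \<open>R\<close> their number is stable.
  Finiteness of the count is part of the result.\<close>

lemma Z_locally_constant:
  assumes s0: "sol 1 w0 v0" and a0: "w0 0 > 0"
    and L: "((\<lambda>r. r powr \<alpha> * w0 r) \<longlongrightarrow> L) at_top" "L \<noteq> 0"
  obtains \<rho> n where "\<rho> > 0"
    "\<And>w v. sol 1 w v \<Longrightarrow> \<bar>w 0 - w0 0\<bar> < \<rho> \<Longrightarrow> num_isolated_zeros w = enat n"
proof -
  obtain C \<delta> where C: "C > 0" "\<delta> > 0"
    "\<And>w v. \<lbrakk>sol 1 w v; \<bar>w 0\<bar> \<le> 2 * w0 0\<rbrakk> \<Longrightarrow>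
       \<exists>L. ((\<lambda>r. r powr \<alpha> * w r) \<longlongrightarrow> L) at_top \<and> (\<forall>r\<ge>1. \<bar>r powr \<alpha> * w r - L\<bar> \<le> C * r powr - \<delta>)"
    using uniform_limit_at_top[of "2 * w0 0"] by blast
  have "((\<lambda>r. C * r powr - \<delta>) \<longlongrightarrow> 0) at_top" using C(2) by real_asymp
  then have "eventually (\<lambda>r. C * r powr - \<delta> < \<bar>L\<bar> / 8) at_top"
    by (rule order_tendstoD(2)) (use L(2) in auto)
  then obtain R0 where R0: "\<And>r. r \<ge> R0 \<Longrightarrow> C * r powr - \<delta> < \<bar>L\<bar> / 8"
    by (auto simp: eventually_at_top_linorder)
  define R where "R = max R0 1"
  have R: "R \<ge> 1" "\<And>r. r \<ge> R \<Longrightarrow> C * r powr - \<delta> < \<bar>L\<bar> / 8"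
    using R0 by (auto simp: R_def)
  have osc: "\<bar>r powr \<alpha> * w r - R powr \<alpha> * w R\<bar> < \<bar>L\<bar> / 4"
    if "sol 1 w v" "\<bar>w 0\<bar> \<le> 2 * w0 0" "r \<ge> R" for w v r
  proof -
    obtain L' where L': "\<forall>r\<ge>1. \<bar>r powr \<alpha> * w r - L'\<bar> \<le> C * r powr - \<delta>"
      using C(3)[OF \<open>sol 1 w v\<close> \<open>\<bar>w 0\<bar> \<le> 2 * w0 0\<close>] by blast
    have "\<bar>r powr \<alpha> * w r - L'\<bar> < \<bar>L\<bar> / 8" "\<bar>R powr \<alpha> * w R - L'\<bar> < \<bar>L\<bar> / 8"
      using L'[rule_format, of r] L'[rule_format, of R] R(1) R(2)[of r] R(2)[of R] that(3) by auto
    then show ?thesis by linarith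
  qed
  have wR: "\<bar>R powr \<alpha> * w0 R\<bar> > \<bar>L\<bar> / 2"
  proof -
    obtain L' where L': "((\<lambda>r. r powr \<alpha> * w0 r) \<longlongrightarrow> L') at_top" "\<forall>r\<ge>1. \<bar>r powr \<alpha> * w0 r - L'\<bar> \<le> C * r powr - \<delta>"
      using C(3)[OF s0] a0 by auto
    then have "L' = L" using L(1) tendsto_unique[of at_top] by force
    then have "\<bar>R powr \<alpha> * w0 R - L\<bar> < \<bar>L\<bar> / 8"
      using L'(2)[rule_format, of R] R(1) R(2)[of R] by auto
    then show ?thesis using L(2) by linarith
  qed
  have Rpos: "R \<ge> 0" "R > 0" using R(1) by auto
  obtain C' where C': "C' > 0"
    "\<And>w1 v1 w2 v2 \<eta> r. \<lbrakk>sol 1 w1 v1; sol 1 w2 v2; w0 0 / 2 \<le> w1 0; w1 0 \<le> 2 * w0 0; w0 0 / 2 \<le> w2 0; w2 0 \<le> 2 * w0 0;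
       \<bar>w1 0 - w2 0\<bar> < \<eta>; 0 \<le> r; r \<le> R\<rbrakk> \<Longrightarrow> \<bar>w1 r - w2 r\<bar> \<le> C' * \<eta> \<and> \<bar>v1 r - v2 r\<bar> \<le> C' * \<eta>"
    using continuous_dependence[OF a0 Rpos(1)] by blast
  have "w0 R \<noteq> 0" using wR by auto
  then obtain \<rho>1 where \<rho>1: "\<rho>1 > 0"
    "\<And>w v. sol 1 w v \<Longrightarrow> \<bar>w 0 - w0 0\<bar> < \<rho>1 \<Longrightarrow>
       w R \<noteq> 0 \<and> card {r \<in> {0..R}. w r = 0} = card {r \<in> {0..R}. w0 r = 0}"
    using zero_count_locally_constant[OF s0 a0 _ Rpos(2)] by blast
  \<comment> \<open>Scaled so that \<open>R powr \<alpha> * w R\<close> moves by at most an eighth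
    of \<open>\<bar>L\<bar>\<close>.\<close>
  define B where "B = \<bar>L\<bar> / (8 * (C' * R powr \<alpha>))"
  have B: "B > 0" "R powr \<alpha> * (C' * B) = \<bar>L\<bar> / 8" using L(2) C'(1) R(1) by (auto simp: B_def)
  define \<rho> where "\<rho> = min \<rho>1 (min (w0 0 / 2) B)"
  have \<rho>: "\<rho> > 0" "\<rho> \<le> \<rho>1" "\<rho> \<le> w0 0 / 2" "\<rho> \<le> B" using \<rho>1(1) a0 B by (auto simp: \<rho>_def)
  show ?thesis
  proof (rule that[OF \<rho>(1)])
    fix w v assume s: "sol 1 w v" and d: "\<bar>w 0 - w0 0\<bar> < \<rho>"
    then have range: "w0 0 / 2 \<le> w 0" "w 0 \<le> 2 * w0 0" "w0 0 / 2 \<le> w0 0" "w0 0 \<le> 2 * w0 0" "\<bar>w 0\<bar> \<le> 2 * w0 0"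
      using \<rho>(3) a0 by auto
    have "\<bar>w 0 - w0 0\<bar> < B" using d \<rho>(4) by linarith
    then have "\<bar>w R - w0 R\<bar> \<le> C' * B"
      using C'(2)[OF s s0 range(1-4), of B R] R(1) by auto
    then have "R powr \<alpha> * \<bar>w R - w0 R\<bar> \<le> R powr \<alpha> * (C' * B)"
      by (intro mult_left_mono) auto
    then have "\<bar>R powr \<alpha> * w R - R powr \<alpha> * w0 R\<bar> \<le> \<bar>L\<bar> / 8"
      unfolding B(2) by (simp add: abs_mult flip: right_diff_distrib)
    then have near: "\<bar>R powr \<alpha> * w R\<bar> \<ge> 3 * \<bar>L\<bar> / 8" using wR by linarith
    have far: "w r \<noteq> 0" if "r \<ge> R" for r
    proof
      assume "w r = 0"
      then show False using osc[OF s range(5) that] near by simp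
    qed
    have "card {r \<in> {0..R}. w r = 0} = card {r \<in> {0..R}. w0 r = 0}"
      using \<rho>1(2)[OF s] d \<rho>(2) by simp
    then show "num_isolated_zeros w = enat (card {r \<in> {0..R}. w0 r = 0})"
      using num_isolated_zeros_before[OF s _ far[of R]] far by simp
  qed
qed

section \<open>Small solutions in the case \<open>\<alpha> < N\<close>, and absence of extinction
  for \<open>p < 2\<close>\<close>

text \<open>The linear term dominates near 0 because \<open>q > 1\<close>. The positive expression
  is the one that drives \<open>Qfun\<close> in \<open>Qfun_deriv\<close>.\<close>

lemma small_threshold:
  assumes "\<alpha> < k + 1"
  obtains \<eta> where "\<eta> > 0" "\<And>x. 0 < x \<Longrightarrow> x \<le> \<eta> \<Longrightarrow> (k + 1 - \<alpha>) * x - g x > 0"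
proof -
  define c where "c = (k + 1 - \<alpha>) / 2"
  have c: "c > 0" using assms by (simp add: c_def)
  show ?thesis
  proof (rule that[of "c powr (1 / (q - 1))"])
    show "c powr (1 / (q - 1)) > 0" using c by simp
    fix x :: real assume x: "0 < x" "x \<le> c powr (1 / (q - 1))"
    have "x powr (q - 1) \<le> (c powr (1 / (q - 1))) powr (q - 1)"
      using x q by (intro powr_mono2) auto
    also have "\<dots> = c" using q c by (simp add: powr_powr)
    finally have "x powr (q - 1) * x \<le> c * x" using x by (intro mult_right_mono) auto
    moreover have "g x = x powr (q - 1) * x" using x by (simp add: pflux_def)
    moreover have "c * x > 0" using c x by simp
    moreover have "(k + 1 - \<alpha>) * x = c * x + c * x" by (simp add: c_def field_simps)
    ultimately show "(k + 1 - \<alpha>) * x - g x > 0" by linarith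
  qed
qed

text \<open>While \<open>w\<close> is positive and small, \<open>Qfun\<close> increases from a
  nonnegative value. At a first zero it reduces to \<open>r ^ k * v r\<close>, so the flux would be
  positive there, which is impossible for a function descending to 0.\<close>

lemma stays_positive:
  assumes s: "sol 1 w v" and \<eta>: "\<And>x. 0 < x \<Longrightarrow> x \<le> \<eta> \<Longrightarrow> (k + 1 - \<alpha>) * x - g x > 0"
    and small: "\<And>r. r \<ge> x \<Longrightarrow> \<bar>w r\<bar> \<le> \<eta>"
    and "x \<ge> 0" "w x > 0" "Qfun 1 w v x \<ge> 0" "y \<ge> x"
  shows "w y > 0"
proof (rule barrier[where h = w and h' = "\<lambda>r. \<phi> (v r)" and x = x])
  show "continuous_on {x..y} w" using assms by (intro sol_cont_on(1)[OF s]) auto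
  show "(w has_real_derivative \<phi> (v r)) (at r)" if "x < r" for r
    using sol_w[OF s, of r] that assms by auto
  fix r assume r: "x < r" "r \<le> y" "w r = 0" and before: "\<And>s. x \<le> s \<Longrightarrow> s < r \<Longrightarrow> w s > 0"
  have "Qfun 1 w v x < Qfun 1 w v r"
  proof (rule DERIV_pos_imp_increasing_open[OF r(1)])
    fix t assume t: "x < t" "t < r"
    then have "t > 0" using assms by auto
    have "(k + 1 - \<alpha>) * w t - g (w t) > 0"
      using before[of t] small[of t] t by (intro \<eta>) auto
    then have "t ^ k * (1 * ((k + 1 - \<alpha>) * w t) - g (w t)) > 0" using \<open>t > 0\<close> by simp
    then show "\<exists>d. (Qfun 1 w v has_real_derivative d) (at t) \<and> 0 < d"
      using Qfun_deriv[OF s \<open>t > 0\<close>] by blast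
  next
    show "continuous_on {x..r} (Qfun 1 w v)" using Qfun_cont[OF s] assms by auto
  qed
  then have "r ^ k * v r > 0" using assms r(3) by (simp add: Qfun_def)
  then have "v r > 0" using r(1) assms by (auto simp: zero_less_mult_iff)
  then show "\<phi> (v r) > 0" by simp
qed (use assms in auto)

text \<open>At a zero with positive flux \<open>Qfun\<close> is positive; by continuity, just to the
  right both \<open>w\<close> and \<open>Qfun\<close> are positive, and
  \<open>stays_positive\<close> takes over. The other sign follows by reflection.\<close>

lemma no_zero_after_zero:
  assumes s: "sol 1 w v" and \<eta>: "\<And>x. 0 < x \<Longrightarrow> x \<le> \<eta> \<Longrightarrow> (k + 1 - \<alpha>) * x - g x > 0"
    and small: "\<And>r. r \<ge> x \<Longrightarrow> \<bar>w r\<bar> \<le> \<eta>"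
    and "x \<ge> 0" "w x = 0" "v x \<noteq> 0" "y > x"
  shows "w y \<noteq> 0"
proof -
  have *: "w y > 0" if s: "sol 1 w v" and small: "\<And>r. r \<ge> x \<Longrightarrow> \<bar>w r\<bar> \<le> \<eta>" and z: "w x = 0" "v x > 0" for w v
  proof -
    obtain d where d: "d > 0" "d < x" "\<And>y. x < y \<Longrightarrow> y < x + d \<Longrightarrow> w y > 0"
       "\<And>y. x - d < y \<Longrightarrow> y < x \<Longrightarrow> w y < 0"
      by (rule simple_zero_neighbourhood[OF s \<open>x \<ge> 0\<close> z]) (rule that)
    then have "x > 0" by simp
    have "Qfun 1 w v x > 0" using z \<open>x > 0\<close> by (simp add: Qfun_def)
    moreover have "isCont (Qfun 1 w v) x" using Qfun_deriv[OF s \<open>x > 0\<close>] DERIV_isCont by blast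
    ultimately have "eventually (\<lambda>t. Qfun 1 w v t > 0) (at x)"
      unfolding isCont_def by (rule order_tendstoD(1)[rotated])
    then obtain e where e: "e > 0" "\<And>t. t \<noteq> x \<Longrightarrow> \<bar>t - x\<bar> < e \<Longrightarrow> Qfun 1 w v t > 0"
      unfolding eventually_at dist_real_def by auto
    define t where "t = x + min (min d e) (y - x) / 2"
    have t: "x < t" "t < x + d" "t - x < e" "t \<le> y"
      using d(1) e(1) \<open>y > x\<close> by (auto simp: t_def min_def field_simps)
    show ?thesis
    proof (rule stays_positive[OF s \<eta>, where x = t])
      show "w t > 0" using d(3) t by auto
      show "Qfun 1 w v t \<ge> 0" using e(2)[of t] t by auto
    qed (use t small \<open>x > 0\<close> in auto)
  qed
  show ?thesis
  proof (cases "v x > 0")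
    case True
    then show ?thesis using *[OF s small] assms by auto
  next
    case False
    then show ?thesis using *[OF sol_uminus[OF s]] small assms by auto
  qed
qed

text \<open>For \<open>p < 2\<close> the energy satisfies a linear differential inequality, hence cannot vanish in finite time.\<close>

lemma energy_never_zero:
  assumes s: "sol 1 w v" and "p < 2" "w 0 \<noteq> 0" "r0 \<ge> 0"
  shows "energy 1 w v r0 > 0"
proof (rule ccontr)
  assume "\<not> energy 1 w v r0 > 0"
  then have E0: "energy 1 w v r0 = 0" using energy_nonneg[of 1 w v r0] by simp
  obtain M where M: "M \<ge> 1" "\<And>\<epsilon> w' v' r. \<lbrakk>sol \<epsilon> w' v'; 0 \<le> \<epsilon>; \<epsilon> \<le> 1; \<bar>w' 0\<bar> \<le> \<bar>w 0\<bar>; r \<ge> 0\<rbrakk> \<Longrightarrow> \<bar>w' r\<bar> \<le> M \<and> \<bar>v' r\<bar> \<le> M"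
    using sol_bounded[of "\<bar>w 0\<bar>"] by blast
  have "r0 > 0"
    using E0 assms(3,4) energy_eq_0_iff[of 1 w v 0] by (cases "r0 = 0") auto
  have zero: "w x = 0" if x: "0 < x" "x < r0" for x
  proof -
    \<comment> \<open>The energy satisfies \<open>E' \<ge> - C * E\<close> on
      \<open>[x, r0]\<close>, so \<open>E * exp (C * r)\<close> is nondecreasing there and vanishing
      at \<open>r0\<close> forces vanishing at \<open>x\<close>. As \<open>k / x\<close> enters,
      \<open>x\<close> must be positive; the value at 0 is recovered by continuity.\<close>
    define C where "C = (k / x + r0 * M powr (pconj - 2)) * pconj"
    have "C \<ge> 0" using x pconj(1) \<open>r0 > 0\<close> unfolding C_def
      by (intro mult_nonneg_nonneg add_nonneg_nonneg) auto
    let ?E = "energy 1 w v"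
    have "- (?E r0 * exp (C * r0)) - (- (?E x * exp (C * x))) \<le> 0 - 0"
    proof (rule deriv_dominated[where F = "\<lambda>r. - (?E r * exp (C * r))" and G = "\<lambda>_. 0" and G' = "\<lambda>_. 0"
          and F' = "\<lambda>r. - ((- (k / r) * \<bar>v r\<bar> powr pconj - 1 * r * (\<phi> (v r))\<^sup>2) * exp (C * r) + (C * exp (C * r)) * ?E r)"])
      show "continuous_on {x..r0} (\<lambda>r. - (?E r * exp (C * r)))"
        using x by (intro continuous_intros continuous_on_subset[OF energy_cont[OF s]]) auto
      fix r assume r: "x < r" "r < r0"
      then have "r > 0" using x by simp
      have de: "((\<lambda>r. exp (C * r)) has_real_derivative C * exp (C * r)) (at r)"
        by (auto intro!: derivative_eq_intros)
      show "((\<lambda>r. - (?E r * exp (C * r))) has_real_derivative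
        - ((- (k / r) * \<bar>v r\<bar> powr pconj - 1 * r * (\<phi> (v r))\<^sup>2) * exp (C * r) + (C * exp (C * r)) * ?E r)) (at r)"
        by (intro DERIV_minus DERIV_mult energy_deriv[OF s \<open>r > 0\<close>] de)
      have "\<bar>v r\<bar> powr pconj / pconj \<le> ?E r"
        using alpha q by (simp add: energy_def)
      then have vE: "\<bar>v r\<bar> powr pconj \<le> pconj * ?E r"
        using pos_divide_le_eq[of pconj "\<bar>v r\<bar> powr pconj" "?E r"] pconj(1) by (simp only: mult.commute)
      have 1: "(k / r) * \<bar>v r\<bar> powr pconj \<le> (k / x) * \<bar>v r\<bar> powr pconj"
        using r x by (intro mult_right_mono divide_left_mono) auto
      \<comment> \<open>The point where \<open>p < 2\<close> enters: the drag contributes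
        \<open>\<bar>v r\<bar> powr (pconj - 2)\<close> times
        \<open>\<bar>v r\<bar> powr pconj\<close>, and the first factor is bounded because its
        exponent is nonnegative.\<close>
      have "pconj \<ge> 2" using assms(2) p by (simp add: field_simps)
      have "(\<phi> (v r))\<^sup>2 = \<bar>v r\<bar> powr (2 * (pconj - 1))"
      proof -
        have "(\<phi> (v r))\<^sup>2 = \<bar>\<phi> (v r)\<bar> * \<bar>\<phi> (v r)\<bar>" by (simp add: power2_eq_square)
        also have "\<dots> = \<bar>v r\<bar> powr ((pconj - 1) + (pconj - 1))"
          unfolding abs_pflux by (rule powr_add[symmetric])
        finally show ?thesis by (simp only: mult_2)
      qed
      also have "\<dots> = \<bar>v r\<bar> powr (pconj - 2) * \<bar>v r\<bar> powr pconj"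
        unfolding powr_add[symmetric] by (simp add: algebra_simps)
      also have "\<dots> \<le> M powr (pconj - 2) * \<bar>v r\<bar> powr pconj"
        using M(2)[OF s, of r] \<open>r > 0\<close> \<open>pconj \<ge> 2\<close> by (intro mult_right_mono powr_mono2) auto
      finally have "r * (\<phi> (v r))\<^sup>2 \<le> r0 * (M powr (pconj - 2) * \<bar>v r\<bar> powr pconj)"
        using r \<open>r > 0\<close> by (intro mult_mono) auto
      with 1 have "(k / r) * \<bar>v r\<bar> powr pconj + r * (\<phi> (v r))\<^sup>2 \<le> (k / x + r0 * M powr (pconj - 2)) * \<bar>v r\<bar> powr pconj"
        by (simp add: distrib_right mult.assoc)
      also have "\<dots> \<le> (k / x + r0 * M powr (pconj - 2)) * (pconj * ?E r)"
        using vE x \<open>r0 > 0\<close> by (intro mult_left_mono) auto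
      also have "\<dots> = C * ?E r" by (simp only: C_def mult.assoc)
      finally have "exp (C * r) * ((k / r) * \<bar>v r\<bar> powr pconj + r * (\<phi> (v r))\<^sup>2) \<le> exp (C * r) * (C * ?E r)"
        by (intro mult_left_mono) auto
      moreover have "- ((- (k / r) * \<bar>v r\<bar> powr pconj - 1 * r * (\<phi> (v r))\<^sup>2) * exp (C * r) + (C * exp (C * r)) * ?E r)
         = exp (C * r) * ((k / r) * \<bar>v r\<bar> powr pconj + r * (\<phi> (v r))\<^sup>2) - exp (C * r) * (C * ?E r)"
        by (simp only: left_diff_distrib right_diff_distrib distrib_left mult_ac mult_minus_left mult_minus_right minus_diff_eq minus_add_distrib mult_1_left)
      ultimately show "- ((- (k / r) * \<bar>v r\<bar> powr pconj - 1 * r * (\<phi> (v r))\<^sup>2) * exp (C * r) + (C * exp (C * r)) * ?E r) \<le> 0"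
        by linarith
    qed (use x in auto)
    then have "?E x * exp (C * x) \<le> 0" using E0 by simp
    then have "?E x \<le> 0" by (simp add: mult_le_0_iff not_le)
    then have "?E x = 0" using energy_nonneg[of 1 w v x] by simp
    then show ?thesis using energy_eq_0_iff[of 1 w v x] by simp
  qed
  have "w 0 = 0"
  proof (rule ccontr)
    assume "w 0 \<noteq> 0"
    have "continuous (at 0 within {0..}) w"
      using sol_cont(1)[OF s] by (simp add: continuous_on_eq_continuous_within)
    then have "eventually (\<lambda>x. w x \<noteq> 0) (at 0 within {0..})"
      unfolding continuous_within using \<open>w 0 \<noteq> 0\<close> by (rule tendsto_imp_eventually_ne)
    then obtain d where d: "d > 0" "\<And>x. x \<ge> 0 \<Longrightarrow> x \<noteq> 0 \<Longrightarrow> x < d \<Longrightarrow> w x \<noteq> 0"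
      unfolding eventually_at by auto
    have "w (min (d / 2) (r0 / 2)) \<noteq> 0" using d \<open>r0 > 0\<close> by (intro d(2)) auto
    moreover have "w (min (d / 2) (r0 / 2)) = 0" using d(1) \<open>r0 > 0\<close> by (intro zero) auto
    ultimately show False by simp
  qed
  then show False using assms(3) by simp
qed

lemma all_zeros_simple:
  assumes s: "sol 1 w v" and "p < 2" "w 0 \<noteq> 0" "r \<ge> 0" "w r = 0"
  shows "v r \<noteq> 0"
  using energy_never_zero[OF assms(1-4)] energy_pos_iff[of 1 w v r] assms(5) by simp

lemma isolated_zeros_eq:
  assumes s: "sol 1 w v" and "p < 2" "w 0 \<noteq> 0"
  shows "isolated_zeros w = zeros w"
proof (intro equalityI subsetI)
  fix r assume "r \<in> zeros w"
  then show "r \<in> isolated_zeros w"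
    using simple_zero_isolated[OF s] all_zeros_simple[OF assms] by (auto simp: isolated_zeros_def zeros_def)
qed (auto simp: isolated_zeros_def isolated_in_def)

subsection \<open>Oscillation of the limit problem\<close>

text \<open>With \<open>N = k + 1\<close> the coefficient \<open>(N - p) / p\<close> is the one for
  which \<open>\<bar>u\<bar> powr pconj\<close> drops out of the derivative. The remaining
  coefficient \<open>N / (q + 1) - (N - p) / p\<close> is positive exactly in the subcritical
  range.\<close>

definition pohozaev :: "(real \<Rightarrow> real) \<Rightarrow> (real \<Rightarrow> real) \<Rightarrow> real \<Rightarrow> real" where
  "pohozaev z u r = r ^ Suc k * energy 0 z u r + (k + 1 - p) / p * (r ^ k * u r * z r)"

lemma pohozaev_deriv:
  assumes "sol 0 z u" "r > 0"
  shows "(pohozaev z u has_real_derivative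
    ((k + 1) / (q + 1) - (k + 1 - p) / p) * (r ^ k * \<bar>z r\<bar> powr (q + 1))) (at r)"
proof -
  define c where "c = (k + 1 - p) / p"
  define U where "U = \<bar>u r\<bar> powr pconj"
  define G where "G = \<bar>z r\<bar> powr (q + 1)"
  have c: "(k + 1) / pconj - k + c = 0"
    using p by (simp add: c_def field_simps)
  have "(pohozaev z u has_real_derivative
     (Suc k * r ^ k * energy 0 z u r + (- (k / r) * \<bar>u r\<bar> powr pconj - 0 * r * (\<phi> (u r))\<^sup>2) * r ^ Suc k) +
     c * (- (r ^ k * (0 * (r * \<phi> (u r) + \<alpha> * z r) + g (z r))) * z r + \<phi> (u r) * (r ^ k * u r))) (at r)"
    unfolding pohozaev_def c_def
    using DERIV_mult[OF DERIV_pow[of "Suc k" r UNIV] energy_deriv[OF assms]]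
    by (intro DERIV_add DERIV_cmult DERIV_mult[OF power_v_deriv[OF assms] sol_w[OF assms]]) simp
  moreover have "(Suc k * r ^ k * energy 0 z u r + (- (k / r) * \<bar>u r\<bar> powr pconj - 0 * r * (\<phi> (u r))\<^sup>2) * r ^ Suc k) +
     c * (- (r ^ k * (0 * (r * \<phi> (u r) + \<alpha> * z r) + g (z r))) * z r + \<phi> (u r) * (r ^ k * u r))
     = r ^ k * ((k + 1) * (U / pconj + G / (q + 1)) - k * U + c * (U - G))"
  proof -
    have 1: "energy 0 z u r = U / pconj + G / (q + 1)" by (simp add: energy_def U_def G_def)
    have 2: "g (z r) * z r = G" "\<phi> (u r) * u r = U"
      using mult_pflux[of "z r" "q + 1"] mult_pflux[of "u r" pconj] by (simp_all add: U_def G_def mult.commute)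
    have 3: "(k / r) * U * r ^ Suc k = r ^ k * (k * U)" using assms(2) by simp
    have "(Suc k * r ^ k * energy 0 z u r + (- (k / r) * U - 0 * r * (\<phi> (u r))\<^sup>2) * r ^ Suc k) +
     c * (- (r ^ k * (0 * (r * \<phi> (u r) + \<alpha> * z r) + g (z r))) * z r + \<phi> (u r) * (r ^ k * u r))
     = Suc k * r ^ k * energy 0 z u r - (k / r) * U * r ^ Suc k + c * (r ^ k * (\<phi> (u r) * u r - g (z r) * z r))"
      by (simp add: algebra_simps)
    also have "\<dots> = r ^ k * ((k + 1) * (U / pconj + G / (q + 1)) - k * U + c * (U - G))"
      unfolding 1 2 3 by (simp add: algebra_simps add_divide_distrib diff_divide_distrib)
    finally show ?thesis unfolding U_def .
  qed
  moreover have "(k + 1) * (U / pconj + G / (q + 1)) - k * U + c * (U - G)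
      = ((k + 1) / (q + 1) - c) * G + ((k + 1) / pconj - k + c) * U"
    by (simp add: algebra_simps add_divide_distrib diff_divide_distrib)
  ultimately show ?thesis
    unfolding c by (elim DERIV_cong) (simp add: c_def G_def)
qed

text \<open>An eventually positive limit solution decays with the exponent
  \<open>p / (q + 1 - p)\<close>, provided \<open>q > p - 1\<close>. Otherwise its
  \<open>q\<close>-th power is weakened to a \<open>Q\<close>-th power, which is legitimate since
  the solution is at most 1. The last condition says that the resulting decay still makes the
  Pohozaev function tend to 0.\<close>

lemma subcritical_exponent:
  assumes "(k + 1 - p) * (q + 1) < (k + 1) * p"
  obtains Q where "Q \<ge> q" "Q > p - 1" "(k + 1) * (Q + 1 - p) < p * (q + 1)"
proof (cases "q > p - 1")
  case True
  then show ?thesis using assms by (intro that[of q]) (auto simp: algebra_simps)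
next
  case False
  \<comment> \<open>Half of the admissible slack: \<open>(k + 1) * e\<close> is half of
    \<open>p * (q + 1)\<close>.\<close>
  define e where "e = p * (q + 1) / (2 * (k + 1))"
  have "e > 0" using p q by (simp add: e_def)
  moreover have "(k + 1) * e = p * (q + 1) / 2" by (simp add: e_def field_simps)
  moreover have "p * (q + 1) > 0" using p q by simp
  ultimately show ?thesis using False by (intro that[of "p - 1 + e"]) auto
qed

context
  fixes z u :: "real \<Rightarrow> real"
  assumes s: "sol 0 z u" and z0: "\<bar>z 0\<bar> = 1"
    and subcrit: "(k + 1 - p) * (q + 1) < (k + 1) * p"
begin

lemma limit_bound: "r \<ge> 0 \<Longrightarrow> \<bar>z r\<bar> \<le> 1"
proof -
  assume "r \<ge> 0"
  then have "energy 0 z u r \<le> energy 0 z u 0" using energy_antimono[OF s] by simp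
  also have "\<dots> = 1 / (q + 1)" using sol_v0[OF s] z0 by (simp add: energy_def)
  finally show "\<bar>z r\<bar> \<le> 1" using energy_bound(1)[of 0 z u r "1 / (q + 1)"] q by simp
qed

lemma kappa_pos: "(k + 1) / (q + 1) - (k + 1 - p) / p > 0"
proof -
  have "(k + 1) / (q + 1) - (k + 1 - p) / p = ((k + 1) * p - (k + 1 - p) * (q + 1)) / ((q + 1) * p)"
    using p q by (simp add: diff_frac_eq)
  also have "\<dots> > 0" using subcrit p q by (intro divide_pos_pos) auto
  finally show ?thesis .
qed

lemma pohozaev_cont: "continuous_on {0..y} (pohozaev z u)"
proof -
  have "continuous_on {0..y} z" "continuous_on {0..y} u"
    by (auto intro!: sol_cont_on[OF s])
  moreover have "continuous_on {0..y} (energy 0 z u)"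
    using energy_cont[OF s] by (rule continuous_on_subset) auto
  ultimately show ?thesis
    unfolding pohozaev_def by (intro continuous_intros)
qed

lemma pohozaev_mono:
  assumes "0 \<le> x" "x \<le> y"
  shows "pohozaev z u x \<le> pohozaev z u y"
proof (rule DERIV_nonneg_imp_increasing_open[OF assms(2)])
  fix r assume "x < r" "r < y"
  then have "r > 0" using assms by simp
  then have "0 \<le> ((k + 1) / (q + 1) - (k + 1 - p) / p) * (r ^ k * \<bar>z r\<bar> powr (q + 1))"
    using kappa_pos by (intro mult_nonneg_nonneg) auto
  then show "\<exists>d. (pohozaev z u has_real_derivative d) (at r) \<and> 0 \<le> d"
    using pohozaev_deriv[OF s \<open>r > 0\<close>] by blast
next
  show "continuous_on {x..y} (pohozaev z u)"
    using pohozaev_cont by (rule continuous_on_subset) (use assms in auto)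
qed

text \<open>It starts at 0 and increases strictly near 0, where \<open>z\<close> is close to its
  nonzero initial value.\<close>

lemma pohozaev_pos:
  assumes "r > 0"
  shows "pohozaev z u r > 0"
proof -
  have "continuous (at 0 within {0..}) z"
    using sol_cont(1)[OF s] by (simp add: continuous_on_eq_continuous_within)
  then have "eventually (\<lambda>x. z x \<noteq> 0) (at 0 within {0..})"
    unfolding continuous_within by (rule tendsto_imp_eventually_ne) (use z0 in auto)
  then obtain d where d: "d > 0" "\<And>x. x \<ge> 0 \<Longrightarrow> x \<noteq> 0 \<Longrightarrow> x < d \<Longrightarrow> z x \<noteq> 0"
    unfolding eventually_at by auto
  have "pohozaev z u 0 < pohozaev z u (min d r)"
  proof (rule DERIV_pos_imp_increasing_open[of 0 "min d r" "pohozaev z u"])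
    show "0 < min d r" using d assms by simp
    fix x assume x: "0 < x" "x < min d r"
    then have "x ^ k * \<bar>z x\<bar> powr (q + 1) > 0" using d(2)[of x] by simp
    then have "((k + 1) / (q + 1) - (k + 1 - p) / p) * (x ^ k * \<bar>z x\<bar> powr (q + 1)) > 0"
      using kappa_pos by (rule mult_pos_pos[rotated])
    then show "\<exists>d. (pohozaev z u has_real_derivative d) (at x) \<and> 0 < d"
      using pohozaev_deriv[OF s x(1)] by blast
  qed (rule pohozaev_cont)
  also have "\<dots> \<le> pohozaev z u r" using d assms by (intro pohozaev_mono) auto
  finally show ?thesis by (simp add: pohozaev_def sol_v0[OF s])
qed

text \<open>Takes the place of a uniqueness theorem: a double zero would annihilate the Pohozaev
  function. Monotonicity of the energy alone would not exclude extinction.\<close>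

lemma not_both_zero: "r > 0 \<Longrightarrow> z r \<noteq> 0 \<or> u r \<noteq> 0"
  using pohozaev_pos[of r] energy_eq_0_iff[of 0 z u r] by (auto simp: pohozaev_def)

end

section \<open>Eventually positive solutions of the limit problem\<close>

text \<open>If \<open>u\<close> stayed nonnegative, \<open>z\<close> would not decrease, so
  \<open>r ^ k * u r\<close> would fall at least linearly and become negative. Once negative it
  remains so, because \<open>r ^ k * u r\<close> is nonincreasing.\<close>

lemma limit_eventually_decreasing:
  assumes s: "sol 0 z u" and "R \<ge> 1" and pos: "\<And>r. r \<ge> R \<Longrightarrow> z r > 0"
  obtains R' where "R' \<ge> R" "\<And>r. r \<ge> R' \<Longrightarrow> u r < 0"
    "\<And>x y. R \<le> x \<Longrightarrow> x \<le> y \<Longrightarrow> y ^ k * u y \<le> x ^ k * u x"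
    "\<And>x y. R' \<le> x \<Longrightarrow> x \<le> y \<Longrightarrow> z y \<le> z x"
proof -
  have md: "((\<lambda>r. r ^ k * u r) has_real_derivative - (r ^ k * g (z r))) (at r)" if "r > 0" for r
    using power_v_deriv[OF s that] by simp
  have cont: "continuous_on {x..y} (\<lambda>r. r ^ k * u r)" if "x \<ge> R" for x y
    using power_v_cont[OF s, of x y] that assms by auto
  have anti: "y ^ k * u y \<le> x ^ k * u x" if "R \<le> x" "x \<le> y" for x y
  proof (rule DERIV_nonpos_imp_decreasing_open[OF that(2) _ cont[OF that(1)]])
    fix r assume "x < r" "r < y"
    then have "r > 0" "z r > 0" using that assms pos[of r] by auto
    then have "- (r ^ k * g (z r)) \<le> 0" by (simp add: less_imp_le)
    then show "\<exists>d. ((\<lambda>r. r ^ k * u r) has_real_derivative d) (at r) \<and> d \<le> 0"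
      using md[OF \<open>r > 0\<close>] by blast
  qed
  have "\<exists>R'\<ge>R. u R' < 0"
  proof (rule ccontr)
    assume "\<not> ?thesis"
    then have nn: "u r \<ge> 0" if "r \<ge> R" for r using that by force
    have incr: "z R \<le> z y" if "R \<le> y" for y
    proof (rule DERIV_nonneg_imp_increasing_open[OF that])
      fix r assume r: "R < r" "r < y"
      then have "r > 0" using assms by simp
      have "\<phi> (u r) \<ge> 0" using nn[of r] r by (meson less_imp_le not_le pflux_neg_iff)
      then show "\<exists>d. (z has_real_derivative d) (at r) \<and> 0 \<le> d"
        using sol_w[OF s \<open>r > 0\<close>] by blast
    next
      show "continuous_on {R..y} z" using assms by (intro sol_cont_on(1)[OF s]) auto
    qed
    define d where "d = g (z R)"
    have d: "d > 0" using pos[of R] by (simp add: d_def)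
    \<comment> \<open>At this point the linear upper bound for \<open>r ^ k * u r\<close> has the
      value \<open>- d\<close>.\<close>
    define y where "y = R + R ^ k * u R / d + 1"
    have "R ^ k * u R / d \<ge> 0" using nn[of R] d assms by simp
    then have y: "y > R" by (simp add: y_def)
    have "y ^ k * u y - R ^ k * u R \<le> - d * y - (- d * R)"
    proof (rule deriv_dominated[where F = "\<lambda>r. r ^ k * u r" and G = "\<lambda>r. - d * r"
          and F' = "\<lambda>r. - (r ^ k * g (z r))" and G' = "\<lambda>_. - d"])
      fix r assume r: "R < r" "r < y"
      then have "r > 0" using assms by simp
      then show "((\<lambda>r. r ^ k * u r) has_real_derivative - (r ^ k * g (z r))) (at r)" by (rule md)
      show "((\<lambda>r. - d * r) has_real_derivative - d) (at r)" by (auto intro!: derivative_eq_intros)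
      have "1 \<le> r ^ k" using r assms by simp
      moreover have "d \<le> g (z r)"
        using incr[of r] r pflux_strict_mono[of "q + 1" "z R" "z r"] q by (cases "z R = z r") (auto simp: d_def)
      ultimately have "1 * d \<le> r ^ k * g (z r)" using d by (intro mult_mono) auto
      then show "- (r ^ k * g (z r)) \<le> - d" by simp
    qed (use y cont in \<open>auto intro!: continuous_intros\<close>)
    moreover have "d * (y - R) = R ^ k * u R + d" using d by (simp add: y_def field_simps)
    ultimately have "y ^ k * u y < 0" using d by (simp add: algebra_simps)
    moreover have "y ^ k * u y \<ge> 0" using nn[of y] y assms by simp
    ultimately show False by simp
  qed
  then obtain R' where R': "R' \<ge> R" "u R' < 0" by blast
  have neg: "u r < 0" if "r \<ge> R'" for r
  proof -
    have "r ^ k * u r \<le> R' ^ k * u R'" using anti[of R' r] R' that by simp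
    also have "\<dots> < 0" using R' assms by (simp add: mult_pos_neg)
    finally show ?thesis using that R' assms by (auto simp: mult_less_0_iff)
  qed
  have decr: "z y \<le> z x" if "R' \<le> x" "x \<le> y" for x y
  proof (rule DERIV_nonpos_imp_decreasing_open[OF that(2)])
    fix r assume r: "x < r" "r < y"
    then have "r > 0" "\<phi> (u r) \<le> 0" using neg[of r] that R' assms by (auto intro: less_imp_le)
    then show "\<exists>d. (z has_real_derivative d) (at r) \<and> d \<le> 0"
      using sol_w[OF s \<open>r > 0\<close>] by blast
  next
    show "continuous_on {x..y} z" using that R' assms by (intro sol_cont_on(1)[OF s]) auto
  qed
  show ?thesis by (rule that[OF R'(1) neg anti decr])
qed

text \<open>Integrating the flux equation over \<open>[r / 2, r]\<close>, where \<open>z\<close> is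
  at least \<open>z r\<close>, bounds \<open>- u r\<close> below by a multiple of
  \<open>r * z r powr Q\<close>. Applying \<open>\<phi>\<close> turns this into a separable
  inequality for \<open>z\<close>, which is integrated for \<open>z powr - \<sigma>\<close>.\<close>

lemma limit_decay:
  assumes s: "sol 0 z u" and "R \<ge> 1" and pos: "\<And>r. r \<ge> R \<Longrightarrow> z r > 0"
    and neg: "\<And>r. r \<ge> R \<Longrightarrow> u r < 0"
    and anti: "\<And>x y. R \<le> x \<Longrightarrow> x \<le> y \<Longrightarrow> y ^ k * u y \<le> x ^ k * u x"
    and decr: "\<And>x y. R \<le> x \<Longrightarrow> x \<le> y \<Longrightarrow> z y \<le> z x"
    and le1: "\<And>r. r \<ge> R \<Longrightarrow> z r \<le> 1"
    and Q: "Q \<ge> q" "Q > p - 1"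
  obtains C R' where "C > 0" "R' \<ge> R" "\<And>r. r \<ge> R' \<Longrightarrow> z r \<le> C * r powr - (p / (Q + 1 - p))"
proof -
  \<comment> \<open>Chosen with \<open>\<sigma> + 1 = Q * e\<close>, so that \<open>z\<close>
    disappears from the lower bound for the derivative of \<open>z powr - \<sigma>\<close>.\<close>
  define \<sigma> where "\<sigma> = (Q + 1 - p) / (p - 1)"
  define e where "e = 1 / (p - 1)"
  have \<sigma>: "\<sigma> > 0" "\<sigma> + 1 = Q * e" using Q p by (auto simp: \<sigma>_def e_def field_simps)
  have e: "e > 0" "e = pconj - 1" using p by (auto simp: e_def field_simps)
  \<comment> \<open>One factor 1/2 comes from the length of \<open>[r / 2, r]\<close>, the other
    \<open>k\<close> from the weight at its left end.\<close>
  define c :: real where "c = (1 / 2) ^ Suc k"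
  have c: "c > 0" by (simp add: c_def)
  have flux: "- u r \<ge> c * r * z r powr Q" if r: "r \<ge> 2 * R" for r
  proof -
    have r0: "r > 0" "r / 2 \<ge> R" "r / 2 > 0" "r \<ge> R" using r assms(2) by auto
    define G where "G = (r / 2) ^ k * g (z r)"
    have "r ^ k * u r - (r / 2) ^ k * u (r / 2) \<le> - G * r - (- G * (r / 2))"
    proof (rule deriv_dominated[where F = "\<lambda>r. r ^ k * u r" and G = "\<lambda>r. - G * r"
          and F' = "\<lambda>r. - (r ^ k * g (z r))" and G' = "\<lambda>_. - G"])
      fix t assume t: "r / 2 < t" "t < r"
      then have "t > 0" using r0 by simp
      then show "((\<lambda>r. r ^ k * u r) has_real_derivative - (t ^ k * g (z t))) (at t)"
        using power_v_deriv[OF s \<open>t > 0\<close>] by simp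
      show "((\<lambda>r. - G * r) has_real_derivative - G) (at t)" by (auto intro!: derivative_eq_intros)
      have "z r \<le> z t" using t r0 by (intro decr) auto
      then have "g (z r) \<le> g (z t)"
        using pflux_strict_mono[of "q + 1" "z r" "z t"] q by (cases "z r = z t") auto
      moreover have "(r / 2) ^ k \<le> t ^ k" using t r0 by (intro power_mono) auto
      moreover have "g (z r) \<ge> 0" using pos[OF r0(4)] by (simp add: pflux_def)
      ultimately have "G \<le> t ^ k * g (z t)" unfolding G_def using \<open>t > 0\<close> by (intro mult_mono) auto
      then show "- (t ^ k * g (z t)) \<le> - G" by simp
    qed (use r0 power_v_cont[OF s] in \<open>auto intro!: continuous_intros\<close>)
    moreover have "(r / 2) ^ k * u (r / 2) \<le> 0"
      using neg[of "r / 2"] r0 by (simp add: mult_le_0_iff less_imp_le)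
    ultimately have "r ^ k * u r \<le> - (G * (r / 2))" by (simp add: algebra_simps)
    also have "G * (r / 2) = r ^ k * (c * r * g (z r))"
      by (simp add: G_def c_def power_divide field_simps)
    finally have "r ^ k * (c * r * g (z r)) \<le> r ^ k * (- u r)" by simp
    then have "c * r * g (z r) \<le> - u r" using r0 by (subst (asm) mult_le_cancel_left_pos) auto
    moreover have "z r powr Q \<le> z r powr q"
      using pos[OF r0(4)] le1[OF r0(4)] Q by (intro powr_mono') auto
    then have "c * r * z r powr Q \<le> c * r * z r powr q" using c r0 by (intro mult_left_mono) auto
    ultimately show ?thesis using pos[OF r0(4)] by (simp add: pflux_of_pos)
  qed
  have dz: "- \<phi> (u r) \<ge> c powr e * r powr e * z r powr (\<sigma> + 1)" if r: "r \<ge> 2 * R" for r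
  proof -
    have r0: "r > 0" "r \<ge> R" using r assms(2) by auto
    have "(c * r * z r powr Q) powr e \<le> (- u r) powr e"
      using flux[OF r] c r0 e by (intro powr_mono2) auto
    also have "\<dots> = - \<phi> (u r)"
      using neg[OF r0(2)] pflux_of_pos[of "- u r" pconj] by (simp add: pflux_minus e(2))
    finally show ?thesis using c r0 by (simp add: powr_mult powr_powr \<sigma>(2))
  qed
  define K where "K = \<sigma> * c powr e / (e + 1)"
  have K: "K > 0" unfolding K_def using \<sigma>(1) c e(1) by (intro divide_pos_pos mult_pos_pos) auto
  define R1 where "R1 = 2 * R"
  have R1: "R1 \<ge> 1" "R1 \<ge> R" using assms(2) by (auto simp: R1_def)
  have growth: "z r powr - \<sigma> \<ge> K * r powr (e + 1) - K * R1 powr (e + 1)" if r: "r \<ge> R1" for r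
  proof -
    have "K * r powr (e + 1) - K * R1 powr (e + 1) \<le> z r powr - \<sigma> - z R1 powr - \<sigma>"
    proof (rule deriv_dominated[where F = "\<lambda>r. K * r powr (e + 1)" and G = "\<lambda>r. z r powr - \<sigma>"
          and F' = "\<lambda>r. K * ((e + 1) * r powr e)" and G' = "\<lambda>r. - \<sigma> * z r powr (- \<sigma> - 1) * \<phi> (u r)"])
      show "continuous_on {R1..r} (\<lambda>r. z r powr - \<sigma>)"
      proof (intro continuous_intros sol_cont_on(1)[OF s] ballI)
        show "z t \<noteq> 0" if "t \<in> {R1..r}" for t using pos[of t] that R1 by simp
      qed (use R1 in auto)
      show "continuous_on {R1..r} (\<lambda>r. K * r powr (e + 1))"
        using R1 by (intro continuous_intros) auto
      fix t assume t: "R1 < t" "t < r"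
      then have t0: "t > 0" "t \<ge> R" "t \<ge> 2 * R" using R1 by (auto simp: R1_def)
      show "((\<lambda>r. K * r powr (e + 1)) has_real_derivative K * ((e + 1) * t powr e)) (at t)"
        using has_real_derivative_powr[of t "e + 1"] t0 by (intro DERIV_cmult) simp
      show "((\<lambda>r. z r powr - \<sigma>) has_real_derivative - \<sigma> * z t powr (- \<sigma> - 1) * \<phi> (u t)) (at t)"
        by (rule DERIV_chain2[OF has_real_derivative_powr[OF pos[OF t0(2)]] sol_w[OF s t0(1)]])
      have "K * ((e + 1) * t powr e) = \<sigma> * (c powr e * t powr e)" using e(1) by (simp add: K_def)
      also have "c powr e * t powr e = z t powr (- \<sigma> - 1) * (c powr e * t powr e * z t powr (\<sigma> + 1))"
      proof -
        have "z t powr (- \<sigma> - 1) * z t powr (\<sigma> + 1) = 1"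
          using pos[OF t0(2)] by (simp flip: powr_add)
        then show ?thesis by (simp add: mult_ac)
      qed
      also have "\<sigma> * (z t powr (- \<sigma> - 1) * (c powr e * t powr e * z t powr (\<sigma> + 1)))
        \<le> \<sigma> * (z t powr (- \<sigma> - 1) * (- \<phi> (u t)))"
        using dz[OF t0(3)] \<sigma> by (intro mult_left_mono) auto
      finally show "K * ((e + 1) * t powr e) \<le> - \<sigma> * z t powr (- \<sigma> - 1) * \<phi> (u t)" by simp
    qed (use r in auto)
    moreover have "z R1 powr - \<sigma> \<ge> 0" by simp
    ultimately show ?thesis by linarith
  qed
  define C where "C = (K / 2) powr - (1 / \<sigma>)"
  have "C > 0" using K by (simp add: C_def)
  moreover have "2 * R1 \<ge> R" using R1 by simp
  moreover have "z r \<le> C * r powr - (p / (Q + 1 - p))" if r: "r \<ge> 2 * R1" for r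
  proof -
    have r0: "r > 0" "r \<ge> R" "r \<ge> R1" using r R1 by auto
    have "R1 powr (e + 1) \<le> (r / 2) powr (e + 1)" using r R1 e by (intro powr_mono2) auto
    also have "\<dots> = r powr (e + 1) / 2 powr (e + 1)" using r0 by (simp add: powr_divide)
    also have "\<dots> \<le> r powr (e + 1) / 2 powr 1"
      using e r0 by (intro divide_left_mono powr_mono) auto
    finally have "K * R1 powr (e + 1) \<le> K * (r powr (e + 1) / 2)" using K by (intro mult_left_mono) auto
    then have "K / 2 * r powr (e + 1) \<le> z r powr - \<sigma>" using growth[OF r0(3)] by simp
    then have "(z r powr - \<sigma>) powr - (1 / \<sigma>) \<le> (K / 2 * r powr (e + 1)) powr - (1 / \<sigma>)"
      using K r0 \<sigma> by (intro powr_mono2') auto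
    moreover have "(z r powr - \<sigma>) powr - (1 / \<sigma>) = z r"
      using \<sigma> pos[OF r0(2)] by (simp add: powr_powr)
    moreover have "(K / 2 * r powr (e + 1)) powr - (1 / \<sigma>) = C * r powr ((e + 1) * - (1 / \<sigma>))"
      unfolding C_def using K by (subst powr_mult) (auto simp: powr_powr)
    moreover have "(e + 1) * - (1 / \<sigma>) = - (p / (Q + 1 - p))"
      using p Q by (simp add: e_def \<sigma>_def divide_simps)
    ultimately show ?thesis by simp
  qed
  ultimately show ?thesis by (rule that)
qed

text \<open>An eventually nonnegative solution would decay so fast that the Pohozaev function is
  arbitrarily small at arbitrarily large radii, although it is positive and nondecreasing.\<close>

lemma limit_not_eventually_nonneg:
  assumes s: "sol 0 z u" and z0: "\<bar>z 0\<bar> = 1"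
    and subcrit: "(k + 1 - p) * (q + 1) < (k + 1) * p"
  shows "\<exists>r>R. z r < 0"
proof (rule ccontr)
  assume "\<not> ?thesis"
  then have nn: "z r \<ge> 0" if "r > R" for r using that by force
  define R0 where "R0 = max R 0 + 1"
  have R0: "R0 \<ge> 1" "R0 > R" by (auto simp: R0_def)
  \<comment> \<open>A zero would be simple by \<open>not_both_zero\<close>, so \<open>z\<close>
    would be negative just before it or just after it; \<open>R0 > R\<close> leaves room on the
    left.\<close>
  have pos: "z r > 0" if r: "r \<ge> R0" for r
  proof (rule ccontr)
    assume "\<not> z r > 0"
    then have zr: "z r = 0" using nn[of r] r R0 by auto
    have r0: "r > 0" "r > R" using r R0 by auto
    have "u r \<noteq> 0" using not_both_zero[OF s z0 subcrit r0(1)] zr by simp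
    have *: "\<exists>y>R. z y < 0" if "u r > 0"
    proof -
      obtain d where d: "d > 0" "d < r" "\<And>y. r < y \<Longrightarrow> y < r + d \<Longrightarrow> z y > 0"
         "\<And>y. r - d < y \<Longrightarrow> y < r \<Longrightarrow> z y < 0"
        by (rule simple_zero_neighbourhood[OF s less_imp_le[OF r0(1)] zr \<open>u r > 0\<close>]) (rule that)
      define y where "y = r - min d (r - R) / 2"
      have "y > R" "r - d < y" "y < r" using d(1) r0 by (auto simp: y_def min_def field_simps)
      then show ?thesis using d(4)[of y] by blast
    qed
    moreover have "\<exists>y>R. z y < 0" if "u r < 0"
    proof -
      have a: "- z r = 0" "- u r > 0" using zr that by auto
      obtain d where d: "d > 0" "d < r" "\<And>y. r < y \<Longrightarrow> y < r + d \<Longrightarrow> - z y > 0"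
         "\<And>y. r - d < y \<Longrightarrow> y < r \<Longrightarrow> - z y < 0"
        by (rule simple_zero_neighbourhood[OF sol_uminus[OF s] less_imp_le[OF r0(1)] a]) (rule that)
      have "z (r + d / 2) < 0" using d(3)[of "r + d / 2"] d(1) by auto
      then show ?thesis using r0 d(1) by (intro exI[of _ "r + d / 2"]) auto
    qed
    ultimately show False using \<open>u r \<noteq> 0\<close> \<open>\<not> (\<exists>r>R. z r < 0)\<close> by (meson linorder_neqE_linordered_idom)
  qed
  obtain R1 where R1: "R1 \<ge> R0" "\<And>r. r \<ge> R1 \<Longrightarrow> u r < 0"
    "\<And>x y. R0 \<le> x \<Longrightarrow> x \<le> y \<Longrightarrow> y ^ k * u y \<le> x ^ k * u x"
    "\<And>x y. R1 \<le> x \<Longrightarrow> x \<le> y \<Longrightarrow> z y \<le> z x"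
    by (rule limit_eventually_decreasing[OF s R0(1) pos]) (assumption, rule that)
  obtain Q where Q: "Q \<ge> q" "Q > p - 1" "(k + 1) * (Q + 1 - p) < p * (q + 1)"
    using subcritical_exponent[OF subcrit] by blast
  define \<beta> where "\<beta> = p / (Q + 1 - p)"
  have "R1 \<ge> 1" using R1(1) R0(1) by simp
  obtain C R2 where C: "C > 0" "R2 \<ge> R1" "\<And>r. r \<ge> R2 \<Longrightarrow> z r \<le> C * r powr - \<beta>"
  proof (rule limit_decay[OF s \<open>R1 \<ge> 1\<close> _ R1(2) _ R1(4) _ Q(1,2)])
    show "z r > 0" if "r \<ge> R1" for r using pos[of r] that R1(1) by simp
    show "y ^ k * u y \<le> x ^ k * u x" if "R1 \<le> x" "x \<le> y" for x y
      using R1(3)[of x y] that R1(1) by simp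
    show "z r \<le> 1" if "r \<ge> R1" for r
      using limit_bound[OF s z0 subcrit, of r] that \<open>R1 \<ge> 1\<close> by simp
  qed (auto simp: \<beta>_def intro: that)
  \<comment> \<open>These inequalities make both exponents in \<open>bound\<close> negative; the
    last one uses \<open>(\<beta> + 1) * p = \<beta> * (Q + 1)\<close>.\<close>
  have \<beta>: "\<beta> > 0" "\<beta> * (q + 1) > k + 1" "(\<beta> + 1) * p > k + 1"
  proof -
    show "\<beta> > 0" using Q p by (simp add: \<beta>_def)
    show 1: "\<beta> * (q + 1) > k + 1" using Q by (simp add: \<beta>_def pos_less_divide_eq)
    have "(\<beta> + 1) * p = \<beta> * (Q + 1)" using Q by (simp add: \<beta>_def field_simps)
    moreover have "\<beta> * (Q + 1) \<ge> \<beta> * (q + 1)" using Q \<open>\<beta> > 0\<close> by simp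
    ultimately show "(\<beta> + 1) * p > k + 1" using 1 by linarith
  qed
  define d where "d = \<bar>(k + 1 - p) / p\<bar>"
  define A where "A = 2 ^ Suc k * C powr p + d * (2 ^ k * C powr p)"
  define B where "B = 2 ^ Suc k * C powr (q + 1)"
  \<comment> \<open>The decay of \<open>z\<close> controls its derivative only on average: the mean
    value theorem gives one point in \<open>[r, 2 * r]\<close> where it is at most
    \<open>z r / r\<close> in size. One such point for every \<open>r\<close> is enough against a
    monotone function.\<close>
  have bound: "\<exists>t\<ge>r. pohozaev z u t \<le> A * r powr (k + 1 - (\<beta> + 1) * p) + B * r powr (k + 1 - \<beta> * (q + 1))"
    if r: "r \<ge> R2" for r
  proof -
    have r0: "r > 0" "r \<ge> R1" using r C(2) \<open>R1 \<ge> 1\<close> by auto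
    have "\<exists>t>r. t < 2 * r \<and> z (2 * r) - z r = (2 * r - r) * \<phi> (u t)"
      using r0 by (intro MVT2) (auto intro!: sol_w[OF s])
    then obtain t where t: "r < t" "t < 2 * r" "z (2 * r) - z r = r * \<phi> (u t)" by auto
    have zt: "0 < z t" "z t \<le> C * r powr - \<beta>" "0 < z (2 * r)"
      using pos[of t] pos[of "2 * r"] R1(1) R1(4)[of r t] C(3)[OF r] t r0 by auto
    have ut: "u t < 0" using R1(2)[of t] t r0 by simp
    have "r * \<bar>\<phi> (u t)\<bar> \<le> z r"
      using t(3) zt(3) ut r0 by (simp add: abs_of_neg)
    also have "\<dots> \<le> r * (C * r powr (- \<beta> - 1))"
      using C(3)[OF r] r0 by (simp add: powr_diff)
    finally have phi: "\<bar>\<phi> (u t)\<bar> \<le> C * r powr (- \<beta> - 1)" using r0 by (subst (asm) mult_le_cancel_left_pos) auto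
    have e: "\<bar>\<phi> (u t)\<bar> powr x = \<bar>u t\<bar> powr (x / (p - 1))" for x
      unfolding abs_pflux by (simp add: powr_powr pconj(2))
    have u1: "\<bar>u t\<bar> powr pconj \<le> C powr p * r powr (- (\<beta> + 1) * p)"
    proof -
      have "\<bar>u t\<bar> powr pconj = \<bar>\<phi> (u t)\<bar> powr p" by (simp only: e)
      also have "\<dots> \<le> (C * r powr (- \<beta> - 1)) powr p" using phi p by (intro powr_mono2) auto
      also have "\<dots> = C powr p * r powr ((- \<beta> - 1) * p)" using C r0 by (simp add: powr_mult powr_powr)
      finally show ?thesis by (simp only: minus_add_distrib diff_conv_add_uminus)
    qed
    have u2: "\<bar>u t\<bar> \<le> C powr (p - 1) * r powr (- (\<beta> + 1) * (p - 1))"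
    proof -
      have "\<bar>u t\<bar> = \<bar>\<phi> (u t)\<bar> powr (p - 1)" using p ut by (simp only: e) simp
      also have "\<dots> \<le> (C * r powr (- \<beta> - 1)) powr (p - 1)" using phi p by (intro powr_mono2) auto
      also have "\<dots> = C powr (p - 1) * r powr ((- \<beta> - 1) * (p - 1))" using C r0 by (simp add: powr_mult powr_powr)
      finally show ?thesis by (simp only: minus_add_distrib diff_conv_add_uminus)
    qed
    have z1: "\<bar>z t\<bar> powr (q + 1) \<le> C powr (q + 1) * r powr (- \<beta> * (q + 1))"
    proof -
      have "\<bar>z t\<bar> powr (q + 1) \<le> (C * r powr - \<beta>) powr (q + 1)"
        using zt q by (intro powr_mono2) auto
      also have "\<dots> = C powr (q + 1) * r powr (- \<beta> * (q + 1))" using C r0 by (simp add: powr_mult powr_powr)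
      finally show ?thesis .
    qed
    have E: "energy 0 z u t \<le> C powr p * r powr (- (\<beta> + 1) * p) + C powr (q + 1) * r powr (- \<beta> * (q + 1))"
    proof -
      have "\<bar>u t\<bar> powr pconj / pconj \<le> \<bar>u t\<bar> powr pconj / 1"
        by (intro divide_left_mono) (use pconj(1) in auto)
      moreover have "\<bar>z t\<bar> powr (q + 1) / (q + 1) \<le> \<bar>z t\<bar> powr (q + 1) / 1"
        using q by (intro divide_left_mono) auto
      ultimately show ?thesis using u1 z1 unfolding energy_def by simp
    qed
    have tk: "t ^ n \<le> 2 ^ n * r ^ n" for n
      using t r0 power_mono[of t "2 * r" n] by (simp add: power_mult_distrib)
    have "(k + 1 - p) / p * (t ^ k * u t * z t) \<le> \<bar>(k + 1 - p) / p * (t ^ k * u t * z t)\<bar>" by (rule abs_ge_self)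
    also have "\<dots> = d * (t ^ k * (\<bar>u t\<bar> * \<bar>z t\<bar>))" unfolding d_def abs_mult using t r0 by simp
    also have "\<dots> \<le> d * ((2 ^ k * r ^ k) * ((C powr (p - 1) * r powr (- (\<beta> + 1) * (p - 1))) * (C * r powr - \<beta>)))"
      using tk[of k] u2 zt C(1) r0 t by (intro mult_left_mono mult_mono) (auto simp: d_def)
    also have "\<dots> = d * (2 ^ k * C powr p) * r powr (k + 1 - (\<beta> + 1) * p)"
    proof -
      have "C powr (p - 1) * C = C powr p" using C(1) by (simp add: powr_diff)
      moreover have "r ^ k * (r powr (- (\<beta> + 1) * (p - 1)) * r powr - \<beta>) = r powr (k + 1 - (\<beta> + 1) * p)"
      proof -
        have "k + (- (\<beta> + 1) * (p - 1) + - \<beta>) = k + 1 - (\<beta> + 1) * p" by (simp add: algebra_simps)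
        then show ?thesis
          using r0 by (simp only: powr_realpow[symmetric] powr_add[symmetric])
      qed
      moreover have "d * ((2 ^ k * r ^ k) * ((C powr (p - 1) * r powr (- (\<beta> + 1) * (p - 1))) * (C * r powr - \<beta>)))
        = d * (2 ^ k * (C powr (p - 1) * C)) * (r ^ k * (r powr (- (\<beta> + 1) * (p - 1)) * r powr - \<beta>))"
        by (simp only: mult_ac)
      ultimately show ?thesis by (simp only:)
    qed
    finally have t2: "(k + 1 - p) / p * (t ^ k * u t * z t) \<le> d * (2 ^ k * C powr p) * r powr (k + 1 - (\<beta> + 1) * p)" .
    have "t ^ Suc k * energy 0 z u t \<le> (2 ^ Suc k * r ^ Suc k) * (C powr p * r powr (- (\<beta> + 1) * p) + C powr (q + 1) * r powr (- \<beta> * (q + 1)))"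
      using tk[of "Suc k"] E energy_nonneg[of 0 z u t] r0 by (intro mult_mono) auto
    also have "\<dots> = 2 ^ Suc k * C powr p * r powr (k + 1 - (\<beta> + 1) * p) + B * r powr (k + 1 - \<beta> * (q + 1))"
    proof -
      have rp: "r ^ Suc k * r powr x = r powr (real (k + 1) + x)" for x
        using powr_realpow[OF r0(1), of "Suc k"] by (simp add: powr_add algebra_simps)
      have "(2 ^ Suc k * r ^ Suc k) * (C powr p * r powr (- (\<beta> + 1) * p) + C powr (q + 1) * r powr (- \<beta> * (q + 1)))
        = 2 ^ Suc k * C powr p * (r ^ Suc k * r powr (- (\<beta> + 1) * p)) + 2 ^ Suc k * C powr (q + 1) * (r ^ Suc k * r powr (- \<beta> * (q + 1)))"
        by (simp only: distrib_left mult_ac)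
      moreover have "real (k + 1) + - (\<beta> + 1) * p = real (k + 1) - (\<beta> + 1) * p"
        "real (k + 1) + - \<beta> * (q + 1) = real (k + 1) - \<beta> * (q + 1)"
        by (simp_all add: algebra_simps)
      ultimately show ?thesis by (simp only: rp B_def)
    qed
    finally have t1: "t ^ Suc k * energy 0 z u t \<le> 2 ^ Suc k * C powr p * r powr (k + 1 - (\<beta> + 1) * p) + B * r powr (k + 1 - \<beta> * (q + 1))" .
    have "pohozaev z u t \<le> A * r powr (k + 1 - (\<beta> + 1) * p) + B * r powr (k + 1 - \<beta> * (q + 1))"
      unfolding pohozaev_def A_def distrib_right[of "2 ^ Suc k * C powr p"] using t1 t2 by linarith
    then show ?thesis using t(1) by (intro exI[of _ t]) auto
  qed
  have neg0: "((\<lambda>r::real. r powr x) \<longlongrightarrow> 0) at_top" if "x < 0" for x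
    using that by real_asymp
  have "((\<lambda>r. A * r powr (k + 1 - (\<beta> + 1) * p) + B * r powr (k + 1 - \<beta> * (q + 1))) \<longlongrightarrow> A * 0 + B * 0) at_top"
    using \<beta> by (intro tendsto_intros neg0) auto
  then have "eventually (\<lambda>r. A * r powr (k + 1 - (\<beta> + 1) * p) + B * r powr (k + 1 - \<beta> * (q + 1)) < pohozaev z u 1) at_top"
    by (rule order_tendstoD(2)) (use pohozaev_pos[OF s z0 subcrit, of 1] in auto)
  then obtain r where r: "r \<ge> max R2 1"
    "A * r powr (k + 1 - (\<beta> + 1) * p) + B * r powr (k + 1 - \<beta> * (q + 1)) < pohozaev z u 1"
    unfolding eventually_at_top_linorder by (metis max.cobounded1 max.cobounded2 order_refl)
  then obtain t where "t \<ge> r" "pohozaev z u t < pohozaev z u 1"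
    using bound[of r] by force
  moreover have "pohozaev z u 1 \<le> pohozaev z u t"
    using \<open>t \<ge> r\<close> r(1) by (intro pohozaev_mono[OF s z0 subcrit]) auto
  ultimately show False by simp
qed

end

subsection \<open>Large initial values\<close>

lemma continuous_on_atLeast_0I:
  fixes f :: "real \<Rightarrow> 'a::topological_space"
  assumes "\<And>n. continuous_on {0..real n} f"
  shows "continuous_on {0..} f"
  unfolding continuous_on_eq_continuous_within
proof
  fix x :: real assume x: "x \<in> {0..}"
  obtain n where n: "x < real n" using reals_Archimedean2 by blast
  have "at x within {0..} = at x within {0..real n}"
    by (rule at_within_nhd[of x "{..<real n}"]) (use n in auto)
  moreover have "continuous (at x within {0..real n}) f"
    using assms[of n] x n by (simp add: continuous_on_eq_continuous_within)
  ultimately show "continuous (at x within {0..}) f" by simp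
qed

lemma has_real_derivative_uniform_limit:
  fixes f f' :: "nat \<Rightarrow> real \<Rightarrow> real"
  assumes "\<And>n x. a < x \<Longrightarrow> x < b \<Longrightarrow> (f n has_real_derivative f' n x) (at x)"
    and ul: "uniform_limit {a<..<b} f' g' sequentially"
    and lim: "\<And>x. a < x \<Longrightarrow> x < b \<Longrightarrow> (\<lambda>n. f n x) \<longlonglongrightarrow> F x"
    and x: "a < x" "x < b"
  shows "(F has_real_derivative g' x) (at x)"
proof -
  let ?S = "{a<..<b}"
  have "\<exists>g. \<forall>y\<in>?S. (\<lambda>n. f n y) \<longlonglongrightarrow> g y \<and> (g has_derivative (\<lambda>h. h * g' y)) (at y within ?S)"
  proof (rule has_derivative_sequence[where ?x0.0 = x and f' = "\<lambda>n y h. h * f' n y"])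
    show "(f n has_derivative (\<lambda>h. h * f' n y)) (at y within ?S)" if "y \<in> ?S" for n y
    proof -
      have "(\<lambda>h. h * f' n y) = (*) (f' n y)" by (auto simp: mult.commute)
      then show ?thesis
        using assms(1)[of y n] that by (auto simp: has_field_derivative_def intro: has_derivative_at_withinI)
    qed
    show "\<forall>\<^sub>F n in sequentially. \<forall>y\<in>?S. \<forall>h. norm (h * f' n y - h * g' y) \<le> e * norm h" if "e > 0" for e
      using uniform_limitD[OF ul that]
    proof eventually_elim
      case (elim n)
      show ?case
      proof (intro ballI allI)
        fix y h assume "y \<in> ?S"
        then have "\<bar>h\<bar> * \<bar>f' n y - g' y\<bar> \<le> \<bar>h\<bar> * e"
          using elim by (intro mult_left_mono) (auto simp: dist_real_def less_imp_le)
        then show "norm (h * f' n y - h * g' y) \<le> e * norm h"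
          by (simp add: abs_mult mult.commute flip: right_diff_distrib)
      qed
    qed
    show "(\<lambda>n. f n x) \<longlonglongrightarrow> F x" using lim x by blast
  qed (use x in auto)
  then obtain G where G: "\<And>y. y \<in> ?S \<Longrightarrow> (\<lambda>n. f n y) \<longlonglongrightarrow> G y"
    "\<And>y. y \<in> ?S \<Longrightarrow> (G has_derivative (\<lambda>h. h * g' y)) (at y within ?S)" by blast
  have eq: "F y = G y" if "y \<in> ?S" for y
    using LIMSEQ_unique[OF lim G(1)[OF that]] that by auto
  have "(G has_derivative (\<lambda>h. h * g' x)) (at x)"
    using G(2)[of x] x at_within_open[of x ?S] by auto
  moreover have "(\<lambda>h. h * g' x) = (*) (g' x)" by (auto simp: mult.commute)
  ultimately have "(G has_real_derivative g' x) (at x)"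
    by (simp add: has_field_derivative_def)
  then show ?thesis
    by (rule has_field_derivative_transform_within_open[of _ _ _ ?S]) (use eq x in auto)
qed

text \<open>Arzela-Ascoli on each interval combined with a diagonal subsequence. The limits on
  nested intervals agree pointwise and are glued to a single \<open>H\<close>.\<close>

lemma diagonal_uniform_limit:
  fixes F :: "nat \<Rightarrow> real \<Rightarrow> 'b::{real_normed_vector,heine_borel}"
  assumes bound: "\<And>R :: nat. \<exists>M. \<forall>n. \<forall>x\<in>{0..real R}. norm (F n x) \<le> M"
    and lip: "\<And>R :: nat. \<exists>L>0. \<forall>n. \<forall>x\<in>{0..real R}. \<forall>y\<in>{0..real R}. norm (F n x - F n y) \<le> L * \<bar>x - y\<bar>"
  obtains r H where "strict_mono (r :: nat \<Rightarrow> nat)" "\<And>R :: nat. uniform_limit {0..real R} (\<lambda>i. F (r i)) H sequentially"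
proof -
  interpret subseqs "\<lambda>R s. \<exists>g. uniform_limit {0..real R} (\<lambda>i. F (s i)) g sequentially"
  proof
    fix R and s :: "nat \<Rightarrow> nat" assume "strict_mono s"
    obtain M where M: "\<And>n x. x \<in> {0..real R} \<Longrightarrow> norm (F n x) \<le> M" using bound[of R] by blast
    obtain L where L: "L > 0" "\<And>n x y. x \<in> {0..real R} \<Longrightarrow> y \<in> {0..real R} \<Longrightarrow> norm (F n x - F n y) \<le> L * \<bar>x - y\<bar>"
      using lip[of R] by blast
    have equi: "\<exists>d>0. \<forall>n y. y \<in> {0..real R} \<and> norm (x - y) < d \<longrightarrow> norm (F (s n) x - F (s n) y) < e"
      if x: "x \<in> {0..real R}" and e: "e > 0" for x e
    proof (intro exI[of _ "e / L"] conjI allI impI)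
      show "e / L > 0" using e L by simp
      fix n y assume y: "y \<in> {0..real R} \<and> norm (x - y) < e / L"
      then have "norm (F (s n) x - F (s n) y) \<le> L * \<bar>x - y\<bar>" using L(2) x by blast
      also have "\<dots> < L * (e / L)" using y L(1) by (intro mult_strict_left_mono) auto
      finally show "norm (F (s n) x - F (s n) y) < e" using L(1) by simp
    qed
    obtain g and k :: "nat \<Rightarrow> nat" where gk: "strict_mono k"
      "\<And>e. e > 0 \<Longrightarrow> \<exists>N. \<forall>n x. n \<ge> N \<and> x \<in> {0..real R} \<longrightarrow> norm (F (s (k n)) x - g x) < e"
      using Arzela_Ascoli[of "{0..real R}" "\<lambda>n. F (s n)" M, OF compact_Icc M equi] by metis
    have "uniform_limit {0..real R} (\<lambda>i. F ((s \<circ> k) i)) g sequentially"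
      unfolding uniform_limit_sequentially_iff dist_norm o_def using gk(2) by blast
    then show "\<exists>r'. strict_mono r' \<and> (\<exists>g. uniform_limit {0..real R} (\<lambda>i. F ((s \<circ> r') i)) g sequentially)"
      using gk(1) by blast
  qed
  have stable: "\<exists>g. uniform_limit {0..real R} (\<lambda>i. F ((s \<circ> t) i)) g sequentially"
    if t: "strict_mono t" and ex: "\<exists>g. uniform_limit {0..real R} (\<lambda>i. F (s i)) g sequentially" for t s R
  proof -
    obtain g where "uniform_limit {0..real R} (\<lambda>i. F (s i)) g sequentially" using ex by blast
    then have "uniform_limit {0..real R} (\<lambda>i. F ((s \<circ> t) i)) g sequentially"
      unfolding uniform_limit_sequentially_iff o_def
      using t by (meson order_trans seq_suble)
    then show ?thesis by blast
  qed
  have "\<exists>g. uniform_limit {0..real R} (\<lambda>i. F (diagseq i)) g sequentially" for R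
  proof -
    \<comment> \<open>Only the tail of the diagonal sequence from index \<open>Suc R\<close> on is a
      subsequence of the \<open>R\<close>-th one; the shift is undone below.\<close>
    obtain g where g: "uniform_limit {0..real R} (\<lambda>i. F ((diagseq \<circ> (+) (Suc R)) i)) g sequentially"
      using diagseq_holds[of R] stable by blast
    have "\<exists>N. \<forall>n\<ge>N. \<forall>x\<in>{0..real R}. dist (F (diagseq n) x) (g x) < e" if "e > 0" for e
    proof -
      have "\<exists>N. \<forall>n\<ge>N. \<forall>x\<in>{0..real R}. dist (F (diagseq (Suc R + n)) x) (g x) < e"
        using g that unfolding uniform_limit_sequentially_iff by simp
      then obtain N where N: "\<And>n x. n \<ge> N \<Longrightarrow> x \<in> {0..real R} \<Longrightarrow> dist (F (diagseq (Suc R + n)) x) (g x) < e"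
        by blast
      have "dist (F (diagseq n) x) (g x) < e" if "n \<ge> N + Suc R" "x \<in> {0..real R}" for n x
        using N[of "n - Suc R" x] that by simp
      then show ?thesis by blast
    qed
    then have "uniform_limit {0..real R} (\<lambda>i. F (diagseq i)) g sequentially"
      unfolding uniform_limit_sequentially_iff by blast
    then show ?thesis by blast
  qed
  then have "\<forall>R. \<exists>g. uniform_limit {0..real R} (\<lambda>i. F (diagseq i)) g sequentially" by (rule allI)
  from choice[OF this] obtain G
    where "\<forall>R. uniform_limit {0..real R} (\<lambda>i. F (diagseq i)) (G R) sequentially" by (rule exE)
  then have G: "uniform_limit {0..real R} (\<lambda>i. F (diagseq i)) (G R) sequentially" for R by (rule spec)
  define H where "H = (\<lambda>x. G (nat \<lceil>x\<rceil>) x)"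
  have eq: "G R x = H x" if "x \<in> {0..real R}" for R x
  proof -
    have "x \<in> {0..real (nat \<lceil>x\<rceil>)}" using that by (auto simp: real_nat_ceiling_ge)
    from LIMSEQ_unique[OF tendsto_uniform_limitI[OF G that] tendsto_uniform_limitI[OF G this]]
    show ?thesis by (simp add: H_def)
  qed
  have "uniform_limit {0..real R} (\<lambda>i. F (diagseq i)) H sequentially" for R
    using G[of R] uniform_limit_cong'[of "{0..real R}" "\<lambda>i. F (diagseq i)" "\<lambda>i. F (diagseq i)" "G R" H] eq by blast
  then show ?thesis by (rule that[OF subseq_diagseq])
qed

context plap
begin

section \<open>Rescaling and the passage to the Emden-Fowler limit\<close>

text \<open>The flux scales by \<open>c\<close> because \<open>w'\<close> scales by
  \<open>a * lam\<close>. The choice of \<open>lam\<close> gives \<open>c * lam = a powr q\<close>,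
  which leaves \<open>g\<close> with coefficient 1; the drag and the linear term both pick up
  \<open>a / (a powr q)\<close>.\<close>

lemma sol_rescale:
  assumes s: "sol 1 w v" and a: "a > 0" and lam: "lam = a powr ((q + 1 - p) / p)" and c: "c = (a * lam) powr (p - 1)"
  shows "sol (a powr (1 - q)) (\<lambda>r. w (r / lam) / a) (\<lambda>r. v (r / lam) / c)"
proof -
  have pos: "lam > 0" "c > 0" using a lam c by auto
  define A where "A = a powr q"
  have A: "A > 0" "a powr (1 - q) = a / A" "(1 / a) powr q = 1 / A"
    using a by (auto simp: A_def powr_diff powr_divide)
  have cl: "c * lam = A"
  proof -
    have "c * lam = a powr (p - 1) * (lam powr (p - 1) * lam)"
      using a pos(1) by (simp add: c powr_mult)
    also have "lam powr (p - 1) * lam = lam powr p" using pos(1) by (simp add: powr_diff)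
    also have "lam powr p = a powr (q + 1 - p)" using p by (simp add: lam powr_powr)
    also have "a powr (p - 1) * a powr (q + 1 - p) = A"
      unfolding A_def powr_add[symmetric] by simp
    finally show ?thesis .
  qed
  have phi: "\<phi> (x / c) = \<phi> x / (a * lam)" for x
  proof -
    have "\<phi> (x / c) = (1 / c) powr (pconj - 1) * \<phi> x"
      using pflux_scale[of "1 / c" pconj x] pos(2) by simp
    also have "(1 / c) powr (pconj - 1) = 1 / (c powr (1 / (p - 1)))"
      using pos(2) by (simp add: powr_divide pconj(2))
    also have "c powr (1 / (p - 1)) = a * lam"
      using p a pos(1) by (simp add: c powr_powr)
    finally show ?thesis by simp
  qed
  have gA: "g (x / a) = g x / A" for x
    using pflux_scale[of "1 / a" "q + 1" x] a A by simp
  show ?thesis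
    unfolding sol_def
  proof (intro conjI allI impI)
    show "continuous_on {0..} (\<lambda>r. w (r / lam) / a)"
      by (intro continuous_intros continuous_on_compose2[OF sol_cont(1)[OF s]]) (use pos a in auto)
    show "continuous_on {0..} (\<lambda>r. v (r / lam) / c)"
      by (intro continuous_intros continuous_on_compose2[OF sol_cont(2)[OF s]]) (use pos a in auto)
    show "v (0 / lam) / c = 0" using sol_v0[OF s] by simp
    fix r :: real assume r: "r > 0"
    then have rl: "r / lam > 0" using pos by simp
    have dl: "((\<lambda>r. r / lam) has_real_derivative 1 / lam) (at r)"
      using pos(1) by (auto intro!: derivative_eq_intros)
    have "((\<lambda>r. w (r / lam) / a) has_real_derivative \<phi> (v (r / lam)) * (1 / lam) / a) (at r)"
      by (intro DERIV_cdivide DERIV_chain2[OF sol_w[OF s rl] dl])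
    then show "((\<lambda>r. w (r / lam) / a) has_real_derivative \<phi> (v (r / lam) / c)) (at r)"
      by (elim DERIV_cong) (simp add: phi mult.commute)
    have "((\<lambda>r. v (r / lam) / c) has_real_derivative
       (- (k / (r / lam)) * v (r / lam) - 1 * (r / lam * \<phi> (v (r / lam)) + \<alpha> * w (r / lam)) - g (w (r / lam))) * (1 / lam) / c) (at r)"
      by (intro DERIV_cdivide DERIV_chain2[OF sol_v[OF s rl] dl])
    then show "((\<lambda>r. v (r / lam) / c) has_real_derivative
       - (k / r) * (v (r / lam) / c) - a powr (1 - q) * (r * \<phi> (v (r / lam) / c) + \<alpha> * (w (r / lam) / a)) - g (w (r / lam) / a)) (at r)"
    proof (elim DERIV_cong)
      define X Y W where "X = v (r / lam)" "Y = \<phi> (v (r / lam))" "W = w (r / lam)"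
      have "(- (k / (r / lam)) * X - 1 * (r / lam * Y + \<alpha> * W) - g W) * (1 / lam) / c
        = - (k / r) * (X / c) - (r / lam * Y + \<alpha> * W) / (c * lam) - g W / (c * lam)"
        using pos r by (simp add: field_simps)
      also have "\<dots> = - (k / r) * (X / c) - a / A * (r * (Y / (a * lam)) + \<alpha> * (W / a)) - g W / A"
        unfolding cl using pos r a A(1) by (simp add: field_simps)
      finally show "(- (k / (r / lam)) * v (r / lam) - 1 * (r / lam * \<phi> (v (r / lam)) + \<alpha> * w (r / lam)) - g (w (r / lam))) * (1 / lam) / c
        = - (k / r) * (v (r / lam) / c) - a powr (1 - q) * (r * \<phi> (v (r / lam) / c) + \<alpha> * (w (r / lam) / a)) - g (w (r / lam) / a)"
        unfolding X_Y_W_def phi gA A(2) .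
    qed
  qed
qed

text \<open>The singular term \<open>(k / r) * v r\<close> is bounded by \<open>flux_linear\<close>.
  The constant is uniform in \<open>\<epsilon>\<close>, as equicontinuity of the rescaled fluxes
  requires.\<close>

lemma flux_lipschitz:
  obtains C where "C > 0"
    "\<And>\<epsilon> w v x y. \<lbrakk>sol \<epsilon> w v; 0 \<le> \<epsilon>; \<epsilon> \<le> 1; \<bar>w 0\<bar> \<le> A; 0 \<le> x; x \<le> y; y \<le> R\<rbrakk> \<Longrightarrow> \<bar>v y - v x\<bar> \<le> C * (y - x)"
proof -
  obtain M where M: "M \<ge> 1" "\<And>\<epsilon> w v r. \<lbrakk>sol \<epsilon> w v; 0 \<le> \<epsilon>; \<epsilon> \<le> 1; \<bar>w 0\<bar> \<le> A; r \<ge> 0\<rbrakk> \<Longrightarrow> \<bar>w r\<bar> \<le> M \<and> \<bar>v r\<bar> \<le> M"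
    using sol_bounded[of A] by blast
  obtain C1 where C1: "C1 > 0"
    "\<And>\<epsilon> w v r. \<lbrakk>sol \<epsilon> w v; 0 \<le> \<epsilon>; \<epsilon> \<le> 1; \<bar>w 0\<bar> \<le> A; 0 \<le> r; r \<le> R\<rbrakk> \<Longrightarrow> \<bar>v r\<bar> \<le> C1 * r"
    using flux_linear[of A R] by blast
  define C where "C = k * C1 + (\<bar>R\<bar> * M powr (pconj - 1) + \<alpha> * M) + M powr (q - 1) * M"
  have "C > 0" unfolding C_def using M(1) alpha C1(1) by (intro add_pos_nonneg add_nonneg_pos) auto
  moreover have "\<bar>v y - v x\<bar> \<le> C * (y - x)"
    if s: "sol \<epsilon> w v" and e: "0 \<le> \<epsilon>" "\<epsilon> \<le> 1" and A: "\<bar>w 0\<bar> \<le> A" and r: "0 \<le> x" "x \<le> y" "y \<le> R" for \<epsilon> w v x y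
  proof -
    have bd: "\<bar>w r\<bar> \<le> M" "\<bar>v r\<bar> \<le> M" if "r \<ge> 0" for r using M(2)[OF s e A that] by auto
    have "\<bar>v y - v x\<bar> \<le> C * y - C * x"
    proof (rule deriv_abs_dominated[where F = v and G = "\<lambda>r. C * r" and G' = "\<lambda>_. C"
          and F' = "\<lambda>r. - (k / r) * v r - \<epsilon> * (r * \<phi> (v r) + \<alpha> * w r) - g (w r)"])
      show "continuous_on {x..y} v" using r by (intro sol_cont_on(2)[OF s]) auto
      fix t assume t: "x < t" "t < y"
      then have t0: "t > 0" using r by simp
      show "(v has_real_derivative - (k / t) * v t - \<epsilon> * (t * \<phi> (v t) + \<alpha> * w t) - g (w t)) (at t)"
        by (rule sol_v[OF s t0])
      have "(k / t) * \<bar>v t\<bar> \<le> (k / t) * (C1 * t)"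
        using C1(2)[OF s e A, of t] t t0 r by (intro mult_left_mono) auto
      then have 1: "\<bar>- (k / t) * v t\<bar> \<le> k * C1" using t0 by (simp add: abs_mult)
      have "\<bar>t * \<phi> (v t) + \<alpha> * w t\<bar> \<le> \<bar>t * \<phi> (v t)\<bar> + \<bar>\<alpha> * w t\<bar>" by (rule abs_triangle_ineq)
      also have "\<bar>t * \<phi> (v t)\<bar> \<le> \<bar>R\<bar> * M powr (pconj - 1)"
        unfolding abs_mult using t r t0 bd[of t] by (intro mult_mono abs_phi_le) auto
      also have "\<bar>\<alpha> * w t\<bar> \<le> \<alpha> * M" using t0 bd(1)[of t] alpha by (simp add: abs_mult)
      finally have "\<epsilon> * \<bar>t * \<phi> (v t) + \<alpha> * w t\<bar> \<le> 1 * (\<bar>R\<bar> * M powr (pconj - 1) + \<alpha> * M)"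
        using e by (intro mult_mono) auto
      then have 2: "\<bar>\<epsilon> * (t * \<phi> (v t) + \<alpha> * w t)\<bar> \<le> \<bar>R\<bar> * M powr (pconj - 1) + \<alpha> * M"
        using e by (simp add: abs_mult)
      have 3: "\<bar>g (w t)\<bar> \<le> M powr (q - 1) * M"
        using abs_g_le[of "w t" M] bd[of t] t0 mult_left_mono[of "\<bar>w t\<bar>" M "M powr (q - 1)"] by simp
      have tri: "\<bar>X - Y - Z\<bar> \<le> \<bar>X\<bar> + \<bar>Y\<bar> + \<bar>Z\<bar>" for X Y Z :: real by linarith
      show "\<bar>- (k / t) * v t - \<epsilon> * (t * \<phi> (v t) + \<alpha> * w t) - g (w t)\<bar> \<le> C"
        unfolding C_def by (rule order_trans[OF tri]) (intro add_mono 1 2 3)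
    qed (use r in \<open>auto intro!: continuous_intros derivative_eq_intros\<close>)
    then show ?thesis by (simp add: right_diff_distrib)
  qed
  ultimately show ?thesis by (rule that)
qed

lemma limit_solution:
  assumes s: "\<And>n. sol (\<epsilon> n) (zs n) (us n)" and e: "\<And>n. 0 \<le> \<epsilon> n" "\<And>n. \<epsilon> n \<le> 1" "\<epsilon> \<longlonglongrightarrow> 0"
    and z0: "\<And>n. zs n 0 = 1"
  obtains r z u where "strict_mono (r :: nat \<Rightarrow> nat)" "sol 0 z u" "z 0 = 1"
    "\<And>x. x \<ge> 0 \<Longrightarrow> (\<lambda>n. zs (r n) x) \<longlonglongrightarrow> z x"
proof -
  obtain M where M: "M \<ge> 1" "\<And>\<epsilon> w v r. \<lbrakk>sol \<epsilon> w v; 0 \<le> \<epsilon>; \<epsilon> \<le> 1; \<bar>w 0\<bar> \<le> 1; r \<ge> 0\<rbrakk> \<Longrightarrow> \<bar>w r\<bar> \<le> M \<and> \<bar>v r\<bar> \<le> M"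
    using sol_bounded[of 1] by blast
  have bd: "\<bar>zs n x\<bar> \<le> M" "\<bar>us n x\<bar> \<le> M" if "x \<ge> 0" for n x
    using M(2)[OF s e(1,2) _ that] z0 by auto
  \<comment> \<open>Pairing the two components yields one subsequence for both.\<close>
  define F where "F = (\<lambda>n x. (zs n x, us n x))"
  obtain r H where r: "strict_mono (r :: nat \<Rightarrow> nat)" and H: "\<And>R :: nat. uniform_limit {0..real R} (\<lambda>i. F (r i)) H sequentially"
  proof (rule diagonal_uniform_limit[of F])
    fix R :: nat
    have "norm (F n x) \<le> M + M" if "x \<in> {0..real R}" for n x
      using bd[of x n] that norm_Pair_le[of "zs n x" "us n x"] by (auto simp: F_def)
    then show "\<exists>M. \<forall>n. \<forall>x\<in>{0..real R}. norm (F n x) \<le> M" by blast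
    obtain C where C: "C > 0"
      "\<And>\<epsilon> w v x y. \<lbrakk>sol \<epsilon> w v; 0 \<le> \<epsilon>; \<epsilon> \<le> 1; \<bar>w 0\<bar> \<le> 1; 0 \<le> x; x \<le> y; y \<le> real R\<rbrakk> \<Longrightarrow> \<bar>v y - v x\<bar> \<le> C * (y - x)"
      using flux_lipschitz[of 1 "real R"] by blast
    let ?L = "M powr (pconj - 1) + C"
    have "?L > 0" using C by (simp add: add_nonneg_pos)
    have one: "norm (F n x - F n y) \<le> ?L * \<bar>x - y\<bar>" if "0 \<le> x" "x \<le> y" "y \<le> real R" for n x y
    proof -
      have "norm (F n x - F n y) \<le> \<bar>zs n x - zs n y\<bar> + \<bar>us n x - us n y\<bar>"
        unfolding F_def using norm_Pair_le[of "zs n x - zs n y" "us n x - us n y"] by simp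
      also have "\<dots> \<le> M powr (pconj - 1) * (y - x) + C * (y - x)"
        using sol_w_lipschitz[OF s[of n] bd(2)[of _ n] that(1,2)] C(2)[OF s e(1,2) _ that, of n] z0[of n]
        by (simp add: abs_minus_commute)
      finally show ?thesis using that by (simp add: distrib_right)
    qed
    have "norm (F n x - F n y) \<le> ?L * \<bar>x - y\<bar>" if "x \<in> {0..real R}" "y \<in> {0..real R}" for n x y
      using one[of x y n] one[of y x n] that
      by (cases "x \<le> y") (auto simp: norm_minus_commute abs_minus_commute)
    then show "\<exists>L>0. \<forall>n. \<forall>x\<in>{0..real R}. \<forall>y\<in>{0..real R}. norm (F n x - F n y) \<le> L * \<bar>x - y\<bar>"
      using \<open>?L > 0\<close> by blast
  qed (rule that)
  define z where "z = (\<lambda>x. fst (H x))"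
  define u where "u = (\<lambda>x. snd (H x))"
  have ptw: "(\<lambda>i. F (r i) x) \<longlonglongrightarrow> H x" if "x \<ge> 0" for x
    using tendsto_uniform_limitI[OF H[of "nat \<lceil>x\<rceil>"], of x] that by (auto simp: real_nat_ceiling_ge)
  have zlim: "(\<lambda>i. zs (r i) x) \<longlonglongrightarrow> z x" and ulim: "(\<lambda>i. us (r i) x) \<longlonglongrightarrow> u x" if "x \<ge> 0" for x
    using tendsto_fst[OF ptw[OF that]] tendsto_snd[OF ptw[OF that]] by (auto simp: F_def z_def u_def)
  have contF: "continuous_on {0..real R} (F n)" for n R
    unfolding F_def by (intro continuous_intros sol_cont_on[OF s]) auto
  have contH: "continuous_on {0..} H"
    by (rule continuous_on_atLeast_0I, rule uniform_limit_theorem[OF _ H]) (auto intro: contF always_eventually)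
  have e0: "(\<lambda>i. \<epsilon> (r i)) \<longlonglongrightarrow> 0" using LIMSEQ_subseq_LIMSEQ[OF e(3) r] by (simp add: o_def)
  have deriv: "(z has_real_derivative \<phi> (u x)) (at x) \<and>
    (u has_real_derivative - (k / x) * u x - 0 * (x * \<phi> (u x) + \<alpha> * z x) - g (z x)) (at x)" if x: "x > 0" for x
  proof -
    \<comment> \<open>Away from 0 the quotient \<open>k / y\<close> is continuous on the compact box
      \<open>?B\<close>. Since \<open>\<epsilon>\<close> is one of the coordinates, the right-hand
      side is a single uniformly continuous function, and uniform convergence passes through
      it.\<close>
    define a b where "a = x / 2" "b = x + 1"
    have ab: "0 < a" "a < x" "x < b" using x by (auto simp: a_b_def)
    let ?S = "{a<..<b}"
    let ?B = "{0..1::real} \<times> {a..b} \<times> {-M..M} \<times> {-M..M}"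
    have ul: "uniform_limit ?S (\<lambda>i y. (\<epsilon> (r i), y, F (r i) y)) (\<lambda>y. (0, y, H y)) sequentially"
    proof (rule uniform_limitI)
      fix \<eta> :: real assume "\<eta> > 0"
      obtain R :: nat where "b < real R" using reals_Archimedean2 by blast
      then have sub: "?S \<subseteq> {0..real R}" using ab by auto
      have "\<forall>\<^sub>F i in sequentially. \<forall>y\<in>?S. dist (F (r i) y) (H y) < \<eta> / 2"
        using uniform_limitD[OF uniform_limit_on_subset[OF H[of R] sub], of "\<eta> / 2"] \<open>\<eta> > 0\<close> by simp
      moreover have "\<forall>\<^sub>F i in sequentially. dist (\<epsilon> (r i)) 0 < \<eta> / 2"
        using tendstoD[OF e0, of "\<eta> / 2"] \<open>\<eta> > 0\<close> by simp
      ultimately show "\<forall>\<^sub>F i in sequentially. \<forall>y\<in>?S. dist (\<epsilon> (r i), y, F (r i) y) (0, y, H y) < \<eta>"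
      proof eventually_elim
        case (elim i)
        show ?case
        proof
          fix y assume "y \<in> ?S"
          have "dist (\<epsilon> (r i), y, F (r i) y) (0, y, H y) \<le> dist (\<epsilon> (r i)) 0 + dist (F (r i) y) (H y)"
            using sqrt_sum_squares_le_sum[of "dist (\<epsilon> (r i)) 0" "dist (F (r i) y) (H y)"]
            by (simp add: dist_Pair_Pair)
          then show "dist (\<epsilon> (r i), y, F (r i) y) (0, y, H y) < \<eta>"
            using elim \<open>y \<in> ?S\<close> by fastforce
        qed
      qed
    qed
    have inB: "\<forall>\<^sub>F i in sequentially. \<forall>y\<in>?S. (\<epsilon> (r i), y, F (r i) y) \<in> ?B"
    proof (rule always_eventually, intro allI ballI)
      fix i y assume "y \<in> ?S"
      then show "(\<epsilon> (r i), y, F (r i) y) \<in> ?B"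
        using e bd[of y "r i"] ab by (auto simp: F_def abs_le_iff)
    qed
    have compB: "compact ?B" by (intro compact_Times compact_Icc)
    have ulc: "uniform_limit ?S (\<lambda>i y. h (\<epsilon> (r i), y, F (r i) y)) (\<lambda>y. h (0, y, H y)) sequentially"
      if "continuous_on ?B h" for h :: "real \<times> real \<times> real \<times> real \<Rightarrow> real"
      by (rule uniform_limit_compose_uniformly_continuous_on[OF ul compact_uniformly_continuous[OF that compB] inB])
        (use compB compact_imp_closed in blast)
    have "continuous_on ?B (\<lambda>t. \<phi> (snd (snd (snd t))))"
      by (intro continuous_intros pconj(1))
    from ulc[OF this] have 1: "uniform_limit ?S (\<lambda>i y. \<phi> (us (r i) y)) (\<lambda>y. \<phi> (u y)) sequentially"
      by (simp add: F_def u_def)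
    have "continuous_on ?B (\<lambda>t. - (k / fst (snd t)) * snd (snd (snd t))
        - fst t * (fst (snd t) * \<phi> (snd (snd (snd t))) + \<alpha> * fst (snd (snd t))) - g (fst (snd (snd t))))"
      using ab q by (intro continuous_intros pconj(1)) auto
    from ulc[OF this] have 2: "uniform_limit ?S
        (\<lambda>i y. - (k / y) * us (r i) y - \<epsilon> (r i) * (y * \<phi> (us (r i) y) + \<alpha> * zs (r i) y) - g (zs (r i) y))
        (\<lambda>y. - (k / y) * u y - 0 * (y * \<phi> (u y) + \<alpha> * z y) - g (z y)) sequentially"
      by (simp add: F_def u_def z_def)
    have "(z has_real_derivative \<phi> (u x)) (at x)"
      by (rule has_real_derivative_uniform_limit[OF _ 1 zlim ab(2,3)]) (use ab in \<open>auto intro!: sol_w[OF s]\<close>)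
    moreover have "(u has_real_derivative - (k / x) * u x - 0 * (x * \<phi> (u x) + \<alpha> * z x) - g (z x)) (at x)"
    proof (rule has_real_derivative_uniform_limit[OF _ 2 ulim ab(2,3)])
      fix n y assume "a < y"
      then have "y > 0" using ab by simp
      then show "(us (r n) has_real_derivative - (k / y) * us (r n) y
          - \<epsilon> (r n) * (y * \<phi> (us (r n) y) + \<alpha> * zs (r n) y) - g (zs (r n) y)) (at y)"
        by (rule sol_v[OF s])
    qed (use ab in auto)
    ultimately show ?thesis by blast
  qed
  have "sol 0 z u"
    unfolding sol_def
  proof (intro conjI allI impI)
    show "continuous_on {0..} z" "continuous_on {0..} u"
      unfolding z_def u_def by (intro continuous_intros contH)+
    show "u 0 = 0" using LIMSEQ_unique[OF ulim[of 0]] sol_v0[OF s] by simp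
  qed (use deriv in blast)+
  moreover have "z 0 = 1" using LIMSEQ_unique[OF zlim[of 0]] z0 by simp
  ultimately show ?thesis using that r zlim by blast
qed

lemma alternating_points:
  fixes z :: "real \<Rightarrow> real"
  assumes "z 0 > 0" "\<And>R. \<exists>r>R. z r < 0" "\<And>R. \<exists>r>R. z r > 0"
  obtains x :: "nat \<Rightarrow> real" where "x 0 = 0" "\<And>i. x i < x (Suc i)" "\<And>i. z (x i) * z (x (Suc i)) < 0"
proof -
  have "\<exists>x. \<forall>n. (z (x n) \<noteq> 0 \<and> (n = 0 \<longrightarrow> x n = 0)) \<and> (x n < x (Suc n) \<and> z (x n) * z (x (Suc n)) < 0)"
  proof (rule dependent_nat_choice)
    show "\<exists>x. z x \<noteq> 0 \<and> ((0::nat) = 0 \<longrightarrow> x = 0)" using assms(1) by (intro exI[of _ 0]) auto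
    fix x and n :: nat assume "z x \<noteq> 0 \<and> (n = 0 \<longrightarrow> x = 0)"
    then consider "z x > 0" | "z x < 0" by linarith
    then show "\<exists>y. (z y \<noteq> 0 \<and> (Suc n = 0 \<longrightarrow> y = 0)) \<and> (x < y \<and> z x * z y < 0)"
    proof cases
      case 1
      then show ?thesis using assms(2)[of x] by (force simp: mult_less_0_iff)
    next
      case 2
      then show ?thesis using assms(3)[of x] by (force simp: mult_less_0_iff)
    qed
  qed
  then show ?thesis using that by blast
qed

text \<open>A sequence of counterexamples with initial values tending to infinity would, after
  rescaling, have a subsequence converging to an oscillating function. Finitely many sign changes of
  the limit survive in the approximants, and rescaling does not affect them.\<close>

lemma many_zeros:
  assumes subcrit: "(k + 1 - p) * (q + 1) < (k + 1) * p"
  obtains A where "A > 0" "\<And>w v. sol 1 w v \<Longrightarrow> w 0 \<ge> A \<Longrightarrow> enat m \<le> num_isolated_zeros w"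
proof -
  have "\<exists>A>0. \<forall>w v. sol 1 w v \<longrightarrow> w 0 \<ge> A \<longrightarrow> enat m \<le> num_isolated_zeros w"
  proof (rule ccontr)
    assume "\<not> ?thesis"
    then have "\<forall>n :: nat. \<exists>w v. sol 1 w v \<and> w 0 \<ge> real n + 1 \<and> \<not> enat m \<le> num_isolated_zeros w"
      by (metis add_nonneg_pos of_nat_0_le_iff zero_less_one)
    then obtain w v where w: "\<And>n. sol 1 (w n) (v n)" "\<And>n. w n 0 \<ge> real n + 1"
      "\<And>n. \<not> enat m \<le> num_isolated_zeros (w n)" by metis
    define a where "a = (\<lambda>n. w n 0)"
    have a: "a n \<ge> real n + 1" "a n > 0" "a n \<ge> 1" for n using w(2)[of n] by (auto simp: a_def)
    define lam where "lam = (\<lambda>n. a n powr ((q + 1 - p) / p))"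
    have lam: "lam n > 0" for n using a(2)[of n] by (simp add: lam_def)
    define zs where "zs = (\<lambda>n r. w n (r / lam n) / a n)"
    define us where "us = (\<lambda>n r. v n (r / lam n) / ((a n * lam n) powr (p - 1)))"
    define \<epsilon> where "\<epsilon> = (\<lambda>n. a n powr (1 - q))"
    have s: "sol (\<epsilon> n) (zs n) (us n)" for n
      unfolding \<epsilon>_def zs_def us_def by (rule sol_rescale[OF w(1) a(2)]) (auto simp: lam_def)
    have "filterlim (\<lambda>n. real n + 1) at_top sequentially" by real_asymp
    then have "filterlim a at_top sequentially"
      by (rule filterlim_at_top_mono) (use a in auto)
    moreover have "((\<lambda>t::real. t powr (1 - q)) \<longlongrightarrow> 0) at_top" using q by real_asymp
    ultimately have e0: "\<epsilon> \<longlonglongrightarrow> 0" unfolding \<epsilon>_def by (rule filterlim_compose[rotated])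
    have e1: "0 \<le> \<epsilon> n" "\<epsilon> n \<le> 1" for n
      using a(3)[of n] q powr_mono[of "1 - q" 0 "a n"] by (auto simp: \<epsilon>_def)
    have z0: "zs n 0 = 1" for n using a(2)[of n] by (simp add: zs_def a_def)
    obtain r z u where r: "strict_mono (r :: nat \<Rightarrow> nat)" and z: "sol 0 z u" "z 0 = 1"
      and lim: "\<And>x. x \<ge> 0 \<Longrightarrow> (\<lambda>n. zs (r n) x) \<longlonglongrightarrow> z x"
      using limit_solution[OF s e1 e0 z0] by metis
    have neg: "\<exists>r>R. z r < 0" for R
      using limit_not_eventually_nonneg[OF z(1) _ subcrit] z(2) by simp
    have pos: "\<exists>r>R. z r > 0" for R
      using limit_not_eventually_nonneg[OF sol_uminus[OF z(1)] _ subcrit] z(2) by simp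
    obtain x :: "nat \<Rightarrow> real" where x: "x 0 = 0" "\<And>i. x i < x (Suc i)" "\<And>i. z (x i) * z (x (Suc i)) < 0"
      using alternating_points[of z] z(2) neg pos by auto
    have x_nonneg: "x i \<ge> 0" for i
    proof (induction i)
      case (Suc i)
      then show ?case using x(2)[of i] by simp
    qed (simp add: x(1))
    have "eventually (\<lambda>n. zs (r n) (x i) * zs (r n) (x (Suc i)) < 0) sequentially" for i
      by (rule order_tendstoD(2)[OF tendsto_mult[OF lim lim] x(3)]) (rule x_nonneg)+
    then have "eventually (\<lambda>n. \<forall>i\<in>{..<m}. zs (r n) (x i) * zs (r n) (x (Suc i)) < 0) sequentially"
      by (intro eventually_ball_finite) auto
    then obtain n where n: "\<And>i. i < m \<Longrightarrow> zs (r n) (x i) * zs (r n) (x (Suc i)) < 0"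
      unfolding eventually_sequentially by blast
    have "enat m \<le> num_isolated_zeros (w (r n))"
    proof (rule sign_changes_imp_zeros[OF w(1), where x = "\<lambda>i. x i / lam (r n)"])
      show "x i / lam (r n) < x (Suc i) / lam (r n)" for i
        using x(2)[of i] lam[of "r n"] by (rule divide_strict_right_mono)
      fix i assume "i < m"
      have "zs (r n) (x i) * zs (r n) (x (Suc i))
        = w (r n) (x i / lam (r n)) * w (r n) (x (Suc i) / lam (r n)) / (a (r n) * a (r n))"
        by (simp add: zs_def)
      then show "w (r n) (x i / lam (r n)) * w (r n) (x (Suc i) / lam (r n)) < 0"
        using n[OF \<open>i < m\<close>] a(2)[of "r n"] by (simp add: divide_less_0_iff zero_less_mult_iff not_less)
    qed (auto simp: x(1))
    then show False using w(3) by blast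
  qed
  then show ?thesis using that by blast
qed

subsection \<open>Zeros and decay along the family of solutions\<close>

lemma is_solution_imp_sol:
  assumes "is_solution (Suc k) p q \<alpha> a u"
  shows "\<exists>v. sol 1 u v" "u 0 = a"
proof -
  obtain du dv where d: "continuous_on {0..} du" "du 0 = 0" "u 0 = a"
      "\<And>r. r \<ge> 0 \<Longrightarrow> (u has_real_derivative du r) (at r within {0..})"
      "\<And>r. r \<ge> 0 \<Longrightarrow> ((\<lambda>s. pflux p (du s)) has_real_derivative dv r) (at r within {0..})"
      "\<And>r. r > 0 \<Longrightarrow> dv r + (real (Suc k) - 1) / r * pflux p (du r) + r * du r + \<alpha> * u r
                 + \<bar>u r\<bar> powr (q - 1) * u r = 0"
    using assms unfolding is_solution_def by blast
  have phi: "\<phi> (pflux p (du r)) = du r" for r using pflux_pflux[OF p] by simp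
  have "sol 1 u (\<lambda>r. pflux p (du r))"
    unfolding sol_def
  proof (intro conjI allI impI)
    show "continuous_on {0..} u"
      using d(4) by (intro DERIV_continuous_on) auto
    show "continuous_on {0..} (\<lambda>r. pflux p (du r))"
      by (intro continuous_intros p d)
    fix r :: real assume r: "r > 0"
    then have at: "at r within {0..} = at r" by (intro at_within_interior) simp
    show "(u has_real_derivative \<phi> (pflux p (du r))) (at r)"
      using d(4)[of r] r unfolding at phi by simp
    have "dv r = - (k / r) * pflux p (du r) - 1 * (r * \<phi> (pflux p (du r)) + \<alpha> * u r) - g (u r)"
      using d(6)[OF r] unfolding phi by (simp add: pflux_def[of "q + 1"])
    then show "((\<lambda>r. pflux p (du r)) has_real_derivative
        - (k / r) * pflux p (du r) - 1 * (r * \<phi> (pflux p (du r)) + \<alpha> * u r) - g (u r)) (at r)"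
      using d(5)[of r] r unfolding at by simp
  qed (simp add: d(2))
  then show "\<exists>v. sol 1 u v" "u 0 = a" using d(3) by blast+
qed

lemma card_le_num_isolated_zeros:
  assumes "sol \<epsilon> w v" "\<epsilon> \<ge> 0" "w R \<noteq> 0"
  shows "enat (card {r \<in> {0..R}. w r = 0}) \<le> num_isolated_zeros w"
proof -
  have sub: "{r \<in> {0..R}. w r = 0} \<subseteq> isolated_zeros w"
    using simple_zero_isolated[OF assms(1)] energy_pos_before[OF assms] by (auto simp: isolated_zeros_def)
  show ?thesis
    using card_mono[OF _ sub] by (simp add: num_isolated_zeros_def)
qed

text \<open>Supplies the endpoint with \<open>w R \<noteq> 0\<close> that the stability of zero
  counts requires; it exists because zeros are isolated for \<open>p < 2\<close>.\<close>

lemma exists_nonzero_beyond: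
  assumes s: "sol 1 w v" and "p < 2" "w 0 \<noteq> 0" "X \<ge> 0"
  obtains R where "R > X" "w R \<noteq> 0"
proof (cases "w (X + 1) = 0")
  case True
  have "X + 1 \<ge> 0" using assms(4) by simp
  then have "X + 1 \<in> isolated_zeros w"
    unfolding isolated_zeros_eq[OF assms(1-3)] using True by (simp add: zeros_def)
  then obtain d where d: "d > 0" "\<And>y. y \<in> zeros w \<Longrightarrow> \<bar>y - (X + 1)\<bar> < d \<Longrightarrow> y = X + 1"
    unfolding isolated_zeros_def isolated_in_iff_punctured by blast
  have "w (X + 1 + d / 2) \<noteq> 0"
    using d(2)[of "X + 1 + d / 2"] d(1) assms(4) by (auto simp: zeros_def)
  then show ?thesis using that[of "X + 1 + d / 2"] d(1) by simp
next
  case False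
  then show ?thesis using that[of "X + 1"] by simp
qed

context
  fixes w :: "real \<Rightarrow> real \<Rightarrow> real" and v :: "real \<Rightarrow> real \<Rightarrow> real" and L :: "real \<Rightarrow> real"
  assumes s: "\<And>a. sol 1 (\<lambda>r. w r a) (v a)" and init: "\<And>a. w 0 a = a"
    and L: "\<And>a. ((\<lambda>r. r powr \<alpha> * w r a) \<longlongrightarrow> L a) at_top"
begin

abbreviation Z :: "real \<Rightarrow> enat" where "Z a \<equiv> num_isolated_zeros (\<lambda>r. w r a)"

lemma Z_local:
  assumes "a0 > 0" "L a0 \<noteq> 0"
  obtains \<rho> n where "\<rho> > 0" "\<And>a. \<bar>a - a0\<bar> < \<rho> \<Longrightarrow> Z a = enat n"
proof -
  have "0 < w 0 a0" using assms by (simp add: init)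
  from Z_locally_constant[OF s[of a0] this L assms(2)]
  obtain \<rho> n where \<rho>: "\<rho> > 0"
    "\<And>u v. sol 1 u v \<Longrightarrow> \<bar>u 0 - w 0 a0\<bar> < \<rho> \<Longrightarrow> num_isolated_zeros u = enat n" by metis
  show ?thesis
  proof (rule that[OF \<rho>(1)])
    show "Z a = enat n" if "\<bar>a - a0\<bar> < \<rho>" for a using \<rho>(2)[OF s[of a]] that by (simp add: init)
  qed
qed

text \<open>If \<open>L\<close> had no zero on the half-line, \<open>Z\<close> would be locally
  constant on a connected set, hence equal to one finite number there, in conflict with
  \<open>many_zeros\<close>.\<close>

lemma L_zero_with_many_zeros:
  assumes subcrit: "(k + 1 - p) * (q + 1) < (k + 1) * p"
  obtains a where "a > B" "a > 0" "Z a \<ge> enat m" "L a = 0"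
proof -
  have "\<exists>a. a > B \<and> a > 0 \<and> Z a \<ge> enat m \<and> L a = 0"
  proof (rule ccontr)
    assume no: "\<not> ?thesis"
    obtain A where A: "A > 0" "\<And>w v. sol 1 w v \<Longrightarrow> w 0 \<ge> A \<Longrightarrow> enat m \<le> num_isolated_zeros w"
      using many_zeros[OF subcrit] by blast
    \<comment> \<open>Beyond \<open>D\<close> every solution has at least \<open>m\<close> isolated
      zeros, so the negated claim says that \<open>L\<close> does not vanish there.\<close>
    define D where "D = max A B"
    have L0: "L a \<noteq> 0" if "a > D" for a
      using no A(1) A(2)[OF s[of a]] that by (auto simp: D_def init)
    have pos: "a > 0" if "a > D" for a using that A(1) by (simp add: D_def)
    have const: "Z a = Z b" if "a > D" "b > D" for a b
    proof (rule connected_local_const[of "{D<..}" a b Z])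
      show "\<forall>a\<in>{D<..}. eventually (\<lambda>b. Z a = Z b) (at a within {D<..})"
      proof
        fix a assume "a \<in> {D<..}"
        then obtain \<rho> n where \<rho>: "\<rho> > 0" "\<And>b. \<bar>b - a\<bar> < \<rho> \<Longrightarrow> Z b = enat n"
          using Z_local[of a] L0 pos by (metis greaterThan_iff)
        then have "Z a = enat n" by simp
        then show "eventually (\<lambda>b. Z a = Z b) (at a within {D<..})"
          unfolding eventually_at using \<rho> by (intro exI[of _ \<rho>]) (auto simp: dist_real_def)
      qed
    qed (use that in auto)
    obtain \<rho> n where "\<rho> > 0" "\<And>b. \<bar>b - (D + 1)\<bar> < \<rho> \<Longrightarrow> Z b = enat n"
      using Z_local[of "D + 1"] L0 pos by (metis less_add_one)
    then have n: "Z (D + 1) = enat n" by simp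
    obtain A' where A': "A' > 0" "\<And>w v. sol 1 w v \<Longrightarrow> w 0 \<ge> A' \<Longrightarrow> enat (Suc n) \<le> num_isolated_zeros w"
      using many_zeros[OF subcrit] by blast
    have "enat (Suc n) \<le> Z (max A' (D + 1))" using A'(2)[OF s[of "max A' (D + 1)"]] by (simp add: init)
    also have "\<dots> = enat n" using const[of "max A' (D + 1)" "D + 1"] n by simp
    finally show False by simp
  qed
  then show ?thesis using that by blast
qed

text \<open>The infimum is not attained, so its solution has at most \<open>m\<close> zeros.
  Approximants from \<open>S\<close> have at least \<open>m + 1\<close>, at most one of them far
  out, which leaves \<open>m\<close> for the threshold solution.\<close>

lemma Inf_threshold:
  fixes m :: nat
  assumes subcrit: "(k + 1 - p) * (q + 1) < (k + 1) * p" and "p < 2" "\<alpha> < k + 1"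
  defines "S \<equiv> {a. a > 0 \<and> Z a \<ge> enat (m + 1)}"
  shows "S \<noteq> {}" "Inf S > 0" "finite (zeros (\<lambda>r. w r (Inf S)))"
    "card (zeros (\<lambda>r. w r (Inf S))) = m" "L (Inf S) = 0"
proof -
  obtain B where "B > 0" "\<And>w v. sol 1 w v \<Longrightarrow> w 0 \<ge> B \<Longrightarrow> enat (m + 1) \<le> num_isolated_zeros w"
    using many_zeros[OF subcrit] by blast
  then have "B \<in> S" using s[of B] by (auto simp: S_def init)
  then show ne: "S \<noteq> {}" by blast
  obtain \<eta> where \<eta>: "\<eta> > 0" "\<And>x. 0 < x \<Longrightarrow> x \<le> \<eta> \<Longrightarrow> (k + 1 - \<alpha>) * x - g x > 0"
    using small_threshold[OF assms(3)] by blast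
  obtain A where A: "A > 0" "\<And>w v r. \<lbrakk>sol 1 w v; \<bar>w 0\<bar> \<le> A; r \<ge> 0\<rbrakk> \<Longrightarrow> \<bar>w r\<bar> \<le> \<eta>"
    using sol_small[OF \<eta>(1)] by blast
  \<comment> \<open>For \<open>a \<le> A\<close> the solution remains below \<open>\<eta>\<close>
    and starts with \<open>Qfun\<close> equal to 0, so it never vanishes.\<close>
  have lower: "a > A" if "a \<in> S" for a
  proof (rule ccontr)
    assume "\<not> a > A"
    then have a: "0 < a" "a \<le> A" using that by (auto simp: S_def)
    have "w r a > 0" if "r \<ge> 0" for r
    proof (rule stays_positive[OF s \<eta>(2)])
      show "\<bar>w r a\<bar> \<le> \<eta>" if "r \<ge> 0" for r using A(2)[OF s[of a], of r] a that by (simp add: init)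
      show "Qfun 1 (\<lambda>r. w r a) (v a) 0 \<ge> 0" using sol_v0[OF s[of a]] by (simp add: Qfun_def)
    qed (use a that in \<open>auto simp: init\<close>)
    then have "zeros (\<lambda>r. w r a) = {}" by (force simp: zeros_def)
    then have "Z a = 0"
      by (simp add: num_isolated_zeros_def isolated_zeros_def isolated_in_def zero_enat_def)
    then show False using \<open>a \<in> S\<close> by (simp add: S_def zero_enat_def)
  qed
  define b where "b = Inf S"
  have bdd: "bdd_below S" using lower by (intro bdd_belowI[of _ A]) (auto intro: less_imp_le)
  have "b \<ge> A" unfolding b_def using ne lower by (intro cInf_greatest) (auto intro: less_imp_le)
  then have b: "b > 0" using A(1) by simp
  then show "Inf S > 0" by (simp add: b_def)
  have b_le: "b \<le> a" if "a \<in> S" for a unfolding b_def using that bdd by (rule cInf_lower)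
  have approx: "\<exists>a\<in>S. \<bar>a - b\<bar> < e" if e: "e > 0" for e
  proof -
    obtain a where "a \<in> S" "a < b + e" using cInf_lessD[OF ne, of "b + e"] e by (auto simp: b_def)
    then show ?thesis using b_le[of a] by (intro bexI[of _ a]) auto
  qed
  have wb: "w 0 b \<noteq> 0" "w 0 b > 0" using b by (auto simp: init)
  note iso = isolated_zeros_eq[OF s assms(2) wb(1)]
  \<comment> \<open>If the solution at \<open>b\<close> had \<open>m + 1\<close> zeros, they would
    be simple and would persist for slightly smaller initial values, against the definition of the
    infimum.\<close>
  have Zb: "\<not> enat (m + 1) \<le> Z b"
  proof
    assume *: "enat (m + 1) \<le> Z b"
    have "\<exists>T. finite T \<and> card T = m + 1 \<and> T \<subseteq> zeros (\<lambda>r. w r b)"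
    proof (cases "finite (zeros (\<lambda>r. w r b))")
      case True
      then have "m + 1 \<le> card (zeros (\<lambda>r. w r b))" using * by (simp add: num_isolated_zeros_def iso)
      then show ?thesis using obtain_subset_with_card_n by metis
    next
      case False
      then show ?thesis using infinite_arbitrarily_large by metis
    qed
    then obtain T where T: "finite T" "card T = m + 1" "T \<subseteq> zeros (\<lambda>r. w r b)" by blast
    define X where "X = Max (insert 0 T)"
    have X: "X \<ge> 0" "\<And>t. t \<in> T \<Longrightarrow> t \<le> X" using T(1) by (auto simp: X_def)
    obtain R where R: "R > X" "w R b \<noteq> 0" by (rule exists_nonzero_beyond[OF s assms(2) wb(1) X(1)]) (rule that)
    have "R > 0" using R X by simp
    have "T \<subseteq> {r \<in> {0..R}. w r b = 0}" using T(3) X(2) R(1) by (force simp: zeros_def)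
    then have "card T \<le> card {r \<in> {0..R}. w r b = 0}"
      by (rule card_mono[OF finite_zeros_before[OF s[of b] zero_le_one R(2)]])
    then have card: "m + 1 \<le> card {r \<in> {0..R}. w r b = 0}" using T(2) by simp
    obtain \<rho> where \<rho>: "\<rho> > 0" "\<And>u v. sol 1 u v \<Longrightarrow> \<bar>u 0 - w 0 b\<bar> < \<rho> \<Longrightarrow>
       u R \<noteq> 0 \<and> card {r \<in> {0..R}. u r = 0} = card {r \<in> {0..R}. w r b = 0}"
      by (rule zero_count_locally_constant[OF s[of b] wb(2) R(2) \<open>R > 0\<close>]) (rule that)
    define a where "a = b - min \<rho> b / 2"
    have a: "0 < a" "a < b" "\<bar>a - b\<bar> < \<rho>" using b \<rho>(1) by (auto simp: a_def min_def)
    have aR: "w R a \<noteq> 0" "card {r \<in> {0..R}. w r a = 0} = card {r \<in> {0..R}. w r b = 0}"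
      using \<rho>(2)[OF s[of a]] a(3) by (auto simp: init)
    have "enat (m + 1) \<le> enat (card {r \<in> {0..R}. w r a = 0})" using card aR(2) by simp
    also have "\<dots> \<le> Z a" using card_le_num_isolated_zeros[OF s[of a] _ aR(1)] by simp
    finally have "a \<in> S" using a by (simp add: S_def)
    then show False using b_le[of a] a by simp
  qed
  have fin: "finite (zeros (\<lambda>r. w r b))" and le: "card (zeros (\<lambda>r. w r b)) \<le> m"
    using Zb by (auto simp: num_isolated_zeros_def iso split: if_splits)
  then show "finite (zeros (\<lambda>r. w r (Inf S)))" by (simp add: b_def)
  \<comment> \<open>Otherwise \<open>Z\<close> is constant near \<open>b\<close>, whereas
    \<open>Z b\<close> is at most \<open>m\<close> and \<open>S\<close> comes arbitrarily close to
    \<open>b\<close>.\<close>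
  show "L (Inf S) = 0"
  proof (rule ccontr)
    assume "L (Inf S) \<noteq> 0"
    then obtain \<rho> n where \<rho>: "\<rho> > 0" "\<And>a. \<bar>a - b\<bar> < \<rho> \<Longrightarrow> Z a = enat n"
      using Z_local[OF b] by (metis b_def)
    obtain a where "a \<in> S" "\<bar>a - b\<bar> < \<rho>" using approx[OF \<rho>(1)] by blast
    moreover have "Z b = enat n" using \<rho> by simp
    ultimately show False using Zb \<rho>(2) by (simp add: S_def)
  qed
  have "m \<le> card (zeros (\<lambda>r. w r b))"
  proof -
    obtain C where C: "\<And>w v r. \<lbrakk>sol 1 w v; \<bar>w 0\<bar> \<le> b + 1; r \<ge> 1\<rbrakk> \<Longrightarrow> \<bar>w r\<bar> \<le> C * r powr - \<alpha>"
      using uniform_decay[of "b + 1"] by metis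
    have "((\<lambda>r. C * r powr - \<alpha>) \<longlongrightarrow> 0) at_top" using alpha by real_asymp
    then have "eventually (\<lambda>r. C * r powr - \<alpha> < \<eta>) at_top" by (rule order_tendstoD(2)) (rule \<eta>(1))
    then obtain R1 where R1: "\<And>r. r \<ge> R1 \<Longrightarrow> C * r powr - \<alpha> < \<eta>" by (auto simp: eventually_at_top_linorder)
    \<comment> \<open>Beyond \<open>R1\<close> all solutions with initial value in
      \<open>(0, b + 1]\<close> are below \<open>\<eta>\<close>; the final 1 puts \<open>R\<close>
      strictly behind the last zero of the solution at \<open>b\<close>.\<close>
    define R where "R = max (max R1 1) (Max (insert 0 (zeros (\<lambda>r. w r b)))) + 1"
    have R: "R \<ge> R1" "R \<ge> 1" "\<And>r. w r b = 0 \<Longrightarrow> 0 \<le> r \<Longrightarrow> r < R"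
    proof -
      show "R \<ge> R1" "R \<ge> 1" by (auto simp: R_def)
      show "r < R" if "w r b = 0" "0 \<le> r" for r
      proof -
        have "r \<le> Max (insert 0 (zeros (\<lambda>r. w r b)))" using fin that by (intro Max_ge) (auto simp: zeros_def)
        then show ?thesis by (simp add: R_def)
      qed
    qed
    have zb: "{r \<in> {0..R}. w r b = 0} = zeros (\<lambda>r. w r b)" using R(3) by (force simp: zeros_def)
    have wRb: "w R b \<noteq> 0" using R(2) R(3)[of R] by auto
    have "R > 0" using R(2) by simp
    obtain \<rho> where \<rho>: "\<rho> > 0" "\<And>u v. sol 1 u v \<Longrightarrow> \<bar>u 0 - w 0 b\<bar> < \<rho> \<Longrightarrow>
       u R \<noteq> 0 \<and> card {r \<in> {0..R}. u r = 0} = card {r \<in> {0..R}. w r b = 0}"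
      by (rule zero_count_locally_constant[OF s[of b] wb(2) wRb \<open>R > 0\<close>]) (rule that)
    obtain a where a: "a \<in> S" "\<bar>a - b\<bar> < min \<rho> 1" using approx[of "min \<rho> 1"] \<rho>(1) by auto
    have a0: "a > 0" "enat (m + 1) \<le> Z a" using a(1) by (auto simp: S_def)
    have aR: "w R a \<noteq> 0" "card {r \<in> {0..R}. w r a = 0} = card (zeros (\<lambda>r. w r b))"
      using \<rho>(2)[OF s[of a]] a(2) unfolding zb[symmetric] by (auto simp: init)
    have wa: "w 0 a \<noteq> 0" using a0 by (simp add: init)
    have "a \<le> b + 1" using a(2) by linarith
    then have small: "\<bar>w r a\<bar> \<le> \<eta>" if "r \<ge> R" for r
      using C[OF s[of a], of r] R1[of r] a0(1) R(1,2) that by (auto simp: init)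
    define Y where "Y = {r. r > R \<and> w r a = 0}"
    \<comment> \<open>Zeros beyond \<open>R\<close> lie in the region of small values and are simple
      since \<open>p < 2\<close>, so \<open>no_zero_after_zero\<close> excludes a second
      one.\<close>
    have one: "r = t" if "r \<in> Y" "t \<in> Y" for r t
    proof -
      have *: False if "x \<in> Y" "y \<in> Y" "x < y" for x y
      proof -
        have x: "x \<ge> 0" "x > R" "w x a = 0" using that(1) R(2) by (auto simp: Y_def)
        have "v a x \<noteq> 0" using all_zeros_simple[OF s assms(2) wa x(1,3)] .
        have "w y a \<noteq> 0"
          by (rule no_zero_after_zero[OF s[of a] \<eta>(2) _ x(1,3) \<open>v a x \<noteq> 0\<close> that(3)]) (use small x(2) in auto)
        then show False using that(2) by (simp add: Y_def)
      qed
      show ?thesis using *[of r t] *[of t r] that by (cases r t rule: linorder_cases) auto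
    qed
    have Yfin: "finite Y \<and> card Y \<le> 1"
    proof (cases "Y = {}")
      case False
      then obtain y where "y \<in> Y" by blast
      then have "Y = {y}" using one by blast
      then show ?thesis by simp
    qed simp
    have za: "zeros (\<lambda>r. w r a) \<subseteq> {r \<in> {0..R}. w r a = 0} \<union> Y" by (auto simp: zeros_def Y_def)
    have fina: "finite ({r \<in> {0..R}. w r a = 0} \<union> Y)"
      using finite_zeros_before[OF s[of a] _ aR(1)] Yfin by simp
    then have "card (zeros (\<lambda>r. w r a)) \<le> card ({r \<in> {0..R}. w r a = 0} \<union> Y)" using za by (intro card_mono)
    also have "\<dots> \<le> card {r \<in> {0..R}. w r a = 0} + card Y" by (rule card_Un_le)
    also have "\<dots> \<le> card (zeros (\<lambda>r. w r b)) + 1" using aR(2) Yfin by simp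
    finally have "card (zeros (\<lambda>r. w r a)) \<le> card (zeros (\<lambda>r. w r b)) + 1" .
    moreover have "m + 1 \<le> card (zeros (\<lambda>r. w r a))"
      using a0(2) finite_subset[OF za fina] isolated_zeros_eq[OF s assms(2) wa] by (simp add: num_isolated_zeros_def)
    ultimately show ?thesis by simp
  qed
  then show "card (zeros (\<lambda>r. w r (Inf S))) = m" using le by (simp add: b_def)
qed

end

end

theorem theorem3p6:
  fixes N :: nat and p q \<alpha> :: real and w :: "real \<Rightarrow> real \<Rightarrow> real"
    and Z :: "real \<Rightarrow> enat" and L :: "real \<Rightarrow> real"
  assumes "N \<ge> 1" and "p > 1" and "q > 1" and "\<alpha> > 0"
    and "p > 2 \<or> (p < 2 \<and> \<alpha> < p / (2 - p))"
    and "\<And>a. is_solution N p q \<alpha> a (\<lambda>r. w r a)"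
    and "\<And>a. Z a = num_isolated_zeros (\<lambda>r. w r a)"
    and "\<And>a. L a = decay_limit \<alpha> (\<lambda>r. w r a)"
  shows "(\<forall>a\<^sub>0>0. Z a\<^sub>0 \<noteq> \<infinity> \<and> L a\<^sub>0 \<noteq> 0 \<longrightarrow> (\<forall>\<^sub>F a in nhds a\<^sub>0. Z a = Z a\<^sub>0))
    \<and> (ereal q < qstar N p \<longrightarrow>
         \<not> bdd_above {a. a > 0 \<and> L a = 0}
         \<and> (\<exists>A :: nat \<Rightarrow> real. strict_mono A \<and> filterlim A at_top sequentially
              \<and> (\<forall>m. A m > 0 \<and> Z (A m) \<ge> enat (m + 1) \<and> L (A m) = 0)))
    \<and> (ereal q < qstar N p \<and> p < 2 \<and> \<alpha> < real N \<longrightarrow>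
         (\<forall>m :: nat.
            let S = {a. a > 0 \<and> Z a \<ge> enat (m + 1)} in
              S \<noteq> {} \<and> Inf S > 0
              \<and> (m \<ge> 1 \<longrightarrow>
                   finite (zeros (\<lambda>r. w r (Inf S))) \<and> card (zeros (\<lambda>r. w r (Inf S))) = m
                   \<and> L (Inf S) = 0)))"
proof -
  obtain k where N: "N = Suc k" using assms(1) by (cases N) auto
  \<comment> \<open>One inequality covers both alternatives for \<open>p\<close>: its left side is
    negative for \<open>p > 2\<close>.\<close>
  have gap: "\<alpha> * (2 - p) < p"
  proof (cases "p > 2")
    case True
    then have "\<alpha> * (2 - p) < 0" using assms(4) by (simp add: mult_pos_neg)
    then show ?thesis using assms(2) by simp
  next
    case False
    then show ?thesis using assms(5) pos_less_divide_eq[of "2 - p" \<alpha> p] by simp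
  qed
  interpret plap k p q \<alpha> using assms gap by unfold_locales auto
  note Z = assms(7)
  have sol: "\<exists>v. sol 1 (\<lambda>r. w r a) v" and init: "w 0 a = a" for a
    using is_solution_imp_sol[OF assms(6)[unfolded N]] by blast+
  obtain v where s: "\<And>a. sol 1 (\<lambda>r. w r a) (v a)" using sol by metis
  \<comment> \<open>\<open>decay_limit\<close> is a choice operator and says nothing until
    convergence is established.\<close>
  have L: "((\<lambda>r. r powr \<alpha> * w r a) \<longlongrightarrow> L a) at_top" for a
  proof -
    obtain l where "((\<lambda>r. r powr \<alpha> * w r a) \<longlongrightarrow> l) at_top"
      using uniform_limit_at_top[of "\<bar>w 0 a\<bar>"] s[of a] by (metis order_refl)
    moreover from this have "L a = l" unfolding assms(8) decay_limit_def by (intro tendsto_Lim) simp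
    ultimately show ?thesis by simp
  qed
  have subcrit: "(k + 1 - p) * (q + 1) < (k + 1) * p" if "ereal q < qstar N p"
  proof (cases "p < N")
    case True
    then have "q * (N - p) < N * (p - 1) + p"
      using that pos_less_divide_eq[of "N - p" q "N * (p - 1) + p"] by (simp add: qstar_def)
    then show ?thesis by (simp add: N algebra_simps)
  next
    case False
    then have "(k + 1 - p) * (q + 1) \<le> 0" using assms(3) by (simp add: N mult_le_0_iff)
    moreover have "(k + 1) * p > 0" using assms(2) by simp
    ultimately show ?thesis by simp
  qed
  have i: "\<forall>\<^sub>F a in nhds a0. Z a = Z a0" if a0: "a0 > 0" "L a0 \<noteq> 0" for a0
  proof -
    obtain \<rho> n where \<rho>: "\<rho> > 0" "\<And>a. \<bar>a - a0\<bar> < \<rho> \<Longrightarrow> num_isolated_zeros (\<lambda>r. w r a) = enat n"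
      by (rule Z_local[OF s init L a0]) (rule that)
    then have "Z a0 = enat n" by (simp add: Z)
    then show ?thesis
      unfolding eventually_nhds_metric using \<rho> by (intro exI[of _ \<rho>]) (auto simp: Z dist_real_def)
  qed
  have many: "\<exists>a>B. a > 0 \<and> Z a \<ge> enat m \<and> L a = 0" if "ereal q < qstar N p" for B m
    using L_zero_with_many_zeros[OF s init L subcrit[OF that], of B m] by (metis Z)
  have ii1: "\<not> bdd_above {a. a > 0 \<and> L a = 0}" if q': "ereal q < qstar N p"
  proof
    assume "bdd_above {a. a > 0 \<and> L a = 0}"
    then obtain B where "\<And>a. a > 0 \<Longrightarrow> L a = 0 \<Longrightarrow> a \<le> B" by (auto simp: bdd_above_def)
    then show False using many[OF q', of B 0] by force
  qed
  have ii2: "\<exists>A :: nat \<Rightarrow> real. strict_mono A \<and> filterlim A at_top sequentially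
              \<and> (\<forall>m. A m > 0 \<and> Z (A m) \<ge> enat (m + 1) \<and> L (A m) = 0)" if q': "ereal q < qstar N p"
  proof -
    \<comment> \<open>The conjunct \<open>A n \<ge> real n\<close> is carried along to force
      divergence.\<close>
    have "\<exists>A. \<forall>n. (A n > 0 \<and> Z (A n) \<ge> enat (n + 1) \<and> L (A n) = 0 \<and> A n \<ge> real n) \<and> A n < A (Suc n)"
    proof (rule dependent_nat_choice)
      show "\<exists>x. x > 0 \<and> Z x \<ge> enat (0 + 1) \<and> L x = 0 \<and> x \<ge> real 0"
        using many[OF q', of 0 1] by force
      fix x :: real and n :: nat
      obtain y where "y > max x (real (Suc n))" "y > 0" "Z y \<ge> enat (Suc n + 1)" "L y = 0"
        using many[OF q', of "max x (real (Suc n))" "Suc n + 1"] by blast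
      then show "\<exists>y. (y > 0 \<and> Z y \<ge> enat (Suc n + 1) \<and> L y = 0 \<and> y \<ge> real (Suc n)) \<and> x < y"
        by (intro exI[of _ y]) auto
    qed
    then obtain A where A: "\<And>n. A n > 0 \<and> Z (A n) \<ge> enat (n + 1) \<and> L (A n) = 0 \<and> A n \<ge> real n"
      "\<And>n. A n < A (Suc n)" by blast
    have "filterlim A at_top sequentially"
      by (rule filterlim_at_top_mono[OF filterlim_real_sequentially]) (use A(1) in auto)
    then show ?thesis using A by (intro exI[of _ A]) (auto simp: strict_mono_Suc_iff)
  qed
  have iii: "let S = {a. a > 0 \<and> Z a \<ge> enat (m + 1)} in
              S \<noteq> {} \<and> Inf S > 0
              \<and> (m \<ge> 1 \<longrightarrow>
                   finite (zeros (\<lambda>r. w r (Inf S))) \<and> card (zeros (\<lambda>r. w r (Inf S))) = m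
                   \<and> L (Inf S) = 0)"
    if "ereal q < qstar N p" "p < 2" "\<alpha> < real N" for m :: nat
  proof -
    have "\<alpha> < k + 1" using that by (simp add: N)
    from Inf_threshold[OF s init L subcrit[OF that(1)] that(2) this, of m]
    show ?thesis unfolding Let_def Z by blast
  qed
  show ?thesis
  proof (intro conjI allI impI, goal_cases)
    case (1 a0)
    then show ?case using i by blast
  next
    case 2
    then show ?case by (rule ii1)
  next
    case 3
    then show ?case by (rule ii2)
  next
    case (4 m)
    then show ?case by (elim conjE) (rule iii)
  qed
qed

end
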